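(* Let $\binom{2k}{k}$ denote the central binomial coefficient, $H_k=\sum_{n=1}^k \frac1n$ and $H_k^{(m)}=\sum_{n=1}^k\frac{1}{n^m}$ for positive integers $k,m$, let $\zeta$ be the Riemann zeta function and $\operatorname{Li}_5(z)=\sum_{k\ge1} z^k/k^5$. Then: (i) $\displaystyle\sum_{k=1}^{\infty}\frac{4^kH_k^{(3)}}{k^2\binom{2k}{k}}=\frac{217}{8}\zeta(5)-\frac92\zeta(2)\zeta(3)-16\operatorname{Li}_5\left(\tfrac12\right)-\frac{19}{2}\ln(2)\zeta(4)+\frac83\ln^3(2)\zeta(2)+\frac{2}{15}\ln^5(2)$; (ii) $\displaystyle\sum_{k=1}^{\infty}\frac{4^kH_k^{(2)}}{k^3\binom{2k}{k}}=\frac{31}{4}\zeta(5)+\frac32\zeta(2)\zeta(3)-16\operatorname{Li}_5\left(\tfrac12\right)-2\ln(2)\zeta(4)+\frac83\ln^3(2)\zeta(2)+\frac{2}{15}\ln^5(2)$; (iii) $\displaystyle\sum_{k=1}^{\infty}\frac{4^kH_k^2}{k^3\binom{2k}{k}}=-62\zeta(5)-\frac{21}{2}\zeta(2)\zeta(3)+48\operatorname{Li}_5\left(\tfrac12\right)+81\ln(2)\zeta(4)+8\ln^3(2)\zeta(2)-\frac25\ln^5(2)$; (iv) $\displaystyle\sum_{k=1}^{\infty}\frac{4^kH_k}{k^4\binom{2k}{k}}=-\frac{31}{2}\zeta(5)+3\zeta(2)\zeta(3)+16\operatorname{Li}_5\left(\tfrac12\right)+2\ln(2)\zeta(4)+\frac{16}{3}\ln^3(2)\zeta(2)-\frac{2}{15}\ln^5(2)$;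 (v) $\displaystyle\sum_{k=1}^{\infty}\frac{4^kH_kH_k^{(2)}}{k^2\binom{2k}{k}}=-\frac{155}{8}\zeta(5)+9\zeta(2)\zeta(3)+16\operatorname{Li}_5\left(\tfrac12\right)+\frac{19}{2}\ln(2)\zeta(4)+\frac{16}{3}\ln^3(2)\zeta(2)-\frac{2}{15}\ln^5(2)$; (vi) $\displaystyle\sum_{k=1}^{\infty}\frac{4^kH_k^3}{k^2\binom{2k}{k}}=-\frac{155}{8}\zeta(5)+18\zeta(2)\zeta(3)+80\operatorname{Li}_5\left(\tfrac12\right)+\frac{455}{2}\ln(2)\zeta(4)+\frac{32}{3}\ln^3(2)\zeta(2)-\frac23\ln^5(2)$.
   Context: $H_k$ is the $k$-th harmonic number and $H_k^{(m)}$ the generalized harmonic number of order $m$; $\operatorname{Li}_5$ is the pentalogarithm; $\zeta$ is the Riemann zeta function. *)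

theory Defs
  imports "HOL-Analysis.Analysis"
begin

text \<open>
  The ordinary harmonic number $H_k$ is the library's \<open>harm k\<close>; \<open>gen_harm m k\<close> is the
  generalized harmonic number $H_k^{(m)}$ of order \<open>m\<close>.
\<close>

definition gen_harm :: "nat \<Rightarrow> nat \<Rightarrow> real" where
  "gen_harm m k = (\<Sum>n = 1..k. 1 / real n ^ m)"

text \<open>
  The Riemann zeta function on its half-line of absolute convergence; the value is meaningful
  only for \<open>s > 1\<close>.
\<close>

definition zeta :: "real \<Rightarrow> real" where
  "zeta s = (\<Sum>n. 1 / real (Suc n) powr s)"

text \<open>
  The pentalogarithm; the defining series converges for \<open>norm z \<le> 1\<close> and the value is meaningful
  only there.
\<close>

definition Li5 :: "'a::{real_normed_field, banach} \<Rightarrow> 'a" where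
  "Li5 z = (\<Sum>n. z ^ Suc n / of_nat (Suc n) ^ 5)"

end

theory Submission
  imports Defs "HOL-Real_Asymp.Real_Asymp" "HOL-Complex_Analysis.Complex_Analysis"
begin

text \<open>
  Write \<open>w k = 4 ^ k / (2 k choose k)\<close>. The proof finds enough linear relations between the six sums
  and the auxiliary sum of \<open>w k / k ^ 5\<close> to solve for them.

  Two relations are discrete. The connector \<open>k! \<Gamma>(n + 1/2) / \<Gamma>(n + k + 1/2)\<close>, which equals \<open>w k\<close> at
  \<open>n = 0\<close>, telescopes in both variables; it transports sums over \<open>k\<close> with nested harmonic weights into
  sums over half-integers, where two of the combinations collapse to zeta values.

  The others come from the expansions of \<open>t\<close> and \<open>t ^ 3\<close> in the functions \<open>sin t ^ (2 k - 1) cos t\<close>,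
  whose coefficients are \<open>w k / k\<close>, respectively \<open>w k / k\<close> times \<open>gen_harm 2 (k - 1)\<close>, up to constants.
  Integrating them over \<open>[0, \<pi>/2]\<close> against powers of \<open>- 2 ln (sin t)\<close> and \<open>- 2 ln (cos t)\<close>
  produces the harmonic numbers on one side and log-sine
  integrals on the other. The reflection \<open>t \<mapsto> \<pi>/2 - t\<close> and the duplication formula for the sine reduce
  these to the integrals of \<open>t ^ j ln (sin t)\<close>, which follow from the polylogarithms on the unit
  circle, and to that of \<open>t ln (sin t) ^ 3\<close>. The latter is the imaginary part of
  \<open>ln ((1 - z) / 2) ^ 4\<close> along \<open>z = exp (2 i t)\<close>, so by Cauchy's theorem it is an integral of
  \<open>(ln ((1 - x) / 2) ^ 4 - ln 2 ^ 4) / x\<close> over \<open>[-1, 1]\<close>; this is where \<open>Li5 (1 / 2)\<close> arises.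
\<close>

section \<open>Connected sums\<close>

text \<open>There are seven unknowns. The expansion of \<open>t\<close> is used with the weights
  \<open>lgS ^ 3\<close>, \<open>lgC ^ 3\<close> and \<open>lgS * lgC * (lgS + lgC)\<close>, that of
  \<open>t ^ 3\<close> with \<open>lgS\<close> and \<open>lgC\<close>; with the two discrete
  relations this makes a regular linear system of seven equations. The obstacle is the cubic weights
  that mix both logarithms: the integrals of \<open>t * lgS ^ 2 * lgC\<close> and
  \<open>t * lgS * lgC ^ 2\<close> are not evaluated separately. Their sum is accessible because its
  weight is invariant under the reflection, so that \<open>t\<close> averages to
  \<open>pi / 4\<close>, and because the weight is a third of
  \<open>(lgS + lgC) ^ 3 - lgS ^ 3 - lgC ^ 3\<close>. Hence only this combination of mixed moments
  enters the system. All interchanges of two series, or of a series and an integral, act on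
  nonnegative terms, so the convergence of one side suffices. The shift by \<open>pi / 2\<close> in
  the log-sine integrals is the argument of \<open>1 - exp (2 i t)\<close>.\<close>

lemma sums_swap_nonneg:
  fixes a :: "nat \<Rightarrow> nat \<Rightarrow> real"
  assumes "\<And>i j. a i j \<ge> 0" and "\<And>i. a i sums r i" and "\<And>j. (\<lambda>i. a i j) sums c j" and "r sums S"
  shows "c sums S"
proof -
  have r0: "r i \<ge> 0" for i
    using sums_le[OF _ sums_zero assms(2)[of i]] assms(1) by auto
  have row: "((\<lambda>j. case (i, j) of (i, j) \<Rightarrow> a i j) has_sum r i) UNIV" for i
    using sums_nonneg_imp_has_sum[OF assms(2)] assms(1) by auto
  have "(r has_sum S) UNIV"
    using sums_nonneg_imp_has_sum[OF assms(4)] r0 by auto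
  then have "((\<lambda>(i, j). a i j) has_sum S) (UNIV \<times> UNIV)"
    using assms(1) row
    by (intro has_sum_SigmaI[where g = r] summable_on_SigmaI[where g = r])
       (auto simp: has_sum_imp_summable)
  then have "((\<lambda>(j, i). a i j) has_sum S) (UNIV \<times> UNIV)"
    by (subst (asm) has_sum_swap) simp
  moreover have "((\<lambda>i. case (j, i) of (j, i) \<Rightarrow> a i j) has_sum c j) UNIV" for j
    using sums_nonneg_imp_has_sum[OF assms(3)] assms(1) by auto
  ultimately have "(c has_sum S) UNIV"
    by (rule has_sum_SigmaD)
  then show ?thesis
    by (rule has_sum_imp_sums)
qed

definition conn :: "nat \<Rightarrow> nat \<Rightarrow> real" where
  "conn k n = fact k / pochhammer (real n + 1 / 2) k"

lemma conn_0 [simp]: "conn 0 n = 1"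
  by (simp add: conn_def)

lemma conn_pos: "conn k n > 0"
  by (simp add: conn_def pochhammer_pos add_nonneg_pos)

lemma conn_nonneg [simp]: "conn k n \<ge> 0"
  using conn_pos[of k n] by simp

lemma conn_Suc_left: "conn (Suc k) n = conn k n * (real k + 1) / (real n + 1 / 2 + real k)"
  by (simp add: conn_def pochhammer_Suc algebra_simps)

lemma conn_Suc_right: "conn k (Suc n) = conn k n * (real n + 1 / 2) / (real n + 1 / 2 + real k)"
proof -
  have "pochhammer (real n + 1 / 2) (Suc k) = (real n + 1 / 2) * pochhammer (real (Suc n) + 1 / 2) k"
    unfolding pochhammer_rec by (simp add: algebra_simps)
  moreover have "pochhammer (real n + 1 / 2) (Suc k) = pochhammer (real n + 1 / 2) k * (real n + 1 / 2 + real k)"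
    by (simp add: pochhammer_Suc)
  ultimately have e: "(real n + 1 / 2) * pochhammer (real (Suc n) + 1 / 2) k
      = pochhammer (real n + 1 / 2) k * (real n + 1 / 2 + real k)"
    by simp
  have "pochhammer (real (Suc n) + 1 / 2) k > 0" "pochhammer (real n + 1 / 2) k > 0"
    by (auto intro!: pochhammer_pos)
  moreover have "real n + 1 / 2 + real k > 0" by simp
  ultimately show ?thesis
    using e unfolding conn_def by (simp add: divide_simps del: of_nat_Suc)
qed

text \<open>With \<open>x = n + 1 / 2\<close> and \<open>k\<close> at least 1, the decrease to
  \<open>conn k (Suc n)\<close> is \<open>k / x\<close> times this value from
  \<open>conn k n\<close>, and \<open>x / k\<close> times it from
  \<open>conn (k - 1) (Suc n)\<close> (\<open>conn_diff_left\<close>). So a factor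
  \<open>1 / k\<close> can be traded for a sum over \<open>n\<close>, and a factor
  \<open>1 / x\<close> for a sum over \<open>k\<close>.\<close>

lemma conn_diff_right: "(conn k n - conn k (Suc n)) = conn k (Suc n) / (real n + 1 / 2) * real k"
proof -
  have "real n + 1 / 2 + real k > 0" "real n + 1/2 > 0" by simp_all
  then show ?thesis
    by (simp add: conn_Suc_right divide_simps) (simp add: algebra_simps)
qed

lemma conn_diff_left:
  "conn k (Suc n) - conn (Suc k) (Suc n) = conn (Suc k) (Suc n) / (real k + 1) * (real n + 1 / 2)"
proof -
  have "real n + 3 / 2 + real k > 0" "real k + 1 > 0" by simp_all
  then show ?thesis
    unfolding conn_Suc_left[of k "Suc n"] by (simp add: divide_simps) (simp add: algebra_simps)
qed

lemma conn_tendsto_right: "(\<lambda>n. conn (Suc k) n) \<longlonglongrightarrow> 0"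
proof -
  \<comment> \<open>The bound is the exact value of \<open>conn 1 (Suc n)\<close>, and
    \<open>conn\<close> decreases in its first argument here. At first argument 0 it is constantly
    1, hence the \<open>Suc k\<close>.\<close>
  have "conn (Suc k) (Suc n) \<le> 1 / (real n + 3 / 2)" for n k
  proof (induction k)
    case 0
    show ?case by (simp add: conn_Suc_left add.commute)
  next
    case (Suc k)
    have "conn (Suc (Suc k)) (Suc n) \<le> conn (Suc k) (Suc n)"
      using conn_diff_left[of "Suc k" n] conn_pos[of "Suc (Suc k)" "Suc n"]
      by (smt (verit) divide_nonneg_nonneg mult_nonneg_nonneg of_nat_0_le_iff)
    with Suc show ?case by linarith
  qed
  moreover have "(\<lambda>n. 1 / (real n + 3 / 2)) \<longlonglongrightarrow> 0"
    by real_asymp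
  ultimately have "(\<lambda>n. conn (Suc k) (Suc n)) \<longlonglongrightarrow> 0"
    using tendsto_sandwich[of "\<lambda>_. 0" "\<lambda>n. conn (Suc k) (Suc n)" sequentially "\<lambda>n. 1 / (real n + 3 / 2)" 0] by simp
  then show ?thesis
    by (rule LIMSEQ_imp_Suc)
qed

text \<open>\<open>conn k n\<close> behaves like \<open>k\<close> to the power
  \<open>1 / 2 - n\<close>, so the second argument must be at least 1, and at 1 the decay is only
  that of \<open>1 / sqrt k\<close>. Squaring gives a bound that survives induction.\<close>

lemma conn_tendsto_left: "(\<lambda>k. conn k (Suc n)) \<longlonglongrightarrow> 0"
proof -
  have sq: "(conn k 1)\<^sup>2 \<le> 1 / (real k + 1)" for k
  proof (induction k)
    case (Suc k)
    have "(conn (Suc k) 1)\<^sup>2 = (conn k 1)\<^sup>2 * ((real k + 1) / (real k + 3 / 2))\<^sup>2"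
      by (simp add: conn_Suc_left power2_eq_square add_ac)
    also have "\<dots> \<le> 1 / (real k + 1) * ((real k + 1) / (real k + 3 / 2))\<^sup>2"
      by (intro mult_right_mono Suc) auto
    also have "\<dots> = (real k + 1) / (real k + 3 / 2)\<^sup>2"
      by (simp add: power2_eq_square)
    also have "\<dots> \<le> 1 / (real (Suc k) + 1)"
      by (simp add: divide_simps power2_eq_square) (simp add: algebra_simps)
    finally show ?case .
  qed simp
  have "conn k 1 \<le> sqrt (1 / (real k + 1))" for k
    using real_le_rsqrt[OF sq] .
  moreover have "conn k (Suc n) \<le> conn k 1" for k
  proof (induction n)
    case (Suc n)
    have "conn k (Suc (Suc n)) \<le> conn k (Suc n)"
      using conn_diff_right[of k "Suc n"] conn_pos[of k "Suc (Suc n)"]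
      by (smt (verit) divide_nonneg_nonneg mult_nonneg_nonneg of_nat_0_le_iff)
    with Suc show ?case by linarith
  qed simp
  ultimately have "conn k (Suc n) \<le> sqrt (1 / (real k + 1))" for k
    by (meson order_trans)
  moreover have "(\<lambda>k. sqrt (1 / (real k + 1))) \<longlonglongrightarrow> 0"
    by real_asymp
  ultimately show ?thesis
    using tendsto_sandwich[of "\<lambda>_. 0" "\<lambda>k. conn k (Suc n)" sequentially "\<lambda>k. sqrt (1 / (real k + 1))" 0] by simp
qed

lemma conn_sums_right:
  "(\<lambda>i. conn (Suc k) (Suc (n + i)) / (real (n + i) + 1 / 2)) sums (conn (Suc k) n / real (Suc k))"
proof -
  have "(\<lambda>i. conn (Suc k) (n + i)) \<longlonglongrightarrow> 0"
    using conn_tendsto_right[of k] LIMSEQ_ignore_initial_segment[of _ _ n] by (simp add: add.commute)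
  from telescope_sums'[OF this]
  have "(\<lambda>i. (conn (Suc k) (n + i) - conn (Suc k) (Suc (n + i))) / real (Suc k))
      sums ((conn (Suc k) n - 0) / real (Suc k))"
    by (intro sums_divide) simp
  moreover have "(conn (Suc k) (n + i) - conn (Suc k) (Suc (n + i))) / real (Suc k)
     = conn (Suc k) (Suc (n + i)) / (real (n + i) + 1 / 2)" for i
    unfolding conn_diff_right by simp
  ultimately show ?thesis by simp
qed

lemma conn_sums_left:
  "(\<lambda>i. conn (Suc (j + i)) (Suc n) / real (Suc (j + i))) sums (conn j (Suc n) / (real n + 1 / 2))"
proof -
  have "(\<lambda>i. conn (j + i) (Suc n)) \<longlonglongrightarrow> 0"
    using conn_tendsto_left[of n] LIMSEQ_ignore_initial_segment[of _ _ j] by (simp add: add.commute)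
  from telescope_sums'[OF this]
  have "(\<lambda>i. (conn (j + i) (Suc n) - conn (Suc (j + i)) (Suc n)) / (real n + 1 / 2))
      sums ((conn j (Suc n) - 0) / (real n + 1 / 2))"
    by (intro sums_divide) simp
  moreover have "real n + 1 / 2 > 0" by simp
  then have "(conn (j + i) (Suc n) - conn (Suc (j + i)) (Suc n)) / (real n + 1 / 2)
     = conn (Suc (j + i)) (Suc n) / real (Suc (j + i))" for i
    unfolding conn_diff_left by (simp add: add_ac)
  ultimately show ?thesis by simp
qed

text \<open>Each \<open>conn j (Suc n) / (n + 1 / 2)\<close> unfolds into a tail sum over
  \<open>k \<ge> j\<close>; swapping the sums collects the coefficients into partial sums. One more
  factor \<open>1 / (n + 1 / 2)\<close> thus means one more nesting level.\<close>

lemma conn_transport_left: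
  assumes "\<And>j. g j \<ge> 0" and "(\<lambda>j. g j * conn j (Suc n)) sums S"
  shows "(\<lambda>k. (\<Sum>j\<le>k. g j) * conn (Suc k) (Suc n) / real (Suc k)) sums (S / (real n + 1 / 2))"
proof (rule sums_swap_nonneg)
  let ?a = "\<lambda>j k. if j \<le> k then g j * conn (Suc k) (Suc n) / real (Suc k) else 0"
  show "?a j k \<ge> 0" for j k
    using assms(1) by simp
  show "?a j sums (g j * conn j (Suc n) / (real n + 1 / 2))" for j
  proof -
    have "(\<lambda>i. g j * (conn (Suc (j + i)) (Suc n) / real (Suc (j + i)))) sums (g j * (conn j (Suc n) / (real n + 1 / 2)))"
      by (intro sums_mult conn_sums_left)
    then have "(\<lambda>i. ?a j (i + j)) sums (g j * conn j (Suc n) / (real n + 1 / 2))"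
      by (simp add: add_ac)
    then show ?thesis
      by (subst (asm) sums_zero_iff_shift) auto
  qed
  show "(\<lambda>j. ?a j k) sums ((\<Sum>j\<le>k. g j) * conn (Suc k) (Suc n) / real (Suc k))" for k
  proof -
    have "(\<lambda>j. ?a j k) sums (\<Sum>j\<le>k. ?a j k)"
      by (rule sums_finite) auto
    then show ?thesis
      by (simp add: sum_distrib_right sum_divide_distrib)
  qed
  show "(\<lambda>j. g j * conn j (Suc n) / (real n + 1 / 2)) sums (S / (real n + 1 / 2))"
    by (intro sums_divide assms)
qed

text \<open>One of the two factors \<open>1 / Suc k\<close> is unfolded by
  \<open>conn_sums_right\<close> into a sum over the half-integers from \<open>n\<close> on, and the
  inner sum over \<open>k\<close> is then known.\<close>

lemma conn_transport_right:
  assumes "\<And>k. c k \<ge> 0"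
    and "\<And>i. (\<lambda>k. c k * conn (Suc k) (Suc (n + i)) / real (Suc k)) sums s i"
    and "(\<lambda>i. s i / (real (n + i) + 1 / 2)) sums S"
  shows "(\<lambda>k. c k * conn (Suc k) n / real (Suc k) ^ 2) sums S"
proof (rule sums_swap_nonneg)
  let ?a = "\<lambda>i k. c k * conn (Suc k) (Suc (n + i)) / real (Suc k) / (real (n + i) + 1 / 2)"
  show "?a i k \<ge> 0" for i k
    using assms(1) by simp
  show "?a i sums (s i / (real (n + i) + 1 / 2))" for i
    by (intro sums_divide assms(2))
  show "(\<lambda>i. ?a i k) sums (c k * conn (Suc k) n / real (Suc k) ^ 2)" for k
    using sums_mult[OF conn_sums_right[of k n], of "c k / real (Suc k)"]
    by (simp add: power2_eq_square field_simps)
qed (rule assms(3))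


lemma conn_transport_left':
  assumes "\<And>i. c i \<ge> 0" and "(\<lambda>i. c i * conn (Suc i) (Suc n) / real (Suc i) ^ p) sums S"
  shows "(\<lambda>k. (\<Sum>i<k. c i / real (Suc i) ^ p) * conn (Suc k) (Suc n) / real (Suc k)) sums (S / (real n + 1 / 2))"
proof -
  \<comment> \<open>The shift by one with \<open>g 0 = 0\<close> turns the inclusive partial sums of
    \<open>conn_transport_left\<close> into strict ones.\<close>
  define g where "g = (\<lambda>j. case j of 0 \<Rightarrow> 0 | Suc i \<Rightarrow> c i / real (Suc i) ^ p)"
  have "(\<lambda>i. g (Suc i) * conn (Suc i) (Suc n)) sums S"
    using assms(2) by (simp add: g_def)
  then have "(\<lambda>i. g i * conn i (Suc n)) sums S"
    by (subst (asm) sums_Suc_iff) (simp add: g_def)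
  moreover have "g j \<ge> 0" for j
    using assms(1) by (simp add: g_def split: nat.split)
  moreover have "(\<Sum>j\<le>k. g j) = (\<Sum>i<k. c i / real (Suc i) ^ p)" for k
    unfolding sum.atMost_shift by (simp add: g_def)
  ultimately show ?thesis
    using conn_transport_left[of g n S] by simp
qed

section \<open>Harmonic weights and zeta values at half-integers\<close>

lemma gen_harm_0 [simp]: "gen_harm m 0 = 0"
  by (simp add: gen_harm_def)

lemma gen_harm_Suc: "gen_harm m (Suc k) = gen_harm m k + 1 / real (Suc k) ^ m"
  by (simp add: gen_harm_def)

text \<open>Replaces the reciprocal of \<open>Suc k\<close> by an opaque \<open>x\<close>, so that
  induction steps on harmonic identities become polynomial identities.\<close>

lemma harm_step:
  obtains x :: real where "\<And>c p. c / real (Suc k) ^ p = c * x ^ p" and "\<And>c. c / real (Suc k) = c * x"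
    and "harm (Suc k) = harm k + x" and "\<And>m. gen_harm m (Suc k) = gen_harm m k + x ^ m"
  by (rule that[of "inverse (real (Suc k))"])
    (simp_all add: harm_Suc gen_harm_Suc divide_inverse power_inverse del: of_nat_Suc)

lemma gen_harm_nonneg [simp]: "gen_harm m k \<ge> 0"
  by (simp add: gen_harm_def sum_nonneg)

lemma gen_harm_conv_lessThan: "gen_harm m k = (\<Sum>i<k. 1 / real (Suc i) ^ m)"
  by (induction k) (simp_all add: gen_harm_Suc)

lemma gen_harm_1: "gen_harm (Suc 0) k = harm k"
  by (induction k) (simp_all add: gen_harm_Suc harm_Suc inverse_eq_divide harm_def)

text \<open>The Hurwitz zeta value at \<open>1 / 2\<close>.\<close>

definition half_zeta :: "nat \<Rightarrow> real" where
  "half_zeta m = (\<Sum>n. 1 / (real n + 1 / 2) ^ m)"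

lemma half_zeta_sums:
  assumes "m \<ge> 2"
  shows "(\<lambda>n. 1 / (real n + 1 / 2) ^ m) sums half_zeta m"
proof -
  have "summable (\<lambda>n. 1 / (real n + 1 / 2) ^ m)"
  proof (rule summable_comparison_test_ev)
    show "eventually (\<lambda>n. norm (1 / (real n + 1 / 2) ^ m) \<le> 1 / real n ^ m) sequentially"
      using eventually_gt_at_top[of 0]
    proof eventually_elim
      case (elim n)
      then have "real n ^ m \<le> (real n + 1 / 2) ^ m"
        by (intro power_mono) auto
      with elim show ?case
        by (auto intro!: divide_left_mono mult_pos_pos zero_less_power)
    qed
    show "summable (\<lambda>n. 1 / real n ^ m)"
      using inverse_power_summable[OF assms, where ?'a = real] by (simp add: inverse_eq_divide)
  qed
  then show ?thesis
    unfolding half_zeta_def by (rule summable_sums)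
qed

text \<open>The Hurwitz zeta value at \<open>n + 1 / 2\<close>, written as a difference so that the
  step in \<open>n\<close> is immediate.\<close>

definition half_tail :: "nat \<Rightarrow> nat \<Rightarrow> real" where
  "half_tail m n = half_zeta m - (\<Sum>i<n. 1 / (real i + 1 / 2) ^ m)"

lemma half_tail_sums:
  assumes "m \<ge> 2"
  shows "(\<lambda>i. 1 / (real (n + i) + 1 / 2) ^ m) sums half_tail m n"
  using sums_split_initial_segment[OF half_zeta_sums[OF assms], of n]
  by (simp add: half_tail_def add_ac)

lemma half_tail_Suc: "half_tail m (Suc n) = half_tail m n - 1 / (real n + 1 / 2) ^ m"
  by (simp add: half_tail_def)

lemma half_tail_tendsto: "m \<ge> 2 \<Longrightarrow> half_tail m \<longlonglongrightarrow> 0"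
  using half_zeta_sums[of m] tendsto_diff[OF tendsto_const[of "half_zeta m"], of "\<lambda>n. \<Sum>i<n. 1 / (real i + 1 / 2) ^ m" "half_zeta m"]
  by (simp add: sums_def half_tail_def[abs_def])

text \<open>Telescoping the product of the two tails: with \<open>x = 1 / (n + 1 / 2)\<close>, one
  step of the product leaves the two cross terms and the diagonal \<open>x ^ 5\<close>, which sums
  to \<open>half_zeta 5\<close>.\<close>

lemma half_tail_sums_mixed:
  "(\<lambda>n. half_tail 2 (Suc n) / (real n + 1 / 2) ^ 3 + half_tail 3 (Suc n) / (real n + 1 / 2) ^ 2)
     sums (half_zeta 2 * half_zeta 3 - half_zeta 5)"
proof -
  have "(\<lambda>n. half_tail 2 n * half_tail 3 n) \<longlonglongrightarrow> 0 * 0"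
    by (intro tendsto_mult half_tail_tendsto) auto
  from telescope_sums'[OF this[unfolded mult_zero_left]]
  have "(\<lambda>n. (half_tail 2 n * half_tail 3 n - half_tail 2 (Suc n) * half_tail 3 (Suc n)) - 1 / (real n + 1 / 2) ^ 5)
     sums (half_tail 2 0 * half_tail 3 0 - 0 - half_zeta 5)"
    by (rule sums_diff) (rule half_zeta_sums, simp)
  moreover have "half_tail 2 n * half_tail 3 n - half_tail 2 (Suc n) * half_tail 3 (Suc n) - 1 / (real n + 1 / 2) ^ 5
    = half_tail 2 (Suc n) / (real n + 1 / 2) ^ 3 + half_tail 3 (Suc n) / (real n + 1 / 2) ^ 2" for n
  proof -
    define a where "a = 1 / (real n + 1 / 2)"
    have "1 / (real n + 1 / 2) ^ m = a ^ m" for m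
      by (simp add: a_def power_one_over)
    then have *: "x / (real n + 1 / 2) ^ m = x * a ^ m" for x m
      by (metis mult.right_neutral times_divide_eq_right)
    show ?thesis
      unfolding half_tail_Suc * by (simp add: algebra_simps flip: power_add)
  qed
  ultimately show ?thesis
    by (simp add: half_tail_def)
qed

text \<open>Newton's identities: the right-hand side is the elementary symmetric polynomial of
  degree 2 in \<open>1, 1/2, ..., 1/k\<close>, a strictly nested double sum;
  \<open>sum_sum_harm_div\<close> is the case of degree 3.\<close>

lemma sum_harm_div: "(\<Sum>i<k. harm i / real (Suc i) ^ 1) = ((harm k)\<^sup>2 - gen_harm 2 k) / 2"
proof (induction k)
  case (Suc k)
  obtain x :: real where x: "\<And>c p. c / real (Suc k) ^ p = c * x ^ p" "\<And>c. c / real (Suc k) = c * x"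
    "harm (Suc k) = harm k + x" "\<And>m. gen_harm m (Suc k) = gen_harm m k + x ^ m"
    by (rule harm_step[of k]) (rule that)
  show ?case
    using Suc unfolding sum.lessThan_Suc x by (simp add: algebra_simps power2_eq_square)
qed (simp add: harm_def)

lemma elementary_harm_2_nonneg: "((harm k)\<^sup>2 - gen_harm 2 k) / (2 :: real) \<ge> 0"
  by (subst sum_harm_div[symmetric]) (auto intro!: sum_nonneg divide_nonneg_nonneg harm_nonneg)

lemma sum_sum_harm_div: "(\<Sum>i<k. ((harm i)\<^sup>2 - gen_harm 2 i) / 2 / real (Suc i) ^ 1)
    = (harm k ^ 3 - 3 * harm k * gen_harm 2 k + 2 * gen_harm 3 k) / 6"
proof (induction k)
  case (Suc k)
  obtain x :: real where x: "\<And>c p. c / real (Suc k) ^ p = c * x ^ p" "\<And>c. c / real (Suc k) = c * x"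
    "harm (Suc k) = harm k + x" "\<And>m. gen_harm m (Suc k) = gen_harm m k + x ^ m"
    by (rule harm_step[of k]) (rule that)
  show ?case
    using Suc unfolding sum.lessThan_Suc x
    by (simp add: field_simps power2_eq_square power3_eq_cube)
qed (simp add: harm_def)

lemma elementary_harm_3_nonneg: "(harm k ^ 3 - 3 * harm k * gen_harm 2 k + 2 * gen_harm 3 k) / (6 :: real) \<ge> 0"
  by (subst sum_sum_harm_div[symmetric])
    (intro sum_nonneg divide_nonneg_nonneg elementary_harm_2_nonneg, simp)

text \<open>Starting from the bare connector, every transport contributes one factor
  \<open>1 / (n + 1 / 2)\<close> and raises the degree of the elementary symmetric weight by
  one.\<close>

lemma conn_harm_sums:
  shows "(\<lambda>k. conn (Suc k) (Suc n) / real (Suc k)) sums (1 / (real n + 1 / 2))"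
    and "(\<lambda>k. harm k * conn (Suc k) (Suc n) / real (Suc k)) sums (1 / (real n + 1 / 2) ^ 2)"
    and "(\<lambda>k. ((harm k)\<^sup>2 - gen_harm 2 k) / 2 * conn (Suc k) (Suc n) / real (Suc k)) sums (1 / (real n + 1 / 2) ^ 3)"
    and "(\<lambda>k. (harm k ^ 3 - 3 * harm k * gen_harm 2 k + 2 * gen_harm 3 k) / 6 * conn (Suc k) (Suc n) / real (Suc k))
           sums (1 / (real n + 1 / 2) ^ 4)"
proof -
  show 0: "(\<lambda>k. conn (Suc k) (Suc n) / real (Suc k)) sums (1 / (real n + 1 / 2))"
    using conn_sums_left[of 0 n] by simp
  have e1: "(\<Sum>i<k. 1 / real (Suc i) ^ 1) = harm k" for k
    by (simp add: gen_harm_conv_lessThan flip: gen_harm_1)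
  show 1: "(\<lambda>k. harm k * conn (Suc k) (Suc n) / real (Suc k)) sums (1 / (real n + 1 / 2) ^ 2)"
    using conn_transport_left'[of "\<lambda>_. 1" n 1 "1 / (real n + 1 / 2)"] 0
    unfolding e1 by (simp add: power2_eq_square)
  show 2: "(\<lambda>k. ((harm k)\<^sup>2 - gen_harm 2 k) / 2 * conn (Suc k) (Suc n) / real (Suc k)) sums (1 / (real n + 1 / 2) ^ 3)"
    using conn_transport_left'[of harm n 1 "1 / (real n + 1 / 2) ^ 2"] 1 harm_nonneg[where 'a = real]
    unfolding sum_harm_div by (simp add: power2_eq_square power3_eq_cube)
  show "(\<lambda>k. (harm k ^ 3 - 3 * harm k * gen_harm 2 k + 2 * gen_harm 3 k) / 6 * conn (Suc k) (Suc n) / real (Suc k))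
           sums (1 / (real n + 1 / 2) ^ 4)"
    using conn_transport_left'[of "\<lambda>k. ((harm k)\<^sup>2 - gen_harm 2 k) / 2" n 1 "1 / (real n + 1 / 2) ^ 3", OF elementary_harm_2_nonneg] 2
    unfolding sum_sum_harm_div by (simp add: power4_eq_xxxx power3_eq_cube)
qed

lemma conn_0_right: "conn k 0 = 4 ^ k / real ((2 * k) choose k)"
proof (induction k)
  case (Suc k)
  have "real (Suc k) * real (Suc k) * real ((2 * Suc k) choose (Suc k)) = real (Suc k) * real (Suc (2 * k)) * 2 * real ((2 * k) choose k)"
  proof -
    have "Suc k * (Suc (Suc (2 * k)) choose Suc k) = Suc (Suc (2 * k)) * (Suc (2 * k) choose k)"
      using Suc_times_binomial_eq[of "Suc (2 * k)" k] by (simp only: mult.commute)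
    moreover have "Suc k * (Suc (2 * k) choose k) = Suc (2 * k) * ((2 * k) choose k)"
      using Suc_times_binomial[of k "2 * k"] binomial_symmetric[of k "Suc (2 * k)"] by (simp add: Suc_diff_le mult_2)
    ultimately have "Suc k * Suc k * (Suc (Suc (2 * k)) choose Suc k) = Suc (Suc (2 * k)) * (Suc (2 * k) * ((2 * k) choose k))"
      by (metis mult.assoc mult.left_commute)
    moreover have "2 * Suc k = Suc (Suc (2 * k))" by simp
    ultimately have "Suc k * Suc k * ((2 * Suc k) choose Suc k) = Suc k * Suc (2 * k) * 2 * ((2 * k) choose k)"
      by (metis mult.assoc mult.commute)
    then show ?thesis
      by (metis of_nat_mult of_nat_numeral)
  qed
  then have "real (Suc k) * real ((2 * Suc k) choose (Suc k)) = real (Suc (2 * k)) * 2 * real ((2 * k) choose k)"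
    by (simp del: of_nat_Suc binomial_Suc_Suc)
  moreover have "real ((2 * Suc k) choose (Suc k)) > 0" "real ((2 * k) choose k) > 0"
    by (simp_all del: binomial_Suc_Suc)
  ultimately show ?case
    unfolding conn_Suc_left Suc by (simp add: divide_simps del: binomial_Suc_Suc) (simp add: algebra_simps del: binomial_Suc_Suc)
qed simp

text \<open>A last transport to \<open>n = 0\<close> sums the pure powers of half-integers. The
  weights are harmonic numbers at \<open>k\<close>, while all other factors sit at
  \<open>Suc k\<close>.\<close>

lemma central_sums:
  shows "(\<lambda>k. conn (Suc k) 0 / real (Suc k) ^ 2) sums half_zeta 2"
    and "(\<lambda>k. harm k * conn (Suc k) 0 / real (Suc k) ^ 2) sums half_zeta 3"
    and "(\<lambda>k. (harm k ^ 3 - 3 * harm k * gen_harm 2 k + 2 * gen_harm 3 k) / 6 * conn (Suc k) 0 / real (Suc k) ^ 2)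
           sums half_zeta 5"
proof -
  show "(\<lambda>k. conn (Suc k) 0 / real (Suc k) ^ 2) sums half_zeta 2"
    using conn_transport_right[of "\<lambda>_. 1" 0 "\<lambda>i. 1 / (real i + 1 / 2)" "half_zeta 2"]
      conn_harm_sums(1) half_zeta_sums[of 2] by (simp add: power2_eq_square)
  show "(\<lambda>k. harm k * conn (Suc k) 0 / real (Suc k) ^ 2) sums half_zeta 3"
    using conn_transport_right[of harm 0 "\<lambda>i. 1 / (real i + 1 / 2) ^ 2" "half_zeta 3"]
      conn_harm_sums(2) half_zeta_sums[of 3] harm_nonneg[where 'a = real] by (simp add: power2_eq_square power3_eq_cube)
  show "(\<lambda>k. (harm k ^ 3 - 3 * harm k * gen_harm 2 k + 2 * gen_harm 3 k) / 6 * conn (Suc k) 0 / real (Suc k) ^ 2)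
           sums half_zeta 5"
    using conn_transport_right[of "\<lambda>k. (harm k ^ 3 - 3 * harm k * gen_harm 2 k + 2 * gen_harm 3 k) / 6" 0 "\<lambda>i. 1 / (real i + 1 / 2) ^ 4" "half_zeta 5", OF elementary_harm_3_nonneg]
      conn_harm_sums(4) half_zeta_sums[of 5] by (simp add: power4_eq_xxxx eval_nat_numeral mult.assoc)
qed

text \<open>The product \<open>harm k * gen_harm 2 k\<close> without its diagonal splits into the
  strict double sums \<open>c1\<close> and \<open>c2\<close>. Transported to the half-integers they
  become the two cross terms of \<open>half_tail_sums_mixed\<close>: neither is evaluated alone, but
  their sum telescopes.\<close>

lemma central_sums_mixed:
  "(\<lambda>k. (harm k * gen_harm 2 k - gen_harm 3 k) * conn (Suc k) 0 / real (Suc k) ^ 2)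
     sums (half_zeta 2 * half_zeta 3 - half_zeta 5)"
proof -
  define c1 where "c1 = (\<lambda>k. \<Sum>i<k. gen_harm 2 i / real (Suc i))"
  define c2 where "c2 = (\<lambda>k. \<Sum>i<k. harm i / real (Suc i) ^ 2)"
  have nonneg: "c1 k \<ge> 0" "c2 k \<ge> 0" for k
    by (auto simp: c1_def c2_def intro!: sum_nonneg divide_nonneg_nonneg harm_nonneg)
  have sum_eq: "c1 k + c2 k = harm k * gen_harm 2 k - gen_harm 3 k" for k
  proof (induction k)
    case (Suc k)
    obtain x :: real where x: "\<And>c p. c / real (Suc k) ^ p = c * x ^ p" "\<And>c. c / real (Suc k) = c * x"
      "harm (Suc k) = harm k + x" "\<And>m. gen_harm m (Suc k) = gen_harm m k + x ^ m"
      by (rule harm_step[of k]) (rule that)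
    show ?case
      using Suc unfolding c1_def c2_def sum.lessThan_Suc x
      by (simp add: field_simps power2_eq_square power3_eq_cube)
  qed (simp add: c1_def c2_def harm_def)
  have A: "(\<lambda>k. conn (Suc k) (Suc n) / real (Suc k) ^ 2) sums half_tail 2 (Suc n)" for n
    using conn_transport_right[of "\<lambda>_. 1" "Suc n" "\<lambda>i. 1 / (real (Suc n + i) + 1 / 2)" "half_tail 2 (Suc n)"]
      conn_harm_sums(1)[of "Suc n + i" for i] half_tail_sums[of 2 "Suc n"] by (simp add: power2_eq_square)
  have B: "(\<lambda>k. harm k * conn (Suc k) (Suc n) / real (Suc k) ^ 2) sums half_tail 3 (Suc n)" for n
    using conn_transport_right[of harm "Suc n" "\<lambda>i. 1 / (real (Suc n + i) + 1 / 2) ^ 2" "half_tail 3 (Suc n)"]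
      conn_harm_sums(2)[of "Suc n + i" for i] half_tail_sums[of 3 "Suc n"] harm_nonneg[where 'a = real] by (simp add: power2_eq_square power3_eq_cube)
  have C: "(\<lambda>k. gen_harm 2 k * conn (Suc k) (Suc n) / real (Suc k)) sums (half_tail 2 (Suc n) / (real n + 1 / 2))" for n
    using conn_transport_left'[of "\<lambda>_. 1" n 2 "half_tail 2 (Suc n)"] A by (simp add: gen_harm_conv_lessThan)
  have D: "(\<lambda>k. c1 k * conn (Suc k) (Suc n) / real (Suc k)) sums (half_tail 2 (Suc n) / (real n + 1 / 2) ^ 2)" for n
    using conn_transport_left'[of "gen_harm 2" n 1 "half_tail 2 (Suc n) / (real n + 1 / 2)"] C
    by (simp add: c1_def power2_eq_square)
  have E: "(\<lambda>k. c2 k * conn (Suc k) (Suc n) / real (Suc k)) sums (half_tail 3 (Suc n) / (real n + 1 / 2))" for n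
    using conn_transport_left'[of harm n 2 "half_tail 3 (Suc n)"] B harm_nonneg[where 'a = real] by (simp add: c2_def)
  have "(\<lambda>k. (c1 k + c2 k) * conn (Suc k) (Suc (0 + n)) / real (Suc k))
      sums (half_tail 2 (Suc n) / (real n + 1 / 2) ^ 2 + half_tail 3 (Suc n) / (real n + 1 / 2))" for n
    using sums_add[OF D E, of n] by (simp add: algebra_simps add_divide_distrib)
  from conn_transport_right[OF _ this, of "half_zeta 2 * half_zeta 3 - half_zeta 5"]
  have "(\<And>k. c1 k + c2 k \<ge> 0) \<Longrightarrow> ?thesis"
    using half_tail_sums_mixed unfolding sum_eq
    by (simp add: add_divide_distrib power2_eq_square power3_eq_cube mult.assoc)
  then show ?thesis
    using nonneg by (simp add: add_nonneg_nonneg)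
qed


section \<open>Polylogarithms on the closed unit disc\<close>

definition polylog :: "nat \<Rightarrow> 'a \<Rightarrow> 'a::{real_normed_field, banach}" where
  "polylog n z = (\<Sum>k. z ^ Suc k / of_nat (Suc k) ^ n)"

lemma Li5_conv_polylog: "Li5 z = polylog 5 z"
  by (simp add: Li5_def polylog_def)

lemma summable_inverse_power_Suc:
  "n \<ge> 2 \<Longrightarrow> summable (\<lambda>k. 1 / real (Suc k) ^ n)"
  using inverse_power_summable[of n, where ?'a = real] by (subst summable_Suc_iff) (simp add: inverse_eq_divide)

lemma polylog_norm_bound:
  fixes z :: "'a::{real_normed_field, banach}"
  assumes "norm z \<le> 1"
  shows "norm (z ^ Suc k / of_nat (Suc k) ^ n) \<le> 1 / real (Suc k) ^ n"
proof -
  have "norm (z ^ Suc k) \<le> 1"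
    using assms by (simp add: norm_power power_le_one del: power_Suc)
  then show ?thesis
    by (simp add: norm_divide norm_power divide_right_mono del: power_Suc of_nat_Suc)
qed

lemma polylog_sums_boundary:
  fixes z :: "'a::{real_normed_field, banach}"
  assumes "n \<ge> 2" "norm z \<le> 1"
  shows "(\<lambda>k. z ^ Suc k / of_nat (Suc k) ^ n) sums polylog n z"
  unfolding polylog_def
  by (intro summable_sums summable_comparison_test'[OF summable_inverse_power_Suc[OF assms(1)], of 0]
      polylog_norm_bound assms)

lemma summable_polylog_inner:
  fixes z :: "'a::{real_normed_field, banach}"
  assumes "norm z < 1"
  shows "summable (\<lambda>k. z ^ k / of_nat k ^ n)"
proof (rule summable_comparison_test'[of "\<lambda>k. norm z ^ k" 1])
  show "summable (\<lambda>k. norm z ^ k)"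
    using assms by (simp add: summable_geometric)
  show "norm (z ^ k / of_nat k ^ n) \<le> norm z ^ k" if "k \<ge> 1" for k
  proof -
    have "1 \<le> real k ^ n" using that by (intro one_le_power) auto
    then show ?thesis
      by (simp add: norm_divide norm_power divide_le_eq mult_left_le)
         (metis mult_right_mono mult_1 mult.commute norm_ge_zero zero_le_power that le_numeral_extra(3))
  qed
qed

lemma continuous_on_polylog:
  assumes "n \<ge> 2"
  shows "continuous_on (cball 0 1) (polylog n :: 'a \<Rightarrow> 'a::{real_normed_field, banach})"
proof (rule uniform_limit_theorem)
  show "uniform_limit (cball 0 1) (\<lambda>N z. \<Sum>k<N. z ^ Suc k / of_nat (Suc k) ^ n) (polylog n :: 'a \<Rightarrow> 'a) sequentially"
    unfolding polylog_def
    by (rule Weierstrass_m_test[OF _ summable_inverse_power_Suc[OF assms]]) (intro polylog_norm_bound, simp)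
qed (auto intro!: always_eventually continuous_intros simp del: of_nat_Suc power_Suc)

lemma polylog_powser:
  fixes z :: "'a::{real_normed_field, banach}"
  assumes "norm z < 1"
  shows "polylog n z = (\<Sum>k. (if k = 0 then 0 else 1 / of_nat k ^ n) * z ^ k)"
proof -
  have "summable (\<lambda>k. (if k = 0 then 0 else 1 / of_nat k ^ n) * z ^ k)"
    using summable_polylog_inner[OF assms, of n]
    by (subst (asm) summable_Suc_iff[symmetric], subst summable_Suc_iff[symmetric]) simp
  from suminf_split_head[OF this] show ?thesis
    by (simp add: polylog_def)
qed

lemma DERIV_polylog:
  fixes z :: "'a::{real_normed_field, banach}"
  assumes "norm z < 1" "z \<noteq> 0"
  shows "(polylog (Suc n) has_field_derivative polylog n z / z) (at z)"
proof -
  let ?c = "\<lambda>n k. if k = 0 then 0 else 1 / of_nat k ^ n :: 'a"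
  have sm: "summable (\<lambda>k. ?c n k * y ^ k)" if "norm y < 1" for y n
    using summable_polylog_inner[OF that, of n]
    by (subst (asm) summable_Suc_iff[symmetric], subst summable_Suc_iff[symmetric]) simp
  have "((\<lambda>y. \<Sum>k. ?c (Suc n) k * y ^ k) has_field_derivative (\<Sum>k. diffs (?c (Suc n)) k * z ^ k)) (at z)"
    by (rule termdiffs_strong'[where K = 1]) (use sm assms in auto)
  also have "(\<Sum>k. diffs (?c (Suc n)) k * z ^ k) = (\<Sum>k. z ^ Suc k / of_nat (Suc k) ^ n / z)"
    using assms(2) by (intro suminf_cong) (simp add: diffs_def field_simps del: of_nat_Suc)
  also have "\<dots> = polylog n z / z"
    unfolding polylog_def using summable_polylog_inner[OF assms(1), of n]
    by (intro suminf_divide) (subst summable_Suc_iff)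
  finally show ?thesis
    by (rule has_field_derivative_transform_within_open[of _ _ _ "ball 0 1"])
       (use assms in \<open>auto simp: polylog_powser[of _ "Suc n"] simp del: power_Suc\<close>)
qed

lemma polylog_0_right [simp]: "polylog n 0 = 0"
  by (simp add: polylog_def)

lemma polylog_of_real:
  assumes "norm x < 1 \<or> n \<ge> 2 \<and> norm x \<le> 1"
  shows "polylog n (of_real x :: complex) = of_real (polylog n x)"
proof -
  have "summable (\<lambda>k. x ^ Suc k / of_nat (Suc k) ^ n)"
  proof (cases "norm x < 1")
    case True
    from summable_polylog_inner[OF this, of n] show ?thesis
      by (subst summable_Suc_iff)
  next
    case False
    then show ?thesis
      using assms polylog_sums_boundary[of n x] by (auto simp: sums_iff)
  qed
  from suminf_of_real[OF this, where 'a = complex] show ?thesis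
    by (simp add: polylog_def)
qed

lemma polylog_1_complex:
  fixes z :: complex
  assumes "norm z < 1"
  shows "polylog 1 z = - Ln (1 - z)"
proof -
  have "(\<lambda>k. - (z ^ k / of_nat k)) sums Ln (1 - z)"
    using Ln_series'[of "- z"] assms by simp
  then have "(\<lambda>k. - (z ^ Suc k / of_nat (Suc k))) sums Ln (1 - z)"
    by (subst sums_Suc_iff) simp
  from sums_minus[OF this] show ?thesis
    by (simp add: polylog_def sums_iff)
qed

lemma polylog_1_real:
  fixes x :: real
  assumes "\<bar>x\<bar> < 1"
  shows "polylog 1 x = - ln (1 - x)"
proof -
  have "(\<lambda>k. - (x ^ k / of_nat k)) sums ln (1 - x)"
    using ln_series'[of "- x"] assms by simp
  then have "(\<lambda>k. - (x ^ Suc k / of_nat (Suc k))) sums ln (1 - x)"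
    by (subst sums_Suc_iff) simp
  from sums_minus[OF this] show ?thesis
    by (simp add: polylog_def sums_iff)
qed

section \<open>Values at 1 and -1 in terms of zeta\<close>

lemma polylog_one: "polylog n 1 = zeta (real n)"
  by (simp add: polylog_def zeta_def powr_realpow del: of_nat_Suc)

lemma zeta_sums: "n \<ge> 2 \<Longrightarrow> (\<lambda>k. 1 / real (Suc k) ^ n) sums zeta (real n)"
  using polylog_sums_boundary[of n "1 :: real"] by (simp add: polylog_one)

lemma zeta_odd_sums:
  assumes "n \<ge> 2"
  shows "(\<lambda>k. 1 / real (2 * k + 1) ^ n) sums ((1 - 1 / 2 ^ n) * zeta (real n))"
proof -
  have "(\<lambda>k. \<Sum>j\<in>{k * 2..<k * 2 + 2}. 1 / real (Suc j) ^ n) sums zeta (real n)"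
    by (rule sums_group[OF zeta_sums[OF assms]]) simp
  moreover have "{k * 2..<k * 2 + 2} = {2 * k, Suc (2 * k)}" for k :: nat
    by auto
  ultimately have "(\<lambda>k. 1 / real (2 * k + 1) ^ n + 1 / real (2 * k + 2) ^ n) sums zeta (real n)"
    by (simp add: add.commute mult.commute)
  moreover have double: "1 / 2 ^ n * (1 / real (Suc k) ^ n) = 1 / real (2 * k + 2) ^ n" for k
    by (simp add: distrib_left flip: power_mult_distrib)
  have "(\<lambda>k. 1 / 2 ^ n * (1 / real (Suc k) ^ n)) sums (1 / 2 ^ n * zeta (real n))"
    by (intro sums_mult zeta_sums assms)
  then have "(\<lambda>k. 1 / real (2 * k + 2) ^ n) sums (1 / 2 ^ n * zeta (real n))"
    unfolding double .
  ultimately show ?thesis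
    by (auto dest: sums_diff simp: algebra_simps)
qed

lemma half_zeta_conv_zeta:
  assumes "n \<ge> 2"
  shows "half_zeta n = (2 ^ n - 1) * zeta (real n)"
proof -
  have "(\<lambda>k. 2 ^ n * (1 / real (2 * k + 1) ^ n)) sums (2 ^ n * ((1 - 1 / 2 ^ n) * zeta (real n)))"
    by (intro sums_mult zeta_odd_sums assms)
  moreover have "2 ^ n * (1 / real (2 * k + 1) ^ n) = 1 / (real k + 1 / 2) ^ n" for k
  proof -
    have "real k + 1 / 2 = real (2 * k + 1) / 2" by simp
    then show ?thesis by (simp only: power_divide) simp
  qed
  ultimately show ?thesis
    using half_zeta_sums[OF assms] by (simp add: sums_iff algebra_simps)
qed

lemma polylog_minus_one:
  assumes "n \<ge> 2"
  shows "polylog n (- 1) = (2 / 2 ^ n - 1) * zeta (real n)"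
proof -
  have "(\<lambda>k. \<Sum>j\<in>{k * 2..<k * 2 + 2}. (- 1) ^ Suc j / real (Suc j) ^ n) sums polylog n (- 1)"
    by (rule sums_group) (use polylog_sums_boundary[of n "- 1 :: real"] assms in auto)
  moreover have "{k * 2..<k * 2 + 2} = {2 * k, Suc (2 * k)}" for k :: nat
    by auto
  ultimately have "(\<lambda>k. - (1 / real (2 * k + 1) ^ n) + 1 / real (2 * k + 2) ^ n) sums polylog n (- 1)"
    by (simp add: add.commute mult.commute)
  moreover have double: "1 / 2 ^ n * (1 / real (Suc k) ^ n) = 1 / real (2 * k + 2) ^ n" for k
    by (simp add: distrib_left flip: power_mult_distrib)
  have "(\<lambda>k. 1 / 2 ^ n * (1 / real (Suc k) ^ n)) sums (1 / 2 ^ n * zeta (real n))"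
    by (intro sums_mult zeta_sums assms)
  then have "(\<lambda>k. - (1 / real (2 * k + 1) ^ n) + 1 / real (2 * k + 2) ^ n)
      sums (- ((1 - 1 / 2 ^ n) * zeta (real n)) + 1 / 2 ^ n * zeta (real n))"
    unfolding double by (intro sums_add sums_minus zeta_odd_sums assms)
  ultimately show ?thesis
    by (simp add: sums_iff algebra_simps)
qed

lemma zeta_2: "zeta 2 = pi\<^sup>2 / 6"
  using zeta_sums[of 2] inverse_squares_sums by (simp add: sums_iff add.commute)

section \<open>Continuation to the plane without the ray from 1 to infinity\<close>

definition slit :: "complex set" where
  "slit = {z. 1 - z \<notin> \<real>\<^sub>\<le>\<^sub>0}"

lemma open_slit: "open slit"
proof -
  have "open ((\<lambda>z. 1 - z) -` (- \<real>\<^sub>\<le>\<^sub>0) :: complex set)"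
    by (intro open_vimage continuous_intros) (simp add: open_Compl)
  then show ?thesis
    by (simp add: slit_def vimage_def)
qed

lemma slit_iff: "z \<in> slit \<longleftrightarrow> (Im z = 0 \<longrightarrow> Re z < 1)"
  by (auto simp: slit_def complex_nonpos_Reals_iff)

lemma zero_in_slit [simp]: "0 \<in> slit"
  by (simp add: slit_iff)

lemma starlike_slit: "starlike slit"
  unfolding starlike_def
proof (intro bexI ballI subsetI)
  fix z w assume z: "z \<in> slit" and "w \<in> closed_segment 0 z"
  then obtain u where u: "0 \<le> u" "u \<le> 1" "w = u *\<^sub>R z"
    by (auto simp: in_segment)
  have "u * Re z < 1" if "Re z < 1"
    using that u mult_left_mono[of "Re z" 1 u] by (cases "u = 1") auto
  with z u show "w \<in> slit"
    by (auto simp: slit_iff)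
qed simp

lemma ball_subset_slit: "ball 0 1 \<subseteq> slit"
proof
  fix z :: complex assume "z \<in> ball 0 1"
  then show "z \<in> slit"
    using complex_Re_le_cmod[of z] by (simp add: slit_iff)
qed

text \<open>Subtracting \<open>f 0\<close> makes the singularity of the quotient at 0 removable, and
  a holomorphic function on a starlike domain has a primitive. The subtraction matters for the
  contour argument, where \<open>f 0\<close> is a power of \<open>- ln 2\<close>.\<close>

lemma slit_primitive:
  assumes "f holomorphic_on slit"
  obtains G where "\<And>z. z \<in> slit \<Longrightarrow> z \<noteq> 0 \<Longrightarrow> (G has_field_derivative (f z - f 0) / z) (at z)"
    and "G holomorphic_on slit" and "G 0 = 0"
proof -
  define q where "q = (\<lambda>z. if z = 0 then deriv f 0 else (f z - f 0) / (z - 0))"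
  have q: "q holomorphic_on slit"
    unfolding q_def by (intro pole_lemma_open assms open_slit)
  obtain G where G: "\<And>z. z \<in> slit \<Longrightarrow> (G has_field_derivative q z) (at z)"
    using holomorphic_starlike_primitive[OF holomorphic_on_imp_continuous_on[OF q] starlike_slit open_slit, of "{}"]
      q open_slit holomorphic_on_imp_differentiable_at by blast
  show thesis
  proof (rule that[of "\<lambda>z. G z - G 0"])
    show "((\<lambda>z. G z - G 0) has_field_derivative (f z - f 0) / z) (at z)" if "z \<in> slit" "z \<noteq> 0" for z
      using G[OF that(1)] that(2) by (auto intro!: derivative_eq_intros simp: q_def)
    have "G holomorphic_on slit"
      using G holomorphic_on_open[OF open_slit] by blast
    then show "(\<lambda>z. G z - G 0) holomorphic_on slit"
      by (intro holomorphic_intros)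
  qed simp
qed

text \<open>
  \<open>polylog_ext n\<close> continues \<open>polylog (Suc n)\<close>, with the index shifted because the recursion starts at
  the logarithm. It makes the boundary values differentiable along the circle even for the dilogarithm,
  where termwise differentiation of the series is not absolutely convergent.
\<close>

primrec polylog_ext :: "nat \<Rightarrow> complex \<Rightarrow> complex" where
  "polylog_ext 0 = (\<lambda>z. - Ln (1 - z))"
| "polylog_ext (Suc n) = (SOME G. G holomorphic_on slit \<and> G 0 = 0 \<and>
     (\<forall>z\<in>slit. z \<noteq> 0 \<longrightarrow> (G has_field_derivative polylog_ext n z / z) (at z)))"

text \<open>The choice at level \<open>Suc n\<close> has a witness because level \<open>n\<close> is
  holomorphic and vanishes at 0, so both facts are carried through the induction before the
  derivative can be read off.\<close>

lemma polylog_ext_holomorphic: "polylog_ext n holomorphic_on slit \<and> polylog_ext n 0 = 0"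
  and DERIV_polylog_ext:
    "z \<in> slit \<Longrightarrow> z \<noteq> 0 \<Longrightarrow> (polylog_ext (Suc n) has_field_derivative polylog_ext n z / z) (at z)"
proof -
  have step: "polylog_ext (Suc n) holomorphic_on slit \<and> polylog_ext (Suc n) 0 = 0 \<and>
     (\<forall>z\<in>slit. z \<noteq> 0 \<longrightarrow> (polylog_ext (Suc n) has_field_derivative polylog_ext n z / z) (at z))"
    if n: "polylog_ext n holomorphic_on slit \<and> polylog_ext n 0 = 0" for n
  proof -
    obtain G where "\<And>z. z \<in> slit \<Longrightarrow> z \<noteq> 0 \<Longrightarrow> (G has_field_derivative (polylog_ext n z - polylog_ext n 0) / z) (at z)"
      "G holomorphic_on slit" "G 0 = 0"
      using slit_primitive[of "polylog_ext n"] n by blast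
    then have "\<exists>G. G holomorphic_on slit \<and> G 0 = 0 \<and>
       (\<forall>z\<in>slit. z \<noteq> 0 \<longrightarrow> (G has_field_derivative polylog_ext n z / z) (at z))"
      using n by auto
    from someI_ex[OF this] show ?thesis
      unfolding polylog_ext.simps .
  qed
  have base: "polylog_ext 0 holomorphic_on slit \<and> polylog_ext 0 0 = 0"
    by (auto intro!: holomorphic_intros simp: slit_def)
  show *: "polylog_ext n holomorphic_on slit \<and> polylog_ext n 0 = 0" for n
    by (induction n) (use base step in blast)+
  show "z \<in> slit \<Longrightarrow> z \<noteq> 0 \<Longrightarrow> (polylog_ext (Suc n) has_field_derivative polylog_ext n z / z) (at z)"
    using step[OF *] by blast
qed

lemma polylog_ext_eq_inner:
  assumes "norm z < 1"
  shows "polylog_ext n z = polylog (Suc n) z"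
  using assms
proof (induction n arbitrary: z)
  case 0
  then show ?case
    using polylog_1_complex[of z] by simp
next
  case (Suc n)
  let ?h = "\<lambda>z. polylog_ext (Suc n) z - polylog (Suc (Suc n)) z"
  have "?h constant_on ball 0 1"
  proof (rule DERIV_zero_connected_constant_on[where K = "{0}"])
    show "continuous_on (ball 0 1) ?h"
      using polylog_ext_holomorphic[of "Suc n"] ball_subset_slit
      by (intro continuous_intros continuous_on_subset[OF continuous_on_polylog]
          holomorphic_on_imp_continuous_on[OF holomorphic_on_subset]) auto
    show "\<forall>x\<in>ball 0 1 - {0}. DERIV ?h x :> 0"
    proof
      fix x :: complex assume x: "x \<in> ball 0 1 - {0}"
      then have "(?h has_field_derivative polylog_ext n x / x - polylog (Suc n) x / x) (at x)"
        using ball_subset_slit by (intro DERIV_diff DERIV_polylog_ext DERIV_polylog) auto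
      then show "DERIV ?h x :> 0"
        using Suc.IH[of x] x by simp
    qed
  qed auto
  then obtain c where c: "\<And>x. x \<in> ball 0 1 \<Longrightarrow> ?h x = c"
    unfolding constant_on_def by blast
  have "?h z = ?h 0"
    using c[of z] c[of 0] Suc.prems by simp
  then show ?case
    using polylog_ext_holomorphic[of "Suc n"] by (simp del: polylog_ext.simps)
qed

text \<open>Both sides are limits along the radius: the continuation is continuous at every point of
  \<open>slit\<close>, and the series is continuous on the closed disc once its exponent is at least
  2.\<close>

lemma polylog_ext_eq:
  assumes "z \<in> slit" "norm z \<le> 1"
  shows "polylog_ext (Suc n) z = polylog (Suc (Suc n)) z"
proof (rule LIMSEQ_unique)
  define r :: "nat \<Rightarrow> real" where "r = (\<lambda>k. 1 - 1 / (real k + 2))"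
  have "r \<longlonglongrightarrow> 1"
    unfolding r_def by real_asymp
  then have lim: "(\<lambda>k. of_real (r k) * z) \<longlonglongrightarrow> z"
    by (auto intro!: tendsto_eq_intros)
  have less: "norm (of_real (r k) * z) < 1" for k
  proof -
    have "0 \<le> r k" "r k < 1" by (auto simp: r_def divide_simps)
    then have "\<bar>r k\<bar> * norm z \<le> r k * 1"
      using assms(2) by (intro mult_mono) auto
    with \<open>r k < 1\<close> show ?thesis
      by (simp add: norm_mult)
  qed
  have "isCont (polylog_ext (Suc n)) z"
    using polylog_ext_holomorphic[of "Suc n"] holomorphic_on_imp_continuous_on open_slit assms(1)
    by (metis continuous_on_eq_continuous_at)
  from isCont_tendsto_compose[OF this lim]
  show "(\<lambda>k. polylog (Suc (Suc n)) (of_real (r k) * z)) \<longlonglongrightarrow> polylog_ext (Suc n) z"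
    using less by (simp add: polylog_ext_eq_inner del: polylog_ext.simps)
  show "(\<lambda>k. polylog (Suc (Suc n)) (of_real (r k) * z)) \<longlonglongrightarrow> polylog (Suc (Suc n)) z"
    by (rule continuous_on_tendsto_compose[OF continuous_on_polylog lim])
       (use less assms in \<open>auto intro!: always_eventually less_imp_le\<close>)
qed

lemma cis_in_slit:
  assumes "0 < t" "t < pi"
  shows "cis (2 * t) \<in> slit"
proof -
  have "cos (2 * t) = 1 - 2 * (sin t)\<^sup>2"
    by (simp add: cos_double_sin)
  moreover have "sin t > 0"
    using assms by (rule sin_gt_zero)
  then have "(sin t)\<^sup>2 > 0" by simp
  ultimately show ?thesis
    by (simp add: slit_iff)
qed

text \<open>\<open>1 - exp (2 i t)\<close> equals \<open>2 sin t\<close> times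
  \<open>exp (i (t - pi / 2))\<close>, and for \<open>0 < t < pi\<close> this angle lies in the
  principal range.\<close>

lemma Ln_one_minus_cis:
  assumes "0 < t" "t < pi"
  shows "Ln (1 - cis (2 * t)) = Complex (ln (2 * sin t)) (t - pi / 2)"
proof -
  have s: "sin t > 0"
    using assms by (rule sin_gt_zero)
  have "exp (Complex (ln (2 * sin t)) (t - pi / 2)) = of_real (2 * sin t) * cis (t - pi / 2)"
    using s by (simp add: exp_eq_polar)
  also have "\<dots> = 1 - cis (2 * t)"
    by (simp add: complex_eq_iff cos_diff sin_diff cos_double_sin sin_double power2_eq_square)
  finally have "1 - cis (2 * t) = exp (Complex (ln (2 * sin t)) (t - pi / 2))" ..
  then show ?thesis
    using assms by (simp add: Ln_exp)
qed

lemma polylog_cis_derivative: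
  assumes "0 < t" "t < pi"
  shows "((\<lambda>t. polylog (Suc (Suc n)) (cis (2 * t))) has_vector_derivative 2 * \<i> * polylog_ext n (cis (2 * t))) (at t)"
proof -
  have 1: "((\<lambda>t. cis (2 * t)) has_vector_derivative 2 * \<i> * cis (2 * t)) (at t)"
    unfolding cis_conv_exp
    by (rule has_vector_derivative_real_field[where f = "\<lambda>w. exp (\<i> * (2 * w))", simplified] | 
        (auto intro!: derivative_eq_intros))+
  have 2: "(polylog_ext (Suc n) has_field_derivative polylog_ext n (cis (2 * t)) / cis (2 * t)) (at (cis (2 * t)))"
    using assms by (intro DERIV_polylog_ext cis_in_slit) auto
  have 3: "((\<lambda>t. polylog_ext (Suc n) (cis (2 * t))) has_vector_derivative
      2 * \<i> * cis (2 * t) * (polylog_ext n (cis (2 * t)) / cis (2 * t))) (at t)"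
    using field_vector_diff_chain_at[OF 1 2] by (simp add: o_def del: polylog_ext.simps)
  have "((\<lambda>t. polylog (Suc (Suc n)) (cis (2 * t))) has_vector_derivative
      2 * \<i> * cis (2 * t) * (polylog_ext n (cis (2 * t)) / cis (2 * t))) (at t)"
    by (rule has_vector_derivative_transform_within_open[OF 3, of "{0<..<pi}"])
       (use assms in \<open>auto intro!: polylog_ext_eq cis_in_slit simp del: polylog_ext.simps\<close>)
  then show ?thesis by (simp add: mult.assoc)
qed


section \<open>Log-sine integrals\<close>

text \<open>The recursion is integration by parts for the integral in
  \<open>arc_moment_integral\<close>; \<open>- \<i> / 2\<close> is the reciprocal of the factor
  \<open>2 * \<i>\<close> from differentiating along the circle. For positive \<open>j\<close> the
  boundary term at \<open>pi / 2\<close> vanishes and only the polylogarithm at 1 remains.\<close>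

primrec arc_moment :: "nat \<Rightarrow> nat \<Rightarrow> complex" where
  "arc_moment 0 n = - \<i> / 2 * (polylog (Suc (Suc n)) (- 1) - polylog (Suc (Suc n)) 1)"
| "arc_moment (Suc j) n = - \<i> / 2 *
     (- of_real ((- pi / 2) ^ Suc j) * polylog (Suc (Suc n)) 1 - of_nat (Suc j) * arc_moment j (Suc n))"

lemma continuous_on_polylog_cis:
  "continuous_on S (\<lambda>t. polylog (Suc (Suc n)) (cis (2 * t)))"
  by (intro continuous_on_compose2[OF continuous_on_polylog] continuous_intros) auto

lemma arc_moment_integral:
  "((\<lambda>t. of_real (t - pi / 2) ^ j * polylog_ext n (cis (2 * t))) has_integral arc_moment j n) {0..pi / 2}"
proof (induction j arbitrary: n)
  case 0
  have "((\<lambda>t. 2 * \<i> * polylog_ext n (cis (2 * t))) has_integral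
      polylog (Suc (Suc n)) (cis (2 * (pi / 2))) - polylog (Suc (Suc n)) (cis (2 * 0))) {0..pi / 2}"
    by (rule fundamental_theorem_of_calculus_interior)
       (auto intro!: polylog_cis_derivative continuous_on_polylog_cis)
  from has_integral_mult_right[OF this, of "- \<i> / 2"] show ?case
    by simp
next
  case (Suc j)
  let ?p = "\<lambda>t. of_real (t - pi / 2) :: complex" and ?L = "\<lambda>t. polylog (Suc (Suc n)) (cis (2 * t))"
  have A: "((\<lambda>t. ?p t ^ Suc j * (2 * \<i> * polylog_ext n (cis (2 * t))) + of_nat (Suc j) * (?p t ^ j * ?L t)) has_integral
      ?p (pi / 2) ^ Suc j * ?L (pi / 2) - ?p 0 ^ Suc j * ?L 0) {0..pi / 2}"
  proof (rule fundamental_theorem_of_calculus_interior)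
    show "continuous_on {0..pi / 2} (\<lambda>t. ?p t ^ Suc j * ?L t)"
      by (intro continuous_intros continuous_on_polylog_cis)
    fix t assume t: "t \<in> {0<..<pi / 2}"
    have 1: "((\<lambda>t. ?p t ^ Suc j) has_vector_derivative of_nat (Suc j) * ?p t ^ j) (at t)"
    proof -
      have "((\<lambda>t. (t - pi / 2) ^ Suc j) has_real_derivative real (Suc j) * (t - pi / 2) ^ j) (at t)"
        by (rule derivative_eq_intros refl | simp del: power_Suc)+
      from has_vector_derivative_of_real[OF this, where ?'a = complex]
      show ?thesis by (simp del: power_Suc)
    qed
    show "((\<lambda>t. ?p t ^ Suc j * ?L t) has_vector_derivative
        ?p t ^ Suc j * (2 * \<i> * polylog_ext n (cis (2 * t))) + of_nat (Suc j) * (?p t ^ j * ?L t)) (at t)"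
      using has_vector_derivative_mult[OF 1 polylog_cis_derivative[of t n]] t
      by (simp add: algebra_simps)
  qed simp
  have B: "((\<lambda>t. of_nat (Suc j) * (?p t ^ j * ?L t)) has_integral of_nat (Suc j) * arc_moment j (Suc n)) {0..pi / 2}"
  proof (rule has_integral_mult_right)
    \<comment> \<open>The continuation and the series agree on the circle except at
      \<open>t = 0\<close>, where the point 1 lies outside \<open>slit\<close>.\<close>
    show "((\<lambda>t. ?p t ^ j * ?L t) has_integral arc_moment j (Suc n)) {0..pi / 2}"
      by (rule has_integral_spike_finite[OF _ _ Suc.IH[of "Suc n"], of "{0}"])
         (auto simp: polylog_ext_eq cis_in_slit simp del: polylog_ext.simps)
  qed
  have "- \<i> / 2 * (?p t ^ Suc j * (2 * \<i> * polylog_ext n (cis (2 * t))) + of_nat (Suc j) * (?p t ^ j * ?L t)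
       - of_nat (Suc j) * (?p t ^ j * ?L t)) = ?p t ^ Suc j * polylog_ext n (cis (2 * t))" for t
    by (simp add: algebra_simps)
  with has_integral_mult_right[OF has_integral_diff[OF A B], of "- \<i> / 2"] show ?case
    by (simp del: power_Suc polylog_ext.simps of_nat_Suc)
qed

abbreviation lsin :: "real \<Rightarrow> real" where "lsin t \<equiv> ln (sin t)"

lemma has_integral_Re:
  assumes "(f has_integral I) S"
  shows "((\<lambda>t. Re (f t)) has_integral Re I) S"
  using has_integral_linear[OF assms bounded_linear_Re] by (simp add: o_def)

lemma has_integral_Im:
  assumes "(f has_integral I) S"
  shows "((\<lambda>t. Im (f t)) has_integral Im I) S"
  using has_integral_linear[OF assms bounded_linear_Im] by (simp add: o_def)

lemma psi_power_integral:
  "((\<lambda>t. (t - pi / 2) ^ j) has_integral - ((- pi / 2) ^ Suc j) / real (Suc j)) {0..pi / 2}"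
proof -
  have "((\<lambda>t. (t - pi / 2) ^ j) has_integral
      (pi / 2 - pi / 2) ^ Suc j / real (Suc j) - (0 - pi / 2) ^ Suc j / real (Suc j)) {0..pi / 2}"
  proof (rule fundamental_theorem_of_calculus)
    fix t :: real
    have "((\<lambda>t. (t - pi / 2) ^ Suc j / real (Suc j)) has_real_derivative (t - pi / 2) ^ j) (at t within {0..pi / 2})"
      by (rule derivative_eq_intros refl | simp)+
    then show "((\<lambda>t. (t - pi / 2) ^ Suc j / real (Suc j)) has_vector_derivative (t - pi / 2) ^ j) (at t within {0..pi / 2})"
      by (simp add: has_real_derivative_iff_has_vector_derivative)
  qed simp
  then show ?thesis by simp
qed

lemma psi_lsin_integral:
  "((\<lambda>t. (t - pi / 2) ^ j * lsin t) has_integral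
     - Re (arc_moment j 0) + ln 2 * (- pi / 2) ^ Suc j / real (Suc j)) {0..pi / 2}"
proof -
  have A: "((\<lambda>t. - Re (of_real (t - pi / 2) ^ j * polylog_ext 0 (cis (2 * t))) - ln 2 * (t - pi / 2) ^ j) has_integral
       - Re (arc_moment j 0) - ln 2 * (- ((- pi / 2) ^ Suc j) / real (Suc j))) {0..pi / 2}"
    by (intro has_integral_diff has_integral_neg has_integral_Re arc_moment_integral has_integral_mult_right psi_power_integral)
  have B: "(t - pi / 2) ^ j * lsin t
      = - Re (of_real (t - pi / 2) ^ j * polylog_ext 0 (cis (2 * t))) - ln 2 * (t - pi / 2) ^ j"
    if "t \<in> {0..pi / 2} - {0}" for t
  proof -
    have "0 < t" "t < pi" "sin t > 0" using that by (auto intro: sin_gt_zero)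
    then show ?thesis
      by (simp add: Ln_one_minus_cis ln_mult flip: of_real_diff of_real_power) (simp add: algebra_simps)
  qed
  have "((\<lambda>t. (t - pi / 2) ^ j * lsin t) has_integral
       - Re (arc_moment j 0) - ln 2 * (- ((- pi / 2) ^ Suc j) / real (Suc j))) {0..pi / 2}"
    by (rule has_integral_spike_finite[of "{0}", OF _ B A]) simp_all
  then show ?thesis by simp
qed

text \<open>The imaginary part of the arc integral is elementary; comparing it yields the value of \<open>zeta 4\<close>.\<close>

lemma psi_power_arc_moment:
  "- ((- pi / 2) ^ Suc (Suc j)) / real (Suc (Suc j)) = - Im (arc_moment j 0)"
proof -
  have A: "((\<lambda>t. - Im (of_real (t - pi / 2) ^ j * polylog_ext 0 (cis (2 * t)))) has_integral - Im (arc_moment j 0)) {0..pi / 2}"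
    by (intro has_integral_neg has_integral_Im arc_moment_integral)
  have B: "(t - pi / 2) ^ Suc j = - Im (of_real (t - pi / 2) ^ j * polylog_ext 0 (cis (2 * t)))"
    if "t \<in> {0..pi / 2} - {0}" for t
  proof -
    have "0 < t" "t < pi" using that by auto
    then show ?thesis
      by (simp add: Ln_one_minus_cis flip: of_real_diff of_real_power)
  qed
  have "((\<lambda>t. (t - pi / 2) ^ Suc j) has_integral - Im (arc_moment j 0)) {0..pi / 2}"
    by (rule has_integral_spike_finite[of "{0}", OF _ B A]) simp_all
  from has_integral_unique[OF psi_power_integral this] show ?thesis .
qed

lemma polylog_one_complex: "n \<ge> 2 \<Longrightarrow> polylog n (1 :: complex) = of_real (zeta (real n))"
  using polylog_of_real[of 1 n] by (simp add: polylog_one)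

lemma polylog_minus_one_complex:
  "n \<ge> 2 \<Longrightarrow> polylog n (- 1 :: complex) = of_real ((2 / 2 ^ n - 1) * zeta (real n))"
  using polylog_of_real[of "- 1" n] by (simp add: polylog_minus_one)

text \<open>The polylogarithms at 1 and -1 are real, so the factor \<open>- \<i> / 2\<close>
  exchanges real and imaginary parts at every step of the recursion.\<close>

lemma arc_moment_parts:
  shows "Re (arc_moment 0 n) = 0"
    and "Im (arc_moment 0 n) = (1 - 1 / 2 ^ (n + 2)) * zeta (real n + 2)"
    and "Re (arc_moment (Suc j) n) = - real (Suc j) / 2 * Im (arc_moment j (Suc n))"
    and "Im (arc_moment (Suc j) n)
      = ((- pi / 2) ^ Suc j * zeta (real n + 2) + real (Suc j) * Re (arc_moment j (Suc n))) / 2"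
  by (simp_all add: polylog_one_complex polylog_minus_one_complex add.commute del: of_real_mult of_real_diff power_Suc of_nat_Suc)
     (simp_all add: field_simps)

lemma arc_moment_values:
  shows "Re (arc_moment 0 0) = 0"
    and "Re (arc_moment 1 0) = - (7 / 16) * zeta 3"
    and "Re (arc_moment 2 0) = pi / 4 * zeta 3"
    and "Re (arc_moment 3 0) = 93 / 128 * zeta 5 - 3 / 16 * pi\<^sup>2 * zeta 3"
    and "Im (arc_moment 2 0) = pi\<^sup>2 / 8 * zeta 2 - 15 / 32 * zeta 4"
proof -
  note [simp del] = arc_moment.simps
  note [simp] = arc_moment_parts
  show "Re (arc_moment 0 0) = 0" by simp
  show "Re (arc_moment 1 0) = - (7 / 16) * zeta 3"
    unfolding One_nat_def by simp
  show "Re (arc_moment 2 0) = pi / 4 * zeta 3" "Im (arc_moment 2 0) = pi\<^sup>2 / 8 * zeta 2 - 15 / 32 * zeta 4"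
    unfolding numeral_2_eq_2 by (simp_all add: power2_eq_square field_simps)
  show "Re (arc_moment 3 0) = 93 / 128 * zeta 5 - 3 / 16 * pi\<^sup>2 * zeta 3"
    unfolding numeral_3_eq_3 by (simp add: power2_eq_square field_simps)
qed

lemma zeta_4: "zeta 4 = pi ^ 4 / 90"
proof -
  have "- ((- pi / 2) ^ 4) / 4 = - (pi\<^sup>2 / 8 * (pi\<^sup>2 / 6) - 15 / 32 * zeta 4)"
    using psi_power_arc_moment[of 2] unfolding arc_moment_values zeta_2
    by (simp del: power_Suc)
  then show ?thesis
    by (simp add: power2_eq_square power4_eq_xxxx)
qed

lemma lsin_moments:
  shows "(lsin has_integral - (pi / 2 * ln 2)) {0..pi / 2}"
    and "((\<lambda>t. (t - pi / 2) * lsin t) has_integral 7 / 16 * zeta 3 + ln 2 * pi\<^sup>2 / 8) {0..pi / 2}"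
    and "((\<lambda>t. (t - pi / 2) ^ 2 * lsin t) has_integral - (pi / 4 * zeta 3) - ln 2 * pi ^ 3 / 24) {0..pi / 2}"
    and "((\<lambda>t. (t - pi / 2) ^ 3 * lsin t) has_integral
           - (93 / 128) * zeta 5 + 3 / 16 * pi\<^sup>2 * zeta 3 + ln 2 * pi ^ 4 / 64) {0..pi / 2}"
  using psi_lsin_integral[of 0] psi_lsin_integral[of 1] psi_lsin_integral[of 2] psi_lsin_integral[of 3]
  unfolding arc_moment_values
  by (simp_all add: power_divide power2_eq_square power3_eq_cube power4_eq_xxxx mult_ac)


section \<open>Contour integration of powers of the logarithm\<close>

lemma slit_of_real_iff: "of_real x \<in> slit \<longleftrightarrow> x < 1"
  by (simp add: slit_iff)

text \<open>
  The next two lemmas compare the primitive at \<open>exp (2 i t)\<close> with its (real) value at \<open>cos (2 t)\<close>, which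
  transfers the limit at the logarithmic singularity \<open>1\<close> from the real axis to the circle.
\<close>

lemma vertical_segment_bound:
  assumes t: "0 < t" "t \<le> pi / 6" and z: "z \<in> closed_segment (of_real (cos (2 * t))) (cis (2 * t))"
  shows "z \<in> slit" and "1 / 2 \<le> norm z"
    and "norm (Ln (1 - z) - of_real (ln 2)) \<le> pi - 2 * ln (sin t)"
proof -
  from z obtain u where u: "0 \<le> u" "u \<le> 1"
    "z = (1 - u) *\<^sub>R of_real (cos (2 * t)) + u *\<^sub>R cis (2 * t)"
    by (auto simp: in_segment)
  have Rez: "Re z = cos (2 * t)" and Imz: "Im z = u * sin (2 * t)"
    by (simp_all add: u(3) algebra_simps)
  have s: "0 < sin t"
    using t by (intro sin_gt_zero) auto
  have cos2: "cos (2 * t) = 1 - 2 * (sin t)\<^sup>2"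
    by (simp add: cos_double_sin)
  show "z \<in> slit"
    using s by (simp add: slit_iff Rez cos2)
  \<comment> \<open>The restriction of \<open>t\<close> to at most \<open>pi / 6\<close> keeps the
    segment at distance at least \<open>1 / 2\<close> from 0.\<close>
  have "cos (pi / 3) \<le> cos (2 * t)"
    using t by (intro cos_monotone_0_pi_le) auto
  then show "1 / 2 \<le> norm z"
    using complex_Re_le_cmod[of z] by (simp add: cos_60 Rez)
  define w where "w = 1 - z"
  have Rew: "Re w = 2 * (sin t)\<^sup>2"
    by (simp add: w_def Rez cos2)
  \<comment> \<open>The segment is vertical, so its distance from 1 is at least that of its foot;
    this bounds the real logarithm from below.\<close>
  have low: "2 * (sin t)\<^sup>2 \<le> norm w"
    using complex_Re_le_cmod[of w] by (simp add: Rew)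
  then have "w \<noteq> 0" using s by auto
  have "\<bar>Im w\<bar> \<le> 1"
  proof -
    have "\<bar>u * sin (2 * t)\<bar> \<le> 1 * 1"
      unfolding abs_mult using u by (intro mult_mono) auto
    then show ?thesis by (simp add: w_def Imz)
  qed
  moreover have "\<bar>Re w\<bar> \<le> 1"
    using \<open>cos (pi / 3) \<le> cos (2 * t)\<close> s by (simp add: w_def Rez cos_60)
  ultimately have high: "norm w \<le> 2"
    using cmod_le[of w] by linarith
  have "norm (Ln w - of_real (ln 2)) \<le> \<bar>ln (norm w) - ln 2\<bar> + \<bar>Im (Ln w)\<bar>"
    using cmod_le[of "Ln w - of_real (ln 2)"] \<open>w \<noteq> 0\<close> by simp
  moreover have "\<bar>Im (Ln w)\<bar> \<le> pi"
    using mpi_less_Im_Ln[OF \<open>w \<noteq> 0\<close>] Im_Ln_le_pi[OF \<open>w \<noteq> 0\<close>] by linarith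
  moreover have "ln (norm w) \<le> ln 2"
    using high \<open>w \<noteq> 0\<close> by simp
  moreover have "ln (2 * (sin t)\<^sup>2) \<le> ln (norm w)"
    using low s by (intro ln_mono) auto
  then have "ln 2 + 2 * ln (sin t) \<le> ln (norm w)"
    using s by (simp add: ln_mult ln_realpow)
  ultimately show "norm (Ln (1 - z) - of_real (ln 2)) \<le> pi - 2 * ln (sin t)"
    unfolding w_def[symmetric] by linarith
qed

lemma log_contour:
  assumes "n \<le> 4"
  obtains g :: "real \<Rightarrow> real" where
    "\<And>x. x < 1 \<Longrightarrow> x \<noteq> 0 \<Longrightarrow> (g has_real_derivative ((ln (1 - x) - ln 2) ^ n - (- ln 2) ^ n) / x) (at x)"
    "isCont g 0" "g 0 = 0"
    "((\<lambda>t. Re (Complex (ln (sin t)) (t - pi / 2) ^ n)) has_integral (- ln 2) ^ n * pi / 2) {0..pi / 2}"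
    "\<And>L. (g \<longlongrightarrow> L) (at_left 1) \<Longrightarrow>
      ((\<lambda>t. Im (Complex (ln (sin t)) (t - pi / 2) ^ n)) has_integral (L - g (- 1)) / 2) {0..pi / 2}"
proof -
  \<comment> \<open>Subtracting \<open>ln 2\<close> turns the modulus \<open>2 sin t\<close> of
    \<open>1 - exp (2 i t)\<close> into \<open>sin t\<close>; in exchange, \<open>f\<close> takes
    the value \<open>(- ln 2) ^ n\<close> at 0.\<close>
  define f where "f = (\<lambda>z. (Ln (1 - z) - of_real (ln 2)) ^ n)"
  have f0: "f 0 = of_real ((- ln 2) ^ n)"
    by (simp add: f_def)
  have f_real: "f (of_real x) = of_real ((ln (1 - x) - ln 2) ^ n)" if "x < 1" for x
  proof -
    have "Ln (1 - of_real x) = of_real (ln (1 - x))"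
      using that Ln_of_real[of "1 - x"] by simp
    then show ?thesis
      using that by (simp add: f_def)
  qed
  have f_cis: "f (cis (2 * t)) = Complex (ln (sin t)) (t - pi / 2) ^ n" if "0 < t" "t < pi" for t
  proof -
    have "sin t > 0" using that by (rule sin_gt_zero)
    then have "Complex (ln (2 * sin t)) (t - pi / 2) - of_real (ln 2) = Complex (ln (sin t)) (t - pi / 2)"
      by (simp add: complex_eq_iff ln_mult)
    then show ?thesis
      using that by (simp add: f_def Ln_one_minus_cis)
  qed
  have "f holomorphic_on slit"
    unfolding f_def by (intro holomorphic_intros) (auto simp: slit_def)
  then obtain G where G: "\<And>z. z \<in> slit \<Longrightarrow> z \<noteq> 0 \<Longrightarrow> (G has_field_derivative (f z - f 0) / z) (at z)"
    and G_holo: "G holomorphic_on slit" and G0: "G 0 = 0"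
    using slit_primitive by blast
  have G_cont: "isCont G z" if "z \<in> slit" for z
    using G_holo that open_slit holomorphic_on_imp_continuous_on continuous_on_eq_continuous_at by blast
  define g where "g = (\<lambda>x. Re (G (of_real x)))"
  have G_deriv_real: "((\<lambda>x. G (of_real x)) has_vector_derivative
      of_real (((ln (1 - x) - ln 2) ^ n - (- ln 2) ^ n) / x)) (at x)" if "x < 1" "x \<noteq> 0" for x
  proof -
    have "((\<lambda>x. G (of_real x)) has_vector_derivative 1 * ((f (of_real x) - f 0) / of_real x)) (at x)"
      using field_vector_diff_chain_at[of of_real 1 x G "(f (of_real x) - f 0) / of_real x"]
        G[of "of_real x"] that has_vector_derivative_of_real[OF DERIV_ident, where ?'a = complex]
      by (simp add: o_def slit_of_real_iff)
    then show ?thesis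
      using that by (simp add: f_real f0)
  qed
  have g_deriv: "(g has_real_derivative ((ln (1 - x) - ln 2) ^ n - (- ln 2) ^ n) / x) (at x)" if "x < 1" "x \<noteq> 0" for x
    using bounded_linear.has_vector_derivative[OF bounded_linear_Re G_deriv_real[OF that]]
    by (simp add: g_def has_real_derivative_iff_has_vector_derivative)
  have Im_deriv: "((\<lambda>x. Im (G (of_real x))) has_real_derivative 0) (at x)" if "x < 1" "x \<noteq> 0" for x
    using bounded_linear.has_vector_derivative[OF bounded_linear_Im G_deriv_real[OF that]]
    by (simp add: has_real_derivative_iff_has_vector_derivative)
  have G_real_cont: "isCont (\<lambda>x. G (of_real x)) x" if "x < 1" for x
    using G_cont[of "of_real x"] that by (intro isCont_o2[OF isCont_of_real]) (auto simp: slit_of_real_iff)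
  have Im_G: "Im (G (of_real x)) = 0" if "x < 1" for x
  proof -
    \<comment> \<open>The derivative of \<open>G\<close> is real on this part of the real axis and
      \<open>G 0 = 0\<close>; the derivative formula excludes 0, where continuity joins the two
      sides.\<close>
    have "(\<lambda>x. Im (G (of_real x))) constant_on {..<1}"
    proof (rule DERIV_zero_connected_constant_on[where K = "{0}"])
      show "continuous_on {..<1} (\<lambda>x. Im (G (of_real x)))"
        using G_real_cont by (intro continuous_intros continuous_at_imp_continuous_on) auto
    qed (use Im_deriv in auto)
    then obtain c where "\<And>x. x < 1 \<Longrightarrow> Im (G (of_real x)) = c"
      by (auto simp: constant_on_def)
    from this[of x] this[of 0] show ?thesis
      using that G0 by simp
  qed
  have G_cis_deriv: "((\<lambda>t. G (cis (2 * t))) has_vector_derivative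
      2 * \<i> * (Complex (ln (sin t)) (t - pi / 2) ^ n - of_real ((- ln 2) ^ n))) (at t)" if "0 < t" "t < pi" for t
  proof -
    have 1: "((\<lambda>t. cis (2 * t)) has_vector_derivative 2 * \<i> * cis (2 * t)) (at t)"
      unfolding cis_conv_exp
      by (rule has_vector_derivative_real_field[where f = "\<lambda>w. exp (\<i> * (2 * w))", simplified] | 
          (auto intro!: derivative_eq_intros))+
    from field_vector_diff_chain_at[OF 1 G[OF cis_in_slit[OF that]]] show ?thesis
      using f_cis[OF that] f0 by (simp add: o_def mult.assoc)
  qed
  \<comment> \<open>The segment has length \<open>sin (2 * t)\<close> and the integrand on it is at
    most \<open>2 * B ^ 4 / (1 / 2)\<close>, whence the factor 4. The exponent 4 serves every
    \<open>n \<le> 4\<close>, and the logarithm's growth loses against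
    \<open>sin (2 * t)\<close>.\<close>
  have close: "((\<lambda>t. G (cis (2 * t)) - G (of_real (cos (2 * t)))) \<longlongrightarrow> 0) (at_right 0)"
  proof (rule Lim_null_comparison)
    show "((\<lambda>t. 4 * (pi - 2 * ln (sin t)) ^ 4 * sin (2 * t)) \<longlongrightarrow> 0) (at_right 0)"
      by real_asymp
    have "eventually (\<lambda>t. t \<in> {0<..<pi / 6}) (at_right (0 :: real))"
      by (intro eventually_at_right_real) simp
    then show "eventually (\<lambda>t. norm (G (cis (2 * t)) - G (of_real (cos (2 * t)))) \<le> 4 * (pi - 2 * ln (sin t)) ^ 4 * sin (2 * t)) (at_right 0)"
    proof eventually_elim
      case (elim t)
      then have t: "0 < t" "t \<le> pi / 6" by auto
      have s: "0 < sin t" "0 \<le> sin (2 * t)"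
        using t by (auto intro!: sin_gt_zero sin_ge_zero)
      define B where "B = pi - 2 * ln (sin t)"
      have "ln (sin t) \<le> 0" using s by simp
      then have B: "B \<ge> 1"
        unfolding B_def using pi_gt3 by linarith
      have "norm (G (cis (2 * t)) - G (of_real (cos (2 * t)))) \<le> 4 * B ^ 4 * norm (cis (2 * t) - of_real (cos (2 * t)))"
      proof (rule field_differentiable_bound)
        fix z assume z: "z \<in> closed_segment (of_real (cos (2 * t))) (cis (2 * t))"
        note b = vertical_segment_bound[OF t z]
        have "z \<noteq> 0" using b(2) by auto
        show "(G has_field_derivative (f z - f 0) / z) (at z within closed_segment (of_real (cos (2 * t))) (cis (2 * t)))"
          using G[OF b(1) \<open>z \<noteq> 0\<close>] by (rule has_field_derivative_at_within)
        have "norm (f z) \<le> B ^ 4"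
        proof -
          have "norm (f z) \<le> B ^ n"
            unfolding f_def norm_power using b(3) by (intro power_mono) (auto simp: B_def)
          also have "\<dots> \<le> B ^ 4" using B assms by (intro power_increasing) auto
          finally show ?thesis .
        qed
        moreover have "norm (f 0) \<le> B ^ 4"
        proof -
          have "ln 2 \<le> (1 :: real)" using ln_2_less_1 by simp
          then have "norm (f 0) \<le> 1 ^ n"
            unfolding f0 by (simp add: norm_power power_le_one)
          also have "\<dots> \<le> B ^ 4" using B by (simp add: one_le_power)
          finally show ?thesis .
        qed
        ultimately have "norm (f z - f 0) \<le> 2 * B ^ 4"
          using norm_triangle_ineq4[of "f z" "f 0"] by linarith
        then have "norm (f z - f 0) / norm z \<le> 2 * B ^ 4 / (1 / 2)"
          using b(2) B by (intro frac_le) auto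
        then show "norm ((f z - f 0) / z) \<le> 4 * B ^ 4"
          by (simp add: norm_divide)
      qed auto
      also have "cis (2 * t) - of_real (cos (2 * t)) = \<i> * of_real (sin (2 * t))"
        by (simp add: complex_eq_iff)
      also have "norm \<dots> = sin (2 * t)"
        using s by (simp add: norm_mult)
      finally show ?case by (simp add: B_def)
    qed
  qed
  have cis0: "0 < t \<Longrightarrow> t < pi \<Longrightarrow> cos (2 * t) < 1" for t
    using cis_in_slit[of t] sin_gt_zero[of t] by (simp add: cos_double_sin)
  have Re_close: "((\<lambda>t. Re (G (cis (2 * t))) - g (cos (2 * t))) \<longlongrightarrow> 0) (at_right 0)"
    using tendsto_Re[OF close] by (simp add: g_def)
  have Im_close: "((\<lambda>t. Im (G (cis (2 * t)))) \<longlongrightarrow> 0) (at_right 0)"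
  proof (rule Lim_transform_eventually)
    show "((\<lambda>t. Im (G (cis (2 * t)) - G (of_real (cos (2 * t))))) \<longlongrightarrow> 0) (at_right 0)"
      using tendsto_Im[OF close] by simp
    have "eventually (\<lambda>t. t \<in> {0<..<pi}) (at_right (0 :: real))"
      by (intro eventually_at_right_real) simp
    then show "eventually (\<lambda>t. Im (G (cis (2 * t)) - G (of_real (cos (2 * t)))) = Im (G (cis (2 * t)))) (at_right 0)"
      by eventually_elim (use Im_G cis0 in auto)
  qed
  \<comment> \<open>The arc starts at 1, outside \<open>slit\<close>, so a primitive along it has
    only a limit \<open>L\<close> at \<open>t = 0\<close>; \<open>k\<close> is its continuous
    extension.\<close>
  have FTC: "(h' has_integral h (pi / 2) - L) {0..pi / 2}"
    if h: "(h \<longlongrightarrow> L) (at_right 0)" "\<And>t. 0 < t \<Longrightarrow> t < pi \<Longrightarrow> (h has_real_derivative h' t) (at t)" for h h' :: "real \<Rightarrow> real" and L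
  proof -
    define k where "k = (\<lambda>t. if t = 0 then L else h t)"
    have "(h' has_integral k (pi / 2) - k 0) {0..pi / 2}"
    proof (rule fundamental_theorem_of_calculus_interior)
      show "(k has_vector_derivative h' t) (at t)" if t: "t \<in> {0<..<pi / 2}" for t
      proof -
        have "(h has_vector_derivative h' t) (at t)"
          using h(2)[of t] t by (simp add: has_real_derivative_iff_has_vector_derivative)
        then show ?thesis
          by (rule has_vector_derivative_transform_within_open[of _ _ _ "{0<..<pi}"]) (use t in \<open>auto simp: k_def\<close>)
      qed
      show "continuous_on {0..pi / 2} k"
        unfolding continuous_on
      proof
        fix t assume t: "t \<in> {0..pi / 2}"
        show "(k \<longlongrightarrow> k t) (at t within {0..pi / 2})"
        proof (cases "t = 0")
          case True
          have "(k \<longlongrightarrow> L) (at_right 0)"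
            using h(1) by (rule Lim_transform_eventually) (auto simp: k_def eventually_at_filter)
          then show ?thesis
            using True by (simp add: k_def at_within_Icc_at_right)
        next
          case False
          have "isCont h t"
            using h(2)[of t] False t DERIV_isCont by auto
          then have "(h \<longlongrightarrow> h t) (at t within {0..pi / 2})"
            unfolding isCont_def by (rule tendsto_within_subset) simp
          moreover have "eventually (\<lambda>u. u \<noteq> 0) (at t within {0..pi / 2})"
            by (rule eventually_neq_at_within)
          ultimately show ?thesis
            using False by (auto simp: k_def elim!: Lim_transform_eventually eventually_mono)
        qed
      qed
    qed simp
    then show ?thesis by (simp add: k_def)
  qed
  have cis_pi: "cis (2 * (pi / 2)) = - 1" by simp
  show thesis
  proof (rule that[of g])
    show "isCont g 0"
      unfolding g_def using G_real_cont[of 0] by (simp add: isCont_def tendsto_Re)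
    show "g 0 = 0" by (simp add: g_def G0)
    \<comment> \<open>\<open>G\<close> is real at -1 and its imaginary part tends to 0 at 1. Hence
      this integral vanishes, and the real part integrates to its subtracted constant.\<close>
    have "((\<lambda>t. 2 * (Re (Complex (ln (sin t)) (t - pi / 2) ^ n) - (- ln 2) ^ n)) has_integral
        Im (G (cis (2 * (pi / 2)))) - 0) {0..pi / 2}"
    proof (rule FTC[OF Im_close])
      fix t :: real assume t: "0 < t" "t < pi"
      show "((\<lambda>t. Im (G (cis (2 * t)))) has_real_derivative
          2 * (Re (Complex (ln (sin t)) (t - pi / 2) ^ n) - (- ln 2) ^ n)) (at t)"
        using bounded_linear.has_vector_derivative[OF bounded_linear_Im G_cis_deriv[OF t]]
        by (simp add: has_real_derivative_iff_has_vector_derivative flip: of_real_power of_real_minus)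
    qed
    then have 1: "((\<lambda>t. 2 * (Re (Complex (ln (sin t)) (t - pi / 2) ^ n) - (- ln 2) ^ n)) has_integral 0) {0..pi / 2}"
      unfolding cis_pi using Im_G[of "- 1"] by simp
    have 2: "((\<lambda>t. (- ln 2) ^ n) has_integral (- ln 2) ^ n * pi / 2) {0..pi / 2}"
      using has_integral_const_real[of "(- ln 2 :: real) ^ n" 0 "pi / 2"] by (simp add: mult.commute)
    show "((\<lambda>t. Re (Complex (ln (sin t)) (t - pi / 2) ^ n)) has_integral (- ln 2) ^ n * pi / 2) {0..pi / 2}"
      using has_integral_add[OF has_integral_mult_right[OF 1, of "1 / 2"] 2] by (simp add: diff_divide_distrib)
    fix L assume L: "(g \<longlongrightarrow> L) (at_left 1)"
    have "filterlim (\<lambda>t. cos (2 * t)) (at_left 1) (at_right (0 :: real))"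
      by real_asymp
    from filterlim_compose[OF L this] have Re_lim: "((\<lambda>t. Re (G (cis (2 * t)))) \<longlongrightarrow> L) (at_right 0)"
      using tendsto_add[OF Re_close] by fastforce
    have "((\<lambda>t. - 2 * Im (Complex (ln (sin t)) (t - pi / 2) ^ n)) has_integral
        Re (G (cis (2 * (pi / 2)))) - L) {0..pi / 2}"
    proof (rule FTC[OF Re_lim])
      fix t :: real assume t: "0 < t" "t < pi"
      show "((\<lambda>t. Re (G (cis (2 * t)))) has_real_derivative - 2 * Im (Complex (ln (sin t)) (t - pi / 2) ^ n)) (at t)"
        using bounded_linear.has_vector_derivative[OF bounded_linear_Re G_cis_deriv[OF t]]
        by (simp add: has_real_derivative_iff_has_vector_derivative flip: of_real_power of_real_minus)
    qed
    from has_integral_mult_right[OF this[unfolded cis_pi], of "- 1 / 2"]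
    show "((\<lambda>t. Im (Complex (ln (sin t)) (t - pi / 2) ^ n)) has_integral (L - g (- 1)) / 2) {0..pi / 2}"
      by (simp add: g_def diff_divide_distrib)
  qed (rule g_deriv)
qed


section \<open>The real primitive for the fourth power\<close>

lemma DERIV_polylog_chain:
  fixes f :: "real \<Rightarrow> real"
  assumes "(f has_real_derivative D) (at x)" "0 < f x" "f x < 1"
  shows "((\<lambda>x. polylog (Suc n) (f x)) has_real_derivative polylog n (f x) / f x * D) (at x)"
  using DERIV_chain2[OF DERIV_polylog assms(1)] assms(2,3) by simp

lemma tendsto_polylog_one:
  fixes f :: "real \<Rightarrow> real"
  assumes "(f \<longlongrightarrow> 1) F" "eventually (\<lambda>x. \<bar>f x\<bar> \<le> 1) F" "n \<ge> 2"
  shows "((\<lambda>x. polylog n (f x)) \<longlongrightarrow> zeta (real n)) F"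
  using continuous_on_tendsto_compose[OF continuous_on_polylog[OF assms(3)] assms(1)] assms(2)
  by (simp add: polylog_one)

lemma polylog_le:
  fixes x :: real
  assumes "0 \<le> x" "x \<le> 1" "n \<ge> 2"
  shows "\<bar>polylog n x\<bar> \<le> zeta (real n) * x"
proof -
  have s: "(\<lambda>k. x ^ Suc k / real (Suc k) ^ n) sums polylog n x"
    using polylog_sums_boundary[of n x] assms by simp
  have "polylog n x \<le> zeta (real n) * x"
  proof (rule sums_le[OF _ s sums_mult2[OF zeta_sums[OF assms(3)], of x]])
    fix k
    have "x ^ Suc k \<le> x"
      using assms power_le_one[of x k] mult_left_le[of "x ^ k" x] by simp
    then show "x ^ Suc k / real (Suc k) ^ n \<le> 1 / real (Suc k) ^ n * x"
      by (simp add: divide_right_mono del: of_nat_Suc power_Suc)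
  qed
  moreover have "0 \<le> polylog n x"
    using sums_le[OF _ sums_zero s] assms by simp
  ultimately show ?thesis by simp
qed

text \<open>Each side of 0 has its own explicit primitive, because the arguments
  \<open>1 - x\<close> and \<open>1 / (1 - x)\<close> lie in the unit interval for
  \<open>0 < x < 1\<close> and for \<open>x < 0\<close> respectively. Continuity of \<open>g\<close>
  at 0 fixes both integration constants.\<close>

lemma log_contour_4_values:
  fixes g :: "real \<Rightarrow> real"
  assumes g_deriv: "\<And>x. x < 1 \<Longrightarrow> x \<noteq> 0 \<Longrightarrow>
      (g has_real_derivative ((ln (1 - x) - ln 2) ^ 4 - (- ln 2) ^ 4) / x) (at x)"
    and g_cont: "isCont g 0" and g0: "g 0 = 0"
  shows "(g \<longlongrightarrow> 4 * ln 2 ^ 3 * zeta 2 + 12 * ln 2 ^ 2 * zeta 3 + 24 * ln 2 * zeta 4 + 24 * zeta 5) (at_left 1)"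
    and "g (- 1) = - 24 * polylog 5 (1 / 2) + ln 2 ^ 5 / 5 - 4 * ln 2 ^ 3 * zeta 2 + 12 * ln 2 ^ 2 * zeta 3
           - 24 * ln 2 * zeta 4 + 24 * zeta 5"
proof -
  have polylog_Suc: "polylog 2 = polylog (Suc 1)" "polylog 3 = polylog (Suc 2)"
    "polylog 4 = polylog (Suc 3)" "polylog 5 = polylog (Suc 4)"
    by (simp_all add: eval_nat_numeral)
  have g_tendsto: "(g \<longlongrightarrow> 0) (at 0 within S)" for S
    using g_cont g0 by (metis isCont_def tendsto_within_subset top_greatest)
  txt \<open>
    Primitives in terms of \<open>w = 1 - x\<close> for \<open>x > 0\<close> and \<open>v = 1 / (1 - x)\<close> for \<open>x < 0\<close>. Powers of
    \<open>ln (w / 2) = - ln (2 v)\<close> are used, so that at \<open>v = 1 / 2\<close> only the pentalogarithm survives.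
  \<close>
  define m where "m = (\<lambda>x :: real. ln (1 - x) - ln 2)"
  define E where "E = (\<lambda>x. (m x ^ 4 - ln 2 ^ 4) * ln x + 4 * m x ^ 3 * polylog 2 (1 - x)
     - 12 * m x ^ 2 * polylog 3 (1 - x) + 24 * m x * polylog 4 (1 - x) - 24 * polylog 5 (1 - x))"
  have E_deriv: "(E has_real_derivative (m x ^ 4 - ln 2 ^ 4) / x) (at x)" if "0 < x" "x < 1" for x
  proof -
    define i j where "i = 1 / (1 - x)" and "j = 1 / x"
    have m': "(m has_real_derivative - i) (at x)"
      unfolding m_def i_def using that by (auto intro!: derivative_eq_intros simp: divide_simps)
    have l: "(ln has_real_derivative j) (at x)"
      unfolding j_def using that by (intro DERIV_ln_divide)
    have p: "((\<lambda>x. polylog (Suc n) (1 - x)) has_real_derivative polylog n (1 - x) * (- i)) (at x)" for n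
    proof -
      have "((\<lambda>x. 1 - x) has_real_derivative - 1) (at x)"
        by (auto intro!: derivative_eq_intros)
      from DERIV_polylog_chain[OF this, of n] show ?thesis
        using that by (simp add: i_def)
    qed
    note p' = p[of 1, folded polylog_Suc] p[of 2, folded polylog_Suc] p[of 3, folded polylog_Suc] p[of 4, folded polylog_Suc]
    have p1: "polylog 1 (1 - x) = - ln x"
      using polylog_1_real[of "1 - x"] that by simp
    have "(E has_real_derivative (m x ^ 4 - ln 2 ^ 4) * j) (at x)"
      unfolding E_def
      by (rule derivative_eq_intros m' p' l refl)+
         (simp add: p1[simplified] algebra_simps power2_eq_square power3_eq_cube)
    then show ?thesis by (simp add: j_def)
  qed
  have gE: "\<exists>c. \<forall>x\<in>{0<..<1}. g x - E x = c"
  proof (rule has_field_derivative_zero_constant)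
    fix x :: real assume "x \<in> {0<..<1}"
    then have "((\<lambda>x. g x - E x) has_field_derivative 0) (at x)"
      using DERIV_diff[OF g_deriv[of x] E_deriv[of x]] by (simp add: m_def)
    then show "((\<lambda>x. g x - E x) has_field_derivative 0) (at x within {0<..<1})"
      by (rule has_field_derivative_at_within)
  qed simp
  then obtain c where "\<forall>x\<in>{0<..<1}. g x - E x = c" ..
  then have c: "g x = E x + c" if "0 < x" "x < 1" for x
    using that by (simp add: algebra_simps)
  define E0 where "E0 = - 4 * ln 2 ^ 3 * zeta 2 - 12 * ln 2 ^ 2 * zeta 3 - 24 * ln 2 * zeta 4 - 24 * zeta 5"
  have E_lim: "(E \<longlongrightarrow> E0) (at_right 0)"
  proof -
    have 1: "((\<lambda>x. (m x ^ 4 - ln 2 ^ 4) * ln x) \<longlongrightarrow> 0) (at_right 0)"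
      unfolding m_def by real_asymp
    have 2: "(m \<longlongrightarrow> - ln 2) (at_right 0)"
      unfolding m_def by (auto intro!: tendsto_eq_intros)
    have "((\<lambda>x::real. 1 - x) \<longlongrightarrow> 1) (at_right 0)"
      by (auto intro!: tendsto_eq_intros)
    moreover have "eventually (\<lambda>x :: real. \<bar>1 - x\<bar> \<le> 1) (at_right 0)"
      using eventually_at_right_real[of 0 1] by (auto elim!: eventually_mono)
    ultimately have pl: "((\<lambda>x. polylog n (1 - x)) \<longlongrightarrow> zeta (real n)) (at_right (0 :: real))" if "n \<ge> 2" for n
      using that by (intro tendsto_polylog_one)
    note pls = pl[of 2, simplified] pl[of 3, simplified] pl[of 4, simplified] pl[of 5, simplified]
    show ?thesis
      unfolding E_def E0_def by (rule tendsto_eq_intros 1 2 pls refl)+ simp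
  qed
  have "c = - E0"
  proof -
    have "((\<lambda>x. E x + c) \<longlongrightarrow> E0 + c) (at_right 0)"
      by (intro tendsto_intros E_lim)
    moreover have "eventually (\<lambda>x. E x + c = g x) (at_right 0)"
      using eventually_at_right_real[of 0 "1 :: real"] by (auto elim!: eventually_mono simp: c)
    ultimately have "(g \<longlongrightarrow> E0 + c) (at_right 0)"
      by (rule Lim_transform_eventually)
    with g_tendsto have "0 = E0 + c"
      by (metis tendsto_unique trivial_limit_at_right_real)
    then show ?thesis by simp
  qed
  \<comment> \<open>\<open>polylog n (1 - x)\<close> is of order \<open>1 - x\<close>, which beats
    any power of the logarithm; \<open>(1 + (m x) ^ 2) ^ 3\<close> dominates
    \<open>\<bar>m x\<bar> ^ j\<close> for all \<open>j \<le> 3\<close> at once.\<close>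
  have small: "((\<lambda>x. m x ^ j * polylog n (1 - x)) \<longlongrightarrow> 0) (at_left 1)" if "n \<ge> 2" "j \<le> 3" for n j
  proof (rule Lim_null_comparison)
    have "((\<lambda>x :: real. (1 + (ln (1 - x) - ln 2)\<^sup>2) ^ 3 * (1 - x)) \<longlongrightarrow> 0) (at_left 1)"
      by real_asymp
    from tendsto_mult_right_zero[OF this, of "zeta (real n)"]
    show "((\<lambda>x. zeta (real n) * ((1 + (m x)\<^sup>2) ^ 3 * (1 - x))) \<longlongrightarrow> 0) (at_left 1)"
      by (simp add: m_def)
    have "eventually (\<lambda>x :: real. x \<in> {0<..<1}) (at_left 1)"
      by (intro eventually_at_left_real) simp
    then show "eventually (\<lambda>x. norm (m x ^ j * polylog n (1 - x)) \<le> zeta (real n) * ((1 + (m x)\<^sup>2) ^ 3 * (1 - x))) (at_left 1)"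
    proof eventually_elim
      case (elim x)
      have "0 \<le> (\<bar>m x\<bar> - 1)\<^sup>2" by simp
      then have "\<bar>m x\<bar> \<le> 1 + (m x)\<^sup>2"
        unfolding power2_diff by simp
      then have "\<bar>m x\<bar> ^ j \<le> (1 + (m x)\<^sup>2) ^ j"
        by (intro power_mono) auto
      also have "\<dots> \<le> (1 + (m x)\<^sup>2) ^ 3"
        using that by (intro power_increasing) auto
      finally have "\<bar>m x\<bar> ^ j \<le> (1 + (m x)\<^sup>2) ^ 3" .
      moreover have "\<bar>polylog n (1 - x)\<bar> \<le> zeta (real n) * (1 - x)"
        using elim that by (intro polylog_le) auto
      ultimately have "\<bar>m x\<bar> ^ j * \<bar>polylog n (1 - x)\<bar> \<le> (1 + (m x)\<^sup>2) ^ 3 * (zeta (real n) * (1 - x))"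
        by (intro mult_mono) auto
      then show ?case
        by (simp add: abs_mult power_abs mult_ac)
    qed
  qed
  have "(E \<longlongrightarrow> 0) (at_left 1)"
  proof -
    have 1: "((\<lambda>x. (m x ^ 4 - ln 2 ^ 4) * ln x) \<longlongrightarrow> 0) (at_left 1)"
      unfolding m_def by real_asymp
    have "((\<lambda>x. (m x ^ 4 - ln 2 ^ 4) * ln x + 4 * (m x ^ 3 * polylog 2 (1 - x))
     - 12 * (m x ^ 2 * polylog 3 (1 - x)) + 24 * (m x ^ 1 * polylog 4 (1 - x)) - 24 * (m x ^ 0 * polylog 5 (1 - x)))
      \<longlongrightarrow> 0 + 4 * 0 - 12 * 0 + 24 * 0 - 24 * 0) (at_left 1)"
      by (intro tendsto_add tendsto_diff tendsto_mult_left 1 small) auto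
    then show ?thesis
      by (simp add: E_def[abs_def] mult.assoc)
  qed
  then have "((\<lambda>x. E x + c) \<longlongrightarrow> 0 + c) (at_left 1)"
    by (intro tendsto_intros)
  moreover have "eventually (\<lambda>x. E x + c = g x) (at_left 1)"
    using eventually_at_left_real[of 0 "1 :: real"] by (auto elim!: eventually_mono simp: c)
  ultimately have "(g \<longlongrightarrow> 0 + c) (at_left 1)"
    by (rule Lim_transform_eventually)
  then show "(g \<longlongrightarrow> 4 * ln 2 ^ 3 * zeta 2 + 12 * ln 2 ^ 2 * zeta 3 + 24 * ln 2 * zeta 4 + 24 * zeta 5) (at_left 1)"
    by (simp add: \<open>c = - E0\<close> E0_def algebra_simps)

  define v where "v = (\<lambda>x :: real. 1 / (1 - x))"
  \<comment> \<open>\<open>polylog 1 (v x)\<close> is \<open>- ln (- x / (1 - x))\<close>, whose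
    logarithm has derivative \<open>1 / x + 1 / (1 - x)\<close>; the term \<open>m x ^ 5 / 5\<close>
    removes the unwanted \<open>1 / (1 - x)\<close>.\<close>
  define F where "F = (\<lambda>x. m x ^ 5 / 5 + m x ^ 4 * ln (- x / (1 - x)) - ln 2 ^ 4 * ln (- x)
     - 4 * m x ^ 3 * polylog 2 (v x)
     - 12 * m x ^ 2 * polylog 3 (v x) - 24 * m x * polylog 4 (v x) - 24 * polylog 5 (v x))"
  have F_deriv: "(F has_real_derivative (m x ^ 4 - ln 2 ^ 4) / x) (at x)" if "x < 0" for x
  proof -
    define i j where "i = 1 / (1 - x)" and "j = 1 / x"
    have m': "(m has_real_derivative - i) (at x)"
      unfolding m_def i_def using that by (auto intro!: derivative_eq_intros simp: divide_simps)
    have "(v has_real_derivative 1 / (1 - x)\<^sup>2) (at x)"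
      unfolding v_def using that by (auto intro!: derivative_eq_intros simp: power2_eq_square)
    from DERIV_polylog_chain[OF this]
    have p: "((\<lambda>x. polylog (Suc n) (v x)) has_real_derivative polylog n (v x) * i) (at x)" for n
      using that by (simp add: v_def i_def power2_eq_square)
    note p' = p[of 1, folded polylog_Suc] p[of 2, folded polylog_Suc] p[of 3, folded polylog_Suc] p[of 4, folded polylog_Suc]
    have l: "((\<lambda>x. ln (- x / (1 - x))) has_real_derivative j + i) (at x)"
      unfolding i_def j_def using that by (auto intro!: derivative_eq_intros simp: divide_simps mult_neg_neg)
    have l2: "((\<lambda>x. ln (- x)) has_real_derivative j) (at x)"
      unfolding j_def using that by (auto intro!: derivative_eq_intros simp: divide_simps)
    have "1 - v x = - x / (1 - x)"
      using that by (simp add: v_def field_simps)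
    then have p1: "polylog 1 (v x) = - ln (- x / (1 - x))"
      using polylog_1_real[of "v x"] that by (simp add: v_def)
    have "(F has_real_derivative (m x ^ 4 - ln 2 ^ 4) * j) (at x)"
      unfolding F_def
      by (rule derivative_eq_intros m' p' l l2 refl | simp)+
         (simp add: p1[simplified] algebra_simps power2_eq_square power3_eq_cube power4_eq_xxxx)
    then show ?thesis by (simp add: j_def)
  qed
  have "\<exists>c. \<forall>x\<in>{..<0}. g x - F x = c"
  proof (rule has_field_derivative_zero_constant)
    fix x :: real assume "x \<in> {..<0}"
    then have "((\<lambda>x. g x - F x) has_field_derivative 0) (at x)"
      using DERIV_diff[OF g_deriv[of x] F_deriv[of x]] by (simp add: m_def)
    then show "((\<lambda>x. g x - F x) has_field_derivative 0) (at x within {..<0})"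
      by (rule has_field_derivative_at_within)
  qed simp
  then obtain d where "\<forall>x\<in>{..<0}. g x - F x = d" ..
  then have d: "g x = F x + d" if "x < 0" for x
    using that by (simp add: algebra_simps)
  define F0 where "F0 = - (ln 2 ^ 5) / 5 + 4 * ln 2 ^ 3 * zeta 2 - 12 * ln 2 ^ 2 * zeta 3 + 24 * ln 2 * zeta 4 - 24 * zeta 5"
  have F_lim: "(F \<longlongrightarrow> F0) (at_left 0)"
  proof -
    \<comment> \<open>Both logarithms diverge at 0; only their difference has a limit, so the two
      terms are kept together.\<close>
    have 1: "((\<lambda>x. m x ^ 4 * ln (- x / (1 - x)) - ln 2 ^ 4 * ln (- x)) \<longlongrightarrow> 0) (at_left 0)"
      unfolding m_def by real_asymp
    have 2: "(m \<longlongrightarrow> - ln 2) (at_left 0)"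
      unfolding m_def by (auto intro!: tendsto_eq_intros)
    have "(v \<longlongrightarrow> 1) (at_left 0)"
      unfolding v_def by (auto intro!: tendsto_eq_intros)
    moreover have "eventually (\<lambda>x :: real. \<bar>v x\<bar> \<le> 1) (at_left 0)"
      using eventually_at_left_real[of "- 1" 0] by (auto elim!: eventually_mono simp: v_def)
    ultimately have pl: "((\<lambda>x. polylog n (v x)) \<longlongrightarrow> zeta (real n)) (at_left 0)" if "n \<ge> 2" for n
      using that by (intro tendsto_polylog_one)
    note pls = pl[of 2, simplified] pl[of 3, simplified] pl[of 4, simplified] pl[of 5, simplified]
    have "((\<lambda>x. m x ^ 5 / 5 + (m x ^ 4 * ln (- x / (1 - x)) - ln 2 ^ 4 * ln (- x))
     - 4 * m x ^ 3 * polylog 2 (v x)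
     - 12 * m x ^ 2 * polylog 3 (v x) - 24 * m x * polylog 4 (v x) - 24 * polylog 5 (v x)) \<longlongrightarrow> F0) (at_left 0)"
      unfolding F0_def by (rule tendsto_eq_intros 1 2 pls refl | simp)+
    then show ?thesis
      by (simp add: F_def[abs_def] add_diff_eq)
  qed
  have "d = - F0"
  proof -
    have "((\<lambda>x. F x + d) \<longlongrightarrow> F0 + d) (at_left 0)"
      by (intro tendsto_intros F_lim)
    moreover have "eventually (\<lambda>x. F x + d = g x) (at_left 0)"
      using eventually_at_left_real[of "- 1 :: real" 0] by (auto elim!: eventually_mono simp: d)
    ultimately have "(g \<longlongrightarrow> F0 + d) (at_left 0)"
      by (rule Lim_transform_eventually)
    with g_tendsto have "0 = F0 + d"
      by (metis tendsto_unique trivial_limit_at_left_real)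
    then show ?thesis by simp
  qed
  have "F (- 1) = - 24 * polylog 5 (1 / 2)"
    by (simp add: F_def m_def v_def)
  then show "g (- 1) = - 24 * polylog 5 (1 / 2) + ln 2 ^ 5 / 5 - 4 * ln 2 ^ 3 * zeta 2 + 12 * ln 2 ^ 2 * zeta 3
           - 24 * ln 2 * zeta 4 + 24 * zeta 5"
    using d[of "- 1"] \<open>d = - F0\<close> by (simp add: F0_def)
qed


section \<open>Integrals of powers of the log-sine\<close>

abbreviation halfpi :: "real set" where "halfpi \<equiv> {0..pi / 2}"

text \<open>The real part of \<open>(a + i b) ^ 2\<close> is \<open>a ^ 2 - b ^ 2\<close>; that of
  the cube, used next, is \<open>a ^ 3 - 3 a b ^ 2\<close>. The terms in
  \<open>b = t - pi / 2\<close> are moments already known.\<close>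

lemma lsin_square_integral: "((\<lambda>t. lsin t ^ 2) has_integral pi ^ 3 / 24 + pi / 2 * ln 2 ^ 2) halfpi"
proof -
  obtain g where "((\<lambda>t. Re (Complex (lsin t) (t - pi / 2) ^ 2)) has_integral (- ln 2) ^ 2 * pi / 2) halfpi"
    using log_contour[of 2] by auto
  from has_integral_add[OF this psi_power_integral[of 2]] show ?thesis
    by (simp add: power2_eq_square power3_eq_cube algebra_simps)
qed

lemma lsin_cube_integral:
  "((\<lambda>t. lsin t ^ 3) has_integral - (pi / 2 * ln 2 ^ 3) - 3 / 4 * pi * zeta 3 - ln 2 * pi ^ 3 / 8) halfpi"
proof -
  obtain g where "((\<lambda>t. Re (Complex (lsin t) (t - pi / 2) ^ 3)) has_integral (- ln 2) ^ 3 * pi / 2) halfpi"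
    using log_contour[of 3] by auto
  from has_integral_add[OF this has_integral_mult_right[OF lsin_moments(3), of 3]]
  have "((\<lambda>t. Re (Complex (lsin t) (t - pi / 2) ^ 3) + 3 * ((t - pi / 2) ^ 2 * lsin t)) has_integral
      (- ln 2) ^ 3 * pi / 2 + 3 * (- (pi / 4 * zeta 3) - ln 2 * pi ^ 3 / 24)) halfpi" .
  moreover have "Re (Complex (lsin t) (t - pi / 2) ^ 3) + 3 * ((t - pi / 2) ^ 2 * lsin t) = lsin t ^ 3" for t
    by (simp add: power2_eq_square power3_eq_cube algebra_simps)
  moreover have "(- ln 2) ^ 3 * pi / 2 + 3 * (- (pi / 4 * zeta 3) - ln 2 * pi ^ 3 / 24)
      = - (pi / 2 * ln 2 ^ 3) - 3 / 4 * pi * zeta 3 - ln 2 * pi ^ 3 / 8"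
    by (simp add: power2_eq_square power3_eq_cube field_simps)
  ultimately show ?thesis by (simp only:)
qed

text \<open>A quarter of the imaginary part of \<open>(a + i b) ^ 4\<close> is
  \<open>a ^ 3 b - a b ^ 3\<close>, and the last term is the third moment of the log-sine. In the
  difference of the two contour values the terms in \<open>zeta 3\<close> and \<open>zeta 5\<close>
  cancel.\<close>

lemma psi_lsin_cube_integral:
  "((\<lambda>t. (t - pi / 2) * lsin t ^ 3) has_integral
     - (93 / 128) * zeta 5 + 3 / 16 * pi\<^sup>2 * zeta 3 + ln 2 * pi ^ 4 / 64
     + 3 * Li5 (1 / 2) - ln 2 ^ 5 / 40 + ln 2 ^ 3 * zeta 2 + 6 * ln 2 * zeta 4) halfpi"
proof -
  obtain g :: "real \<Rightarrow> real" where g: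
    "\<And>x. x < 1 \<Longrightarrow> x \<noteq> 0 \<Longrightarrow> (g has_real_derivative ((ln (1 - x) - ln 2) ^ 4 - (- ln 2) ^ 4) / x) (at x)"
    "isCont g 0" "g 0 = 0"
    "((\<lambda>t. Re (Complex (lsin t) (t - pi / 2) ^ 4)) has_integral (- ln 2) ^ 4 * pi / 2) halfpi"
    "\<And>L. (g \<longlongrightarrow> L) (at_left 1) \<Longrightarrow>
      ((\<lambda>t. Im (Complex (lsin t) (t - pi / 2) ^ 4)) has_integral (L - g (- 1)) / 2) halfpi"
    by (rule log_contour[of 4]) (rule order_refl, rule that)
  have v1: "(g \<longlongrightarrow> 4 * ln 2 ^ 3 * zeta 2 + 12 * ln 2 ^ 2 * zeta 3 + 24 * ln 2 * zeta 4 + 24 * zeta 5) (at_left 1)"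
    by (rule log_contour_4_values(1)) (use g(1-3) in blast)+
  have v2: "g (- 1) = - 24 * polylog 5 (1 / 2) + ln 2 ^ 5 / 5 - 4 * ln 2 ^ 3 * zeta 2 + 12 * ln 2 ^ 2 * zeta 3
      - 24 * ln 2 * zeta 4 + 24 * zeta 5"
    by (rule log_contour_4_values(2)) (use g(1-3) in blast)+
  have *: "(1 / 4) * Im (Complex a b ^ 4) + b ^ 3 * a = b * a ^ 3" for a b
    by (simp add: power3_eq_cube power4_eq_xxxx algebra_simps)
  show ?thesis
    using has_integral_add[OF has_integral_mult_right[OF g(5)[OF v1], of "1 / 4"] lsin_moments(4)]
    unfolding * by (rule has_integral_eq_rhs) (simp add: v2 Li5_conv_polylog field_simps)
qed

section \<open>Reflection, duplication and the weighted integrals\<close>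

lemma has_integral_reflect_shift:
  fixes f :: "real \<Rightarrow> real"
  assumes "(f has_integral I) {a..b}"
  shows "((\<lambda>t. f (c - t)) has_integral I) {c - b..c - a}"
proof -
  have "((\<lambda>t. f (- t)) has_integral I) {- b..- a}"
    using assms by (simp add: has_integral_reflect_real)
  from has_integral_affinity'[of "\<lambda>t. f (- t)" I "- b" "- a" 1 "- c"] this show ?thesis
    by simp
qed

lemma reflect_halfpi:
  fixes f :: "real \<Rightarrow> real"
  assumes "(f has_integral I) halfpi"
  shows "((\<lambda>t. f (pi / 2 - t)) has_integral I) halfpi"
  using has_integral_reflect_shift[OF assms, of "pi / 2"] by simp

text \<open>By the symmetry of the sine about \<open>pi / 2\<close> the integral over
  \<open>{0..pi}\<close> is twice \<open>I\<close>; halving the variable takes the factor 2 away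
  again.\<close>

lemma double_angle_integral:
  fixes f :: "real \<Rightarrow> real"
  assumes "((\<lambda>t. f (sin t)) has_integral I) halfpi"
  shows "((\<lambda>t. f (sin (2 * t))) has_integral I) halfpi"
proof -
  have "((\<lambda>t. f (sin t)) has_integral I) {pi / 2..pi}"
    using has_integral_reflect_shift[OF assms, of pi] by simp
  from has_integral_combine[OF _ _ assms this] have "((\<lambda>t. f (sin t)) has_integral I + I) {0..pi}"
    by simp
  from has_integral_affinity'[of "\<lambda>t. f (sin t)" "I + I" 0 pi 2 0] this show ?thesis
    by simp
qed

text \<open>
  At the endpoints of \<open>halfpi\<close> the convention \<open>ln 0 = 0\<close> makes \<open>lgS\<close> and \<open>lgC\<close> vanish instead of diverge.
\<close>

abbreviation lgS :: "real \<Rightarrow> real" where "lgS t \<equiv> - 2 * ln (sin t)"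
abbreviation lgC :: "real \<Rightarrow> real" where "lgC t \<equiv> - 2 * ln (cos t)"

lemma lgS_reflect: "lgS (pi / 2 - t) = lgC t" and lgC_reflect: "lgC (pi / 2 - t) = lgS t"
  by (simp_all add: sin_diff cos_diff)

lemma lgS_nonneg: "t \<in> halfpi \<Longrightarrow> 0 \<le> lgS t"
proof -
  assume t: "t \<in> halfpi"
  then have "0 \<le> sin t" "sin t \<le> 1" by (auto intro: sin_ge_zero)
  then show "0 \<le> lgS t" by (cases "sin t = 0") auto
qed

lemma lgC_nonneg: "t \<in> halfpi \<Longrightarrow> 0 \<le> lgC t"
  using lgS_nonneg[of "pi / 2 - t"] unfolding lgS_reflect by simp

text \<open>Reflection gives \<open>J = pi / 2 * I - J\<close> for the unknown integral
  \<open>J\<close>. Nonnegativity of \<open>K\<close> provides absolute integrability, and with it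
  the existence of \<open>J\<close>.\<close>

lemma symmetric_weight_integral:
  fixes K :: "real \<Rightarrow> real"
  assumes "(K has_integral I) halfpi" "\<And>t. t \<in> halfpi \<Longrightarrow> 0 \<le> K t" "\<And>t. K (pi / 2 - t) = K t"
  shows "((\<lambda>t. t * K t) has_integral pi / 4 * I) halfpi"
proof -
  have "K absolutely_integrable_on halfpi"
    using assms(1,2) by (intro nonnegative_absolutely_integrable_1) (auto simp: integrable_on_def)
  then have "(\<lambda>t. t * K t) absolutely_integrable_on halfpi"
    by (intro absolutely_integrable_bounded_measurable_product_real
        continuous_imp_measurable_on_sets_lebesgue) auto
  then have "(\<lambda>t. t * K t) integrable_on halfpi"
    by (rule set_lebesgue_integral_eq_integral(1))
  then obtain J where J: "((\<lambda>t. t * K t) has_integral J) halfpi"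
    by (auto simp: integrable_on_def)
  have "((\<lambda>t. pi / 2 * K t - t * K t) has_integral J) halfpi"
    using reflect_halfpi[OF J] by (simp add: assms(3) algebra_simps)
  moreover have "((\<lambda>t. pi / 2 * K t - t * K t) has_integral pi / 2 * I - J) halfpi"
    by (intro has_integral_diff has_integral_mult_right assms J)
  ultimately have "J = pi / 2 * I - J"
    by (rule has_integral_unique)
  then have "J = pi / 4 * I" by simp
  with J show ?thesis by simp
qed

lemma lgS_integral: "(lgS has_integral pi * ln 2) halfpi"
  using has_integral_mult_right[OF lsin_moments(1), of "- 2"] by simp

lemma lgS_cube_integral:
  "((\<lambda>t. lgS t ^ 3) has_integral 4 * pi * ln 2 ^ 3 + 6 * pi * zeta 3 + ln 2 * pi ^ 3) halfpi"
  using has_integral_mult_right[OF lsin_cube_integral, of "- 8"]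
  by (rule has_integral_eq_rhs[OF has_integral_eq[rotated]]) (simp_all add: power_mult_distrib field_simps)

text \<open>Duplication gives \<open>lgS t + lgC t = lgS (2 * t) + 2 * ln 2\<close> away from the
  endpoints; the value is the expanded cube of the right-hand side, integrated by
  \<open>double_angle_integral\<close>.\<close>

lemma lgS_lgC_cube_integral:
  "((\<lambda>t. (lgS t + lgC t) ^ 3) has_integral
     4 * pi * ln 2 ^ 3 + 6 * pi * zeta 3 + ln 2 * pi ^ 3
     + 6 * ln 2 * (pi ^ 3 / 6 + 2 * pi * ln 2 ^ 2) + 12 * ln 2 ^ 2 * (pi * ln 2) + 4 * pi * ln 2 ^ 3) halfpi"
proof -
  have sq: "((\<lambda>t. lgS t ^ 2) has_integral pi ^ 3 / 6 + 2 * pi * ln 2 ^ 2) halfpi"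
    using has_integral_mult_right[OF lsin_square_integral, of 4]
    by (rule has_integral_eq_rhs[OF has_integral_eq[rotated]]) (simp_all add: power_mult_distrib field_simps)
  have const: "((\<lambda>t. 8 * ln 2 ^ 3 :: real) has_integral 4 * pi * ln 2 ^ 3) halfpi"
    using has_integral_const_real[of "8 * ln 2 ^ 3 :: real" 0 "pi / 2"] by (simp add: mult_ac)
  have "((\<lambda>t. lgS t ^ 3 + 6 * ln 2 * lgS t ^ 2 + 12 * ln 2 ^ 2 * lgS t + 8 * ln 2 ^ 3) has_integral
     4 * pi * ln 2 ^ 3 + 6 * pi * zeta 3 + ln 2 * pi ^ 3
     + 6 * ln 2 * (pi ^ 3 / 6 + 2 * pi * ln 2 ^ 2) + 12 * ln 2 ^ 2 * (pi * ln 2) + 4 * pi * ln 2 ^ 3) halfpi"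
    by (intro has_integral_add lgS_cube_integral has_integral_mult_right sq lgS_integral const)
  from double_angle_integral[of "\<lambda>s. (- 2 * ln s) ^ 3 + 6 * ln 2 * (- 2 * ln s) ^ 2 + 12 * ln 2 ^ 2 * (- 2 * ln s) + 8 * ln 2 ^ 3", OF this]
  have A: "((\<lambda>t. lgS (2 * t) ^ 3 + 6 * ln 2 * lgS (2 * t) ^ 2 + 12 * ln 2 ^ 2 * lgS (2 * t) + 8 * ln 2 ^ 3) has_integral
     4 * pi * ln 2 ^ 3 + 6 * pi * zeta 3 + ln 2 * pi ^ 3
     + 6 * ln 2 * (pi ^ 3 / 6 + 2 * pi * ln 2 ^ 2) + 12 * ln 2 ^ 2 * (pi * ln 2) + 4 * pi * ln 2 ^ 3) halfpi" .
  show ?thesis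
  proof (rule has_integral_spike_finite[of "{0, pi / 2}", OF _ _ A])
    fix t assume "t \<in> halfpi - {0, pi / 2}"
    then have "0 < t" "t < pi / 2" by auto
    then have "sin t > 0" "cos t > 0" by (auto intro: sin_gt_zero cos_gt_zero)
    then have "lgS (2 * t) = lgS t + lgC t - 2 * ln 2"
      by (simp add: sin_double ln_mult)
    then have *: "lgS t + lgC t = lgS (2 * t) + 2 * ln 2" by simp
    show "(lgS t + lgC t) ^ 3 = lgS (2 * t) ^ 3 + 6 * ln 2 * lgS (2 * t) ^ 2 + 12 * ln 2 ^ 2 * lgS (2 * t) + 8 * ln 2 ^ 3"
      unfolding * power3_eq_cube power2_eq_square by (simp add: algebra_simps)
  qed simp
qed

text \<open>A third of \<open>(S + C) ^ 3 - S ^ 3 - C ^ 3\<close> is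
  \<open>S * C * (S + C)\<close>.\<close>

lemma lgS_lgC_mixed_integral:
  "((\<lambda>t. lgS t * lgC t * (lgS t + lgC t)) has_integral 8 * pi * ln 2 ^ 3 - 2 * pi * zeta 3) halfpi"
proof -
  have "((\<lambda>t. lgC t ^ 3) has_integral 4 * pi * ln 2 ^ 3 + 6 * pi * zeta 3 + ln 2 * pi ^ 3) halfpi"
    using reflect_halfpi[OF lgS_cube_integral] unfolding lgS_reflect .
  from has_integral_mult_right[OF has_integral_diff[OF lgS_lgC_cube_integral has_integral_add[OF lgS_cube_integral this]], of "1 / 3"]
  show ?thesis
    by (rule has_integral_eq_rhs[OF has_integral_eq[rotated]])
       (simp_all add: field_simps power2_eq_square power3_eq_cube)
qed

text \<open>The factors \<open>4 * t\<close> and \<open>8 / 3 * t ^ 3\<close> are the sums of the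
  two expansions in \<open>theta_series\<close>.\<close>

lemma weighted_integrals:
  shows "((\<lambda>t. 4 * t * lgS t) has_integral ln 2 * pi\<^sup>2 - 7 / 2 * zeta 3) halfpi" (is ?A)
    and "((\<lambda>t. 8 / 3 * t ^ 3 * lgS t) has_integral
           31 / 8 * zeta 5 - 3 / 4 * pi\<^sup>2 * zeta 3 + ln 2 * pi ^ 4 / 12) halfpi" (is ?B)
    and "((\<lambda>t. 8 / 3 * t ^ 3 * lgC t) has_integral
           - (31 / 8) * zeta 5 + pi\<^sup>2 * zeta 3 + ln 2 * pi ^ 4 / 12) halfpi" (is ?C)
    and "((\<lambda>t. 4 * t * lgS t ^ 3) has_integral
           93 / 4 * zeta 5 + 6 * pi\<^sup>2 * zeta 3 + 3 / 2 * ln 2 * pi ^ 4 - 96 * Li5 (1 / 2) + 4 / 5 * ln 2 ^ 5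
           - 32 * ln 2 ^ 3 * zeta 2 - 192 * ln 2 * zeta 4 + 8 * pi\<^sup>2 * ln 2 ^ 3) halfpi" (is ?D)
    and "((\<lambda>t. 4 * t * lgC t ^ 3) has_integral
           - (93 / 4) * zeta 5 + 6 * pi\<^sup>2 * zeta 3 + ln 2 * pi ^ 4 / 2 + 96 * Li5 (1 / 2) - 4 / 5 * ln 2 ^ 5
           + 32 * ln 2 ^ 3 * zeta 2 + 192 * ln 2 * zeta 4) halfpi" (is ?E)
    and "((\<lambda>t. 4 * t * (lgS t * lgC t * (lgS t + lgC t))) has_integral 8 * pi\<^sup>2 * ln 2 ^ 3 - 2 * pi\<^sup>2 * zeta 3) halfpi" (is ?F)
proof -
  note m = lsin_moments
  have "((\<lambda>t. - 8 * ((t - pi / 2) * lsin t + pi / 2 * lsin t)) has_integral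
      - 8 * ((7 / 16 * zeta 3 + ln 2 * pi\<^sup>2 / 8) + pi / 2 * - (pi / 2 * ln 2))) halfpi"
    by (intro has_integral_mult_right has_integral_add m)
  then show ?A
    by (rule has_integral_eq_rhs[OF has_integral_eq[rotated]]) (simp_all add: field_simps power2_eq_square)
  \<comment> \<open>The factor is \<open>8 / 3 * (- 2)\<close>, and \<open>t ^ 3\<close> is expanded
    in powers of \<open>t - pi / 2\<close>.\<close>
  have "((\<lambda>t. - (16 / 3) * ((t - pi / 2) ^ 3 * lsin t + 3 * pi / 2 * ((t - pi / 2) ^ 2 * lsin t)
      + 3 * pi\<^sup>2 / 4 * ((t - pi / 2) * lsin t) + pi ^ 3 / 8 * lsin t)) has_integral
      - (16 / 3) * ((- (93 / 128) * zeta 5 + 3 / 16 * pi\<^sup>2 * zeta 3 + ln 2 * pi ^ 4 / 64)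
      + 3 * pi / 2 * (- (pi / 4 * zeta 3) - ln 2 * pi ^ 3 / 24)
      + 3 * pi\<^sup>2 / 4 * (7 / 16 * zeta 3 + ln 2 * pi\<^sup>2 / 8) + pi ^ 3 / 8 * - (pi / 2 * ln 2))) halfpi"
    by (intro has_integral_mult_right has_integral_add m)
  then show ?B
    by (rule has_integral_eq_rhs[OF has_integral_eq[rotated]])
       (simp_all add: field_simps power2_eq_square power3_eq_cube power4_eq_xxxx)
  \<comment> \<open>Reflection turns \<open>(t - pi / 2) ^ 3\<close> into \<open>- t ^ 3\<close>, so
    for the cosine a single moment is enough.\<close>
  have "((\<lambda>t. 16 / 3 * ((pi / 2 - t - pi / 2) ^ 3 * lsin (pi / 2 - t))) has_integral
      16 / 3 * (- (93 / 128) * zeta 5 + 3 / 16 * pi\<^sup>2 * zeta 3 + ln 2 * pi ^ 4 / 64)) halfpi"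
    by (intro has_integral_mult_right reflect_halfpi[OF m(4)])
  moreover have "lsin (pi / 2 - t) = ln (cos t)" for t
    by (simp add: sin_diff)
  ultimately have "((\<lambda>t. 16 / 3 * ((pi / 2 - t - pi / 2) ^ 3 * ln (cos t))) has_integral
      16 / 3 * (- (93 / 128) * zeta 5 + 3 / 16 * pi\<^sup>2 * zeta 3 + ln 2 * pi ^ 4 / 64)) halfpi"
    by (simp only:)
  then show ?C
    by (rule has_integral_eq_rhs[OF has_integral_eq[rotated]])
       (simp_all add: field_simps)
  have "((\<lambda>t. - 32 * ((t - pi / 2) * lsin t ^ 3 + pi / 2 * lsin t ^ 3)) has_integral
      - 32 * ((- (93 / 128) * zeta 5 + 3 / 16 * pi\<^sup>2 * zeta 3 + ln 2 * pi ^ 4 / 64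
     + 3 * Li5 (1 / 2) - ln 2 ^ 5 / 40 + ln 2 ^ 3 * zeta 2 + 6 * ln 2 * zeta 4)
      + pi / 2 * (- (pi / 2 * ln 2 ^ 3) - 3 / 4 * pi * zeta 3 - ln 2 * pi ^ 3 / 8))) halfpi"
    by (intro has_integral_mult_right has_integral_add psi_lsin_cube_integral lsin_cube_integral)
  then show D: ?D
    by (rule has_integral_eq_rhs[OF has_integral_eq[rotated]])
       (simp_all add: field_simps power2_eq_square power3_eq_cube power4_eq_xxxx)
  have "((\<lambda>t. 4 * (pi / 2 - t) * lgC t ^ 3) has_integral
           93 / 4 * zeta 5 + 6 * pi\<^sup>2 * zeta 3 + 3 / 2 * ln 2 * pi ^ 4 - 96 * Li5 (1 / 2) + 4 / 5 * ln 2 ^ 5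
           - 32 * ln 2 ^ 3 * zeta 2 - 192 * ln 2 * zeta 4 + 8 * pi\<^sup>2 * ln 2 ^ 3) halfpi"
    using reflect_halfpi[OF D] unfolding lgS_reflect .
  from has_integral_diff[OF has_integral_mult_right[OF reflect_halfpi[OF lgS_cube_integral, unfolded lgS_reflect], of "2 * pi"] this]
  show ?E
    by (rule has_integral_eq_rhs[OF has_integral_eq[rotated]])
       (simp_all add: field_simps power2_eq_square power3_eq_cube power4_eq_xxxx)
  have "((\<lambda>t. t * (lgS t * lgC t * (lgS t + lgC t))) has_integral pi / 4 * (8 * pi * ln 2 ^ 3 - 2 * pi * zeta 3)) halfpi"
  proof (rule symmetric_weight_integral[OF lgS_lgC_mixed_integral])
    show "0 \<le> lgS t * lgC t * (lgS t + lgC t)" if "t \<in> halfpi" for t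
      by (rule mult_nonneg_nonneg[OF mult_nonneg_nonneg add_nonneg_nonneg]; intro lgS_nonneg lgC_nonneg that)
    show "lgS (pi / 2 - t) * lgC (pi / 2 - t) * (lgS (pi / 2 - t) + lgC (pi / 2 - t)) = lgS t * lgC t * (lgS t + lgC t)" for t
      unfolding lgS_reflect lgC_reflect by (simp add: algebra_simps)
  qed
  from has_integral_mult_right[OF this, of 4] show ?F
    by (rule has_integral_eq_rhs[OF has_integral_eq[rotated]]) (simp_all add: algebra_simps power2_eq_square)
qed


section \<open>Moments of the Beta weights\<close>

text \<open>Under \<open>x = sin\<^sup>2 t\<close> the weight \<open>beta_wt k t dt\<close> becomes \<open>x ^ k dx\<close>.\<close>

definition beta_wt :: "nat \<Rightarrow> real \<Rightarrow> real" where
  "beta_wt k t = 2 * sin t * cos t * sin t ^ (2 * k)"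

lemma beta_wt_nonneg: "t \<in> halfpi \<Longrightarrow> 0 \<le> beta_wt k t"
  unfolding beta_wt_def by (intro mult_nonneg_nonneg zero_le_power) (auto intro!: sin_ge_zero cos_ge_zero)

lemma continuous_on_x_ln_power:
  assumes "p \<le> 3"
  shows "continuous_on {0..1} (\<lambda>x :: real. x * ln x ^ p)"
proof (rule continuous_on_IccI)
  have "p = 0 \<or> p = 1 \<or> p = 2 \<or> p = 3" using assms by auto
  moreover have "((\<lambda>x :: real. x * ln x ^ 0) \<longlongrightarrow> 0) (at_right 0)" "((\<lambda>x :: real. x * ln x ^ 1) \<longlongrightarrow> 0) (at_right 0)"
    "((\<lambda>x :: real. x * ln x ^ 2) \<longlongrightarrow> 0) (at_right 0)" "((\<lambda>x :: real. x * ln x ^ 3) \<longlongrightarrow> 0) (at_right 0)"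
    by real_asymp+
  ultimately show "((\<lambda>x :: real. x * ln x ^ p) \<longlongrightarrow> 0 * ln 0 ^ p) (at_right 0)"
    by fastforce
  show "((\<lambda>x :: real. x * ln x ^ p) \<longlongrightarrow> 1 * ln 1 ^ p) (at_left 1)"
    by (intro tendsto_intros) simp
  show "((\<lambda>x :: real. x * ln x ^ p) \<longlongrightarrow> x * ln x ^ p) (at x)" if "0 < x" for x
    using that by (intro tendsto_intros) simp
qed simp

lemma continuous_on_sin_lgS: "p \<le> 3 \<Longrightarrow> continuous_on halfpi (\<lambda>t. sin t * lgS t ^ p)"
proof -
  assume p: "p \<le> 3"
  have "continuous_on halfpi (\<lambda>t. sin t * ln (sin t) ^ p)"
    by (rule continuous_on_compose2[OF continuous_on_x_ln_power[OF p]]) (auto intro!: continuous_intros sin_ge_zero)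
  from continuous_on_mult_left[OF this, of "(- 2) ^ p"] show ?thesis
    by (simp only: power_mult_distrib mult_ac)
qed

lemma continuous_on_cos_lgC: "p \<le> 3 \<Longrightarrow> continuous_on halfpi (\<lambda>t. cos t * lgC t ^ p)"
proof -
  assume p: "p \<le> 3"
  have "continuous_on halfpi (\<lambda>t. cos t * ln (cos t) ^ p)"
    by (rule continuous_on_compose2[OF continuous_on_x_ln_power[OF p]]) (auto intro!: continuous_intros cos_ge_zero)
  from continuous_on_mult_left[OF this, of "(- 2) ^ p"] show ?thesis
    by (simp only: power_mult_distrib mult_ac)
qed

lemma continuous_on_cot_lgC: "continuous_on halfpi (\<lambda>t. cos t * lgC t / sin t)"
  unfolding continuous_on_eq_continuous_within
proof
  fix t :: real assume t: "t \<in> halfpi"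
  show "continuous (at t within halfpi) (\<lambda>t. cos t * lgC t / sin t)"
  proof (cases "t = 0")
    case True
    have "((\<lambda>t::real. cos t * lgC t / sin t) \<longlongrightarrow> 0) (at_right 0)"
      by real_asymp
    then show ?thesis
      using True by (simp add: continuous_within at_within_Icc_at_right)
  next
    case False
    then have "sin t \<noteq> 0" using t sin_gt_zero[of t] by auto
    moreover have "((\<lambda>t. cos t * lgC t) \<longlongrightarrow> cos t * lgC t) (at t within halfpi)"
      using bspec[OF continuous_on_cos_lgC[of 1, unfolded continuous_on] t] by simp
    ultimately show ?thesis
      unfolding continuous_within by (intro tendsto_divide tendsto_sin tendsto_ident_at)
  qed
qed

context
  fixes t :: real
  assumes t: "0 < t" "t < pi / 2"
begin

lemma sin_cos_pos: "sin t > 0" "cos t > 0"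
  using t by (auto intro: sin_gt_zero cos_gt_zero)

lemma DERIV_lgS: "(lgS has_real_derivative - (2 * cos t / sin t)) (at t)"
  using sin_cos_pos by (auto intro!: derivative_eq_intros)

lemma DERIV_lgC: "(lgC has_real_derivative 2 * sin t / cos t) (at t)"
  using sin_cos_pos by (auto intro!: derivative_eq_intros)

lemma DERIV_sin_power: "((\<lambda>t. sin t ^ (2 * Suc k)) has_real_derivative real (Suc k) * beta_wt k t) (at t)"
  by (rule derivative_eq_intros refl)+ (simp add: beta_wt_def)

lemma beta_wt_conv_cot: "beta_wt k t = 2 * cos t / sin t * sin t ^ (2 * Suc k)"
  using sin_cos_pos by (simp add: beta_wt_def)

lemma sum_beta_wt: "(\<Sum>j\<le>k. beta_wt j t) = 2 * sin t / cos t * (1 - sin t ^ (2 * Suc k))"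
proof -
  have "(\<Sum>j\<le>k. beta_wt j t) = 2 * sin t / cos t * ((cos t)\<^sup>2 * (\<Sum>j\<le>k. ((sin t)\<^sup>2) ^ j))"
    using sin_cos_pos by (simp add: beta_wt_def sum_distrib_left power_mult power2_eq_square power_mult_distrib mult_ac)
  also have "(cos t)\<^sup>2 * (\<Sum>j\<le>k. ((sin t)\<^sup>2) ^ j) = 1 - sin t ^ (2 * Suc k)"
    using one_diff_power_eq[of "(sin t)\<^sup>2" "Suc k"]
    unfolding cos_squared_eq power_mult lessThan_Suc_atMost by linarith
  finally show ?thesis .
qed

end

text \<open>With \<open>x = sin^2 t\<close> this is the integral of
  \<open>x ^ k (- ln x) ^ p\<close> over \<open>[0, 1]\<close>; each integration by parts lowers
  \<open>p\<close> by one and divides by \<open>Suc k\<close>.\<close>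

lemma lgS_moment:
  assumes "p \<le> 3"
  shows "((\<lambda>t. beta_wt k t * lgS t ^ p) has_integral fact p / real (Suc k) ^ Suc p) halfpi"
  using assms
proof (induction p)
  case 0
  have "((\<lambda>t. real (Suc k) * beta_wt k t) has_integral sin (pi / 2) ^ (2 * Suc k) - sin 0 ^ (2 * Suc k)) halfpi"
  proof (rule fundamental_theorem_of_calculus_interior)
    fix t assume "t \<in> {0<..<pi / 2}"
    then have "((\<lambda>t. sin t ^ (2 * Suc k)) has_real_derivative real (Suc k) * beta_wt k t) (at t)"
      by (intro DERIV_sin_power) auto
    then show "((\<lambda>t. sin t ^ (2 * Suc k)) has_vector_derivative real (Suc k) * beta_wt k t) (at t)"
      by (simp only: has_real_derivative_iff_has_vector_derivative)
  qed (auto intro!: continuous_intros)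
  from has_integral_mult_right[OF this, of "1 / real (Suc k)"] show ?case
    by (rule has_integral_eq_rhs[OF has_integral_eq[rotated]]) (simp_all add: field_simps)
next
  case (Suc p)
  let ?G = "\<lambda>t. sin t ^ (2 * Suc k) * lgS t ^ Suc p"
  have "((\<lambda>t. real (Suc k) * beta_wt k t * lgS t ^ Suc p - real (Suc p) * (beta_wt k t * lgS t ^ p)) has_integral ?G (pi / 2) - ?G 0) halfpi"
  proof (rule fundamental_theorem_of_calculus_interior)
    have "continuous_on halfpi (\<lambda>t. sin t ^ Suc (2 * k) * (sin t * lgS t ^ Suc p))"
      using Suc.prems by (intro continuous_on_mult continuous_on_sin_lgS continuous_intros)
    then show "continuous_on halfpi ?G" by (simp add: mult_ac)
    fix t assume "t \<in> {0<..<pi / 2}"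
    then have t: "0 < t" "t < pi / 2" by auto
    have "(?G has_real_derivative real (Suc k) * beta_wt k t * lgS t ^ Suc p
        + (real (Suc p) * (- (2 * cos t / sin t) * lgS t ^ p)) * sin t ^ (2 * Suc k)) (at t)"
      using DERIV_mult[OF DERIV_sin_power[OF t, of k] DERIV_power[OF DERIV_lgS[OF t], of "Suc p"]]
      by (simp del: power_Suc of_nat_Suc)
    also have "real (Suc k) * beta_wt k t * lgS t ^ Suc p + (real (Suc p) * (- (2 * cos t / sin t) * lgS t ^ p)) * sin t ^ (2 * Suc k)
       = real (Suc k) * beta_wt k t * lgS t ^ Suc p - real (Suc p) * (beta_wt k t * lgS t ^ p)"
      unfolding beta_wt_conv_cot[OF t] by (simp add: algebra_simps del: power_Suc of_nat_Suc)
    finally show "(?G has_vector_derivative real (Suc k) * beta_wt k t * lgS t ^ Suc p - real (Suc p) * (beta_wt k t * lgS t ^ p)) (at t)"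
      by (simp only: has_real_derivative_iff_has_vector_derivative)
  qed simp
  moreover have "((\<lambda>t. real (Suc p) * (beta_wt k t * lgS t ^ p)) has_integral real (Suc p) * (fact p / real (Suc k) ^ Suc p)) halfpi"
    using Suc by (intro has_integral_mult_right) simp
  ultimately have "((\<lambda>t. real (Suc k) * beta_wt k t * lgS t ^ Suc p - real (Suc p) * (beta_wt k t * lgS t ^ p)
      + real (Suc p) * (beta_wt k t * lgS t ^ p)) has_integral ?G (pi / 2) - ?G 0 + real (Suc p) * (fact p / real (Suc k) ^ Suc p)) halfpi"
    by (rule has_integral_add)
  from has_integral_mult_right[OF this, of "1 / real (Suc k)"]
  show ?case
    by (rule has_integral_eq_rhs[OF has_integral_eq[rotated]]) (simp_all add: field_simps)
qed

text \<open>
  Integration by parts with the primitive \<open>sin t ^ (2 * Suc k) - 1\<close> of \<open>Suc k * beta_wt k\<close>, whose constant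
  is chosen to cancel the singularity of \<open>lgC\<close>.
\<close>

lemma lgS_lgC_moment_step:
  assumes "p \<le> 3" "q \<le> 3"
    and A: "\<And>j. ((\<lambda>t. beta_wt j t * lgS t ^ p * lgC t ^ q) has_integral a j) halfpi"
    and B: "p > 0 \<Longrightarrow> ((\<lambda>t. beta_wt k t * lgS t ^ (p - 1) * lgC t ^ Suc q) has_integral b) halfpi"
    and C: "p > 0 \<Longrightarrow> ((\<lambda>t. 2 * cos t / sin t * lgS t ^ (p - 1) * lgC t ^ Suc q) has_integral z) halfpi"
  shows "((\<lambda>t. beta_wt k t * lgS t ^ p * lgC t ^ Suc q) has_integral
           (real (Suc q) * (\<Sum>j\<le>k. a j) + real p * (b - z)) / real (Suc k)) halfpi"
proof -
  let ?D = "\<lambda>t. (sin t ^ (2 * Suc k) - 1) * (lgS t ^ p * lgC t ^ Suc q)"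
  define E where "E = (\<lambda>t. real (Suc q) * (\<Sum>j\<le>k. beta_wt j t * lgS t ^ p * lgC t ^ q)
      + real p * (beta_wt k t * lgS t ^ (p - 1) * lgC t ^ Suc q - 2 * cos t / sin t * lgS t ^ (p - 1) * lgC t ^ Suc q))"
  have "((\<lambda>t. real (Suc k) * (beta_wt k t * lgS t ^ p * lgC t ^ Suc q) - E t) has_integral ?D (pi / 2) - ?D 0) halfpi"
  proof (rule fundamental_theorem_of_calculus_interior[where f = ?D])
    \<comment> \<open>\<open>1 - sin t ^ (2 * Suc k)\<close> is \<open>cos^2 t\<close> times a
      polynomial. One cosine tames \<open>lgC ^ q\<close>, the other the remaining
      \<open>lgC\<close>; dividing that last factor by the sine frees a sine to tame
      \<open>lgS ^ p\<close>.\<close>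
    have "continuous_on halfpi (\<lambda>t. - (\<Sum>j\<le>k. (sin t ^ 2) ^ j) * (cos t * lgC t ^ q) * (cos t * lgC t / sin t) * (sin t * lgS t ^ p))"
      by (rule continuous_on_mult[OF continuous_on_mult[OF continuous_on_mult[OF _
            continuous_on_cos_lgC[OF assms(2)]] continuous_on_cot_lgC] continuous_on_sin_lgS[OF assms(1)]])
         (intro continuous_intros)
    moreover have "- (\<Sum>j\<le>k. (sin t ^ 2) ^ j) * (cos t * lgC t ^ q) * (cos t * lgC t / sin t) * (sin t * lgS t ^ p) = ?D t"
      if "t \<in> halfpi" for t
    proof (cases "t = 0")
      case False
      then have "sin t > 0" using that by (auto intro: sin_gt_zero)
      moreover have "sin t ^ (2 * Suc k) - 1 = - ((cos t)\<^sup>2 * (\<Sum>j\<le>k. ((sin t)\<^sup>2) ^ j))"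
        using one_diff_power_eq[of "(sin t)\<^sup>2" "Suc k"]
        unfolding cos_squared_eq power_mult lessThan_Suc_atMost by linarith
      ultimately show ?thesis
        by (simp add: power2_eq_square)
    qed simp
    ultimately show "continuous_on halfpi ?D"
      by (subst continuous_on_cong[OF refl, symmetric]) auto
    fix t assume "t \<in> {0<..<pi / 2}"
    then have t: "0 < t" "t < pi / 2" by auto
    have alg: "A * u * (P * L1) + (n * (- c * P') * L1 + m * (s * L0) * P) * (X - 1)
        = A * (u * P * L1) - (m * ((s * (1 - X)) * (P * L0)) + n * ((c * X) * P' * L1 - c * P' * L1))"
      for A u P P' L0 L1 n m c s X :: real
      by (simp add: algebra_simps)
    have 1: "((\<lambda>t. sin t ^ (2 * Suc k) - 1) has_real_derivative real (Suc k) * beta_wt k t) (at t)"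
      using DERIV_diff[OF DERIV_sin_power[OF t, of k] DERIV_const[of 1]] by simp
    have "(?D has_real_derivative real (Suc k) * beta_wt k t * (lgS t ^ p * lgC t ^ Suc q)
        + (real p * (- (2 * cos t / sin t) * lgS t ^ (p - 1)) * lgC t ^ Suc q
           + real (Suc q) * (2 * sin t / cos t * lgC t ^ q) * lgS t ^ p) * (sin t ^ (2 * Suc k) - 1)) (at t)"
      using DERIV_mult[OF 1 DERIV_mult[OF DERIV_power[OF DERIV_lgS[OF t], of p] DERIV_power[OF DERIV_lgC[OF t], of "Suc q"]]]
      by (simp del: power_Suc of_nat_Suc)
    also have "real (Suc k) * beta_wt k t * (lgS t ^ p * lgC t ^ Suc q)
        + (real p * (- (2 * cos t / sin t) * lgS t ^ (p - 1)) * lgC t ^ Suc q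
           + real (Suc q) * (2 * sin t / cos t * lgC t ^ q) * lgS t ^ p) * (sin t ^ (2 * Suc k) - 1)
      = real (Suc k) * (beta_wt k t * lgS t ^ p * lgC t ^ Suc q)
        - (real (Suc q) * ((2 * sin t / cos t * (1 - sin t ^ (2 * Suc k))) * (lgS t ^ p * lgC t ^ q))
          + real p * ((2 * cos t / sin t * sin t ^ (2 * Suc k)) * lgS t ^ (p - 1) * lgC t ^ Suc q
             - 2 * cos t / sin t * lgS t ^ (p - 1) * lgC t ^ Suc q))"
      by (rule alg)
    also have "\<dots> = real (Suc k) * (beta_wt k t * lgS t ^ p * lgC t ^ Suc q) - E t"
      unfolding E_def sum_beta_wt[OF t, symmetric] beta_wt_conv_cot[OF t, of k, symmetric] sum_distrib_right
      by (simp only: mult.assoc)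
    finally show "(?D has_vector_derivative real (Suc k) * (beta_wt k t * lgS t ^ p * lgC t ^ Suc q) - E t) (at t)"
      by (simp only: has_real_derivative_iff_has_vector_derivative)
  qed simp
  moreover have "(E has_integral real (Suc q) * (\<Sum>j\<le>k. a j) + real p * (b - z)) halfpi"
  proof (cases "p = 0")
    case True
    then show ?thesis
      unfolding E_def using A by (simp del: of_nat_Suc) (intro has_integral_mult_right has_integral_sum, auto)
  next
    case False
    then show ?thesis
      unfolding E_def using A B C
      by (intro has_integral_add has_integral_mult_right has_integral_sum has_integral_diff) auto
  qed
  ultimately have "((\<lambda>t. real (Suc k) * (beta_wt k t * lgS t ^ p * lgC t ^ Suc q) - E t + E t) has_integral
      ?D (pi / 2) - ?D 0 + (real (Suc q) * (\<Sum>j\<le>k. a j) + real p * (b - z))) halfpi"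
    by (rule has_integral_add)
  from has_integral_mult_right[OF this, of "1 / real (Suc k)"] show ?thesis
    by (rule has_integral_eq_rhs[OF has_integral_eq[rotated]]) (simp_all add: field_simps)
qed

section \<open>Logarithmic integrals against the cotangent\<close>

lemma polylog_sin_square_derivative:
  assumes t: "0 < t" "t < pi / 2"
  shows "((\<lambda>t. polylog (Suc n) ((sin t)\<^sup>2)) has_real_derivative 2 * cos t / sin t * polylog n ((sin t)\<^sup>2)) (at t)"
proof -
  note sc = sin_cos_pos[OF t]
  have "(sin t)\<^sup>2 + (cos t)\<^sup>2 = 1" by simp
  moreover have "(cos t)\<^sup>2 > 0" using sc by simp
  ultimately have "(sin t)\<^sup>2 < 1" by linarith
  moreover have "((\<lambda>t. (sin t)\<^sup>2) has_real_derivative 2 * sin t * cos t) (at t)"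
    by (rule derivative_eq_intros refl)+ simp
  ultimately show ?thesis
    using DERIV_polylog_chain[of "\<lambda>t. (sin t)\<^sup>2" "2 * sin t * cos t" t n] sc
    by (simp add: power2_eq_square field_simps)
qed

lemma polylog_1_sin_square:
  assumes t: "0 < t" "t < pi / 2"
  shows "polylog 1 ((sin t)\<^sup>2) = lgC t"
proof -
  note sc = sin_cos_pos[OF t]
  have "1 - (sin t)\<^sup>2 = (cos t)\<^sup>2" by (simp add: cos_squared_eq)
  moreover have "(cos t)\<^sup>2 > 0" using sc by simp
  ultimately have "\<bar>(sin t)\<^sup>2\<bar> < 1" and eq: "1 - (sin t)\<^sup>2 = (cos t)\<^sup>2"
    unfolding abs_power2 by linarith+
  then show ?thesis
    using polylog_1_real[of "(sin t)\<^sup>2"] sc by (simp only: eq ln_realpow)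
qed

lemma continuous_on_polylog_sin_square: "n \<ge> 2 \<Longrightarrow> continuous_on S (\<lambda>t :: real. polylog n ((sin t)\<^sup>2))"
  by (rule continuous_on_compose2[OF continuous_on_polylog])
     (auto intro!: continuous_intros simp: power_le_one abs_square_le_1)

lemma cot_lgC_integral: "((\<lambda>t. 2 * cos t / sin t * lgC t) has_integral zeta 2) halfpi"
proof -
  have "((\<lambda>t. 2 * cos t / sin t * lgC t) has_integral polylog 2 ((sin (pi / 2))\<^sup>2) - polylog 2 ((sin 0)\<^sup>2)) halfpi"
  proof (rule fundamental_theorem_of_calculus_interior)
    fix t assume "t \<in> {0<..<pi / 2}"
    then have t: "0 < t" "t < pi / 2" by auto
    have "((\<lambda>t. polylog 2 ((sin t)\<^sup>2)) has_real_derivative 2 * cos t / sin t * lgC t) (at t)"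
      using polylog_sin_square_derivative[OF t, of 1] unfolding polylog_1_sin_square[OF t] by (simp only: Suc_1)
    then show "((\<lambda>t. polylog 2 ((sin t)\<^sup>2)) has_vector_derivative 2 * cos t / sin t * lgC t) (at t)"
      by (simp only: has_real_derivative_iff_has_vector_derivative)
  qed (auto intro!: continuous_on_polylog_sin_square)
  then show ?thesis by (simp add: polylog_one)
qed

text \<open>In the primitive \<open>?G\<close>, the trilogarithm cancels the term that arises from
  differentiating \<open>lgS\<close> in front of the dilogarithm.\<close>

lemma cot_lgS_lgC_integral: "((\<lambda>t. 2 * cos t / sin t * lgS t * lgC t) has_integral zeta 3) halfpi"
proof -
  let ?G = "\<lambda>t. lgS t * polylog 2 ((sin t)\<^sup>2) + polylog 3 ((sin t)\<^sup>2)"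
  have "((\<lambda>t. 2 * cos t / sin t * lgS t * lgC t) has_integral ?G (pi / 2) - ?G 0) halfpi"
  proof (rule fundamental_theorem_of_calculus_interior)
    have "continuous_on halfpi (\<lambda>t. lgS t * polylog 2 ((sin t)\<^sup>2))"
      unfolding continuous_on_eq_continuous_within
    proof
      fix t :: real assume t: "t \<in> halfpi"
      show "continuous (at t within halfpi) (\<lambda>t. lgS t * polylog 2 ((sin t)\<^sup>2))"
      proof (cases "t = 0")
        case True
        have "((\<lambda>t. lgS t * polylog 2 ((sin t)\<^sup>2)) \<longlongrightarrow> 0) (at 0 within halfpi)"
        proof (rule Lim_null_comparison)
          have "((\<lambda>t. sin t * lgS t ^ 1) \<longlongrightarrow> sin 0 * lgS 0 ^ 1) (at 0 within halfpi)"
            using continuous_on_sin_lgS[of 1] unfolding continuous_on by (rule bspec) simp_all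
          from tendsto_mult_left[OF this, of "zeta 2"]
          show "((\<lambda>t. zeta 2 * (sin t * lgS t)) \<longlongrightarrow> 0) (at 0 within halfpi)" by simp
          have "norm (lgS t * polylog 2 ((sin t)\<^sup>2)) \<le> zeta 2 * (sin t * lgS t)" if "t \<in> halfpi" for t
          proof -
            have s: "0 \<le> sin t" "sin t \<le> 1" using that by (auto intro: sin_ge_zero)
            have "\<bar>polylog 2 ((sin t)\<^sup>2)\<bar> \<le> zeta (real 2) * (sin t)\<^sup>2"
              using s by (intro polylog_le) (auto simp: power_le_one)
            also have "\<dots> \<le> zeta 2 * sin t"
              using s by (auto intro!: mult_left_mono simp: zeta_2 power2_eq_square mult_left_le)
            finally have "lgS t * \<bar>polylog 2 ((sin t)\<^sup>2)\<bar> \<le> lgS t * (zeta 2 * sin t)"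
              using lgS_nonneg[OF that] by (intro mult_left_mono)
            moreover have "norm (lgS t * polylog 2 ((sin t)\<^sup>2)) = lgS t * \<bar>polylog 2 ((sin t)\<^sup>2)\<bar>"
              using lgS_nonneg[OF that] by (simp only: real_norm_def abs_mult[of "lgS t"] abs_of_nonneg)
            ultimately show ?thesis by (simp only: mult_ac)
          qed
          then show "\<forall>\<^sub>F t in at 0 within halfpi. norm (lgS t * polylog 2 ((sin t)\<^sup>2)) \<le> zeta 2 * (sin t * lgS t)"
            by (simp add: eventually_at_filter)
        qed
        then show ?thesis using True by (simp add: continuous_within)
      next
        case False
        then have "sin t > 0" using t by (auto intro: sin_gt_zero)
        moreover have "continuous (at t within halfpi) (\<lambda>t. polylog 2 ((sin t)\<^sup>2))"
          using continuous_on_polylog_sin_square[of 2 halfpi] t by (simp add: continuous_on_eq_continuous_within)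
        ultimately show ?thesis
          by (auto intro!: continuous_intros)
      qed
    qed
    then show "continuous_on halfpi ?G"
      by (intro continuous_on_add continuous_on_polylog_sin_square) auto
    fix t assume "t \<in> {0<..<pi / 2}"
    then have t: "0 < t" "t < pi / 2" by auto
    have "(?G has_real_derivative 2 * cos t / sin t * lgS t * lgC t) (at t)"
      using DERIV_add[OF DERIV_mult[OF DERIV_lgS[OF t] polylog_sin_square_derivative[OF t, of 1]] polylog_sin_square_derivative[OF t, of 2]]
        polylog_1_sin_square[OF t]
      by (simp add: numeral_2_eq_2 numeral_3_eq_3 mult_ac)
    then show "(?G has_vector_derivative 2 * cos t / sin t * lgS t * lgC t) (at t)"
      by (simp only: has_real_derivative_iff_has_vector_derivative)
  qed simp
  then show ?thesis by (simp add: polylog_one)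
qed

text \<open>Integration by parts with \<open>lgS * lgC ^ 2\<close>, which vanishes at both ends,
  leads to the tangent integral of \<open>lgC * lgS\<close>, the reflection of
  \<open>cot_lgS_lgC_integral\<close>.\<close>

lemma cot_lgC_square_integral: "((\<lambda>t. 2 * cos t / sin t * lgC t ^ 2) has_integral 2 * zeta 3) halfpi"
proof -
  let ?G = "\<lambda>t. lgS t * lgC t ^ 2"
  have "((\<lambda>t. 2 * (2 * sin t / cos t * lgC t * lgS t) - 2 * cos t / sin t * lgC t ^ 2) has_integral ?G (pi / 2) - ?G 0) halfpi"
  proof (rule fundamental_theorem_of_calculus_interior)
    show "continuous_on halfpi ?G"
    proof (rule continuous_on_IccI)
      have "((\<lambda>t :: real. lgS t * lgC t ^ 2) \<longlongrightarrow> 0) (at_right 0)" by real_asymp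
      then show "(?G \<longlongrightarrow> ?G 0) (at_right 0)" by simp
      have "((\<lambda>t :: real. lgC t * lgS t ^ 2) \<longlongrightarrow> 0) (at_right 0)" by real_asymp
      moreover have "filterlim (\<lambda>t :: real. pi / 2 - t) (at_right 0) (at_left (pi / 2))" by real_asymp
      ultimately have "((\<lambda>t :: real. lgC (pi / 2 - t) * lgS (pi / 2 - t) ^ 2) \<longlongrightarrow> 0) (at_left (pi / 2))"
        by (rule filterlim_compose)
      then show "(?G \<longlongrightarrow> ?G (pi / 2)) (at_left (pi / 2))"
        unfolding lgS_reflect lgC_reflect by simp
      show "(?G \<longlongrightarrow> ?G t) (at t)" if "0 < t" "t < pi / 2" for t
        using sin_cos_pos[OF that] by (intro tendsto_intros) auto
    qed simp
    fix t assume "t \<in> {0<..<pi / 2}"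
    then have t: "0 < t" "t < pi / 2" by auto
    have "(?G has_real_derivative 2 * (2 * sin t / cos t * lgC t * lgS t) - 2 * cos t / sin t * lgC t ^ 2) (at t)"
      using DERIV_mult[OF DERIV_lgS[OF t] DERIV_power[OF DERIV_lgC[OF t], of 2]] by (simp add: mult_ac)
    then show "(?G has_vector_derivative 2 * (2 * sin t / cos t * lgC t * lgS t) - 2 * cos t / sin t * lgC t ^ 2) (at t)"
      by (simp only: has_real_derivative_iff_has_vector_derivative)
  qed simp
  then have 1: "((\<lambda>t. 2 * (2 * sin t / cos t * lgC t * lgS t) - 2 * cos t / sin t * lgC t ^ 2) has_integral 0) halfpi"
    by simp
  have "((\<lambda>t. 2 * cos (pi / 2 - t) / sin (pi / 2 - t) * lgS (pi / 2 - t) * lgC (pi / 2 - t)) has_integral zeta 3) halfpi"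
    by (rule reflect_halfpi[OF cot_lgS_lgC_integral])
  moreover have "2 * cos (pi / 2 - t) / sin (pi / 2 - t) = 2 * sin t / cos t" for t
    by (simp add: sin_diff cos_diff)
  ultimately have 2: "((\<lambda>t. 2 * sin t / cos t * lgC t * lgS t) has_integral zeta 3) halfpi"
    unfolding lgS_reflect lgC_reflect by simp
  from has_integral_diff[OF has_integral_mult_right[OF 2, of 2] 1] show ?thesis by simp
qed


section \<open>Harmonic numbers as Beta moments\<close>

lemma sum_harm_Suc_div:
  shows "(\<Sum>j\<le>k. harm (Suc j) / real (Suc j)) = ((harm (Suc k))\<^sup>2 + gen_harm 2 (Suc k)) / 2"
    and "(\<Sum>j\<le>k. ((harm (Suc j))\<^sup>2 + gen_harm 2 (Suc j)) / real (Suc j))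
      = (harm (Suc k) ^ 3 + 3 * harm (Suc k) * gen_harm 2 (Suc k) + 2 * gen_harm 3 (Suc k)) / 3"
    and "(\<Sum>j\<le>k. (gen_harm 2 (Suc j) + harm (Suc j) / real (Suc j) - z) / real (Suc j))
      = harm (Suc k) * gen_harm 2 (Suc k) + gen_harm 3 (Suc k) - z * harm (Suc k)"
proof -
  have "(\<Sum>j<k. harm (Suc j) / real (Suc j)) = ((harm k)\<^sup>2 + gen_harm 2 k) / 2
    \<and> (\<Sum>j<k. ((harm (Suc j))\<^sup>2 + gen_harm 2 (Suc j)) / real (Suc j))
      = (harm k ^ 3 + 3 * harm k * gen_harm 2 k + 2 * gen_harm 3 k) / 3
    \<and> (\<Sum>j<k. (gen_harm 2 (Suc j) + harm (Suc j) / real (Suc j) - z) / real (Suc j))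
      = harm k * gen_harm 2 k + gen_harm 3 k - z * harm k" for k
  proof (induction k)
    case (Suc k)
    obtain x :: real where x: "\<And>c p. c / real (Suc k) ^ p = c * x ^ p" "\<And>c. c / real (Suc k) = c * x"
      "harm (Suc k) = harm k + x" "\<And>m. gen_harm m (Suc k) = gen_harm m k + x ^ m"
      by (rule harm_step[of k]) (rule that)
    show ?case
      unfolding sum.lessThan_Suc Suc[THEN conjunct1] Suc[THEN conjunct2, THEN conjunct1] Suc[THEN conjunct2, THEN conjunct2] x
      by (simp add: field_simps power2_eq_square power3_eq_cube)
  qed (simp add: harm_def)
  note * = this[of "Suc k", unfolded lessThan_Suc_atMost]
  show "(\<Sum>j\<le>k. harm (Suc j) / real (Suc j)) = ((harm (Suc k))\<^sup>2 + gen_harm 2 (Suc k)) / 2"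
    and "(\<Sum>j\<le>k. ((harm (Suc j))\<^sup>2 + gen_harm 2 (Suc j)) / real (Suc j))
      = (harm (Suc k) ^ 3 + 3 * harm (Suc k) * gen_harm 2 (Suc k) + 2 * gen_harm 3 (Suc k)) / 3"
    and "(\<Sum>j\<le>k. (gen_harm 2 (Suc j) + harm (Suc j) / real (Suc j) - z) / real (Suc j))
      = harm (Suc k) * gen_harm 2 (Suc k) + gen_harm 3 (Suc k) - z * harm (Suc k)"
    using * by blast+
qed

text \<open>The moment of \<open>lgC ^ q\<close> is \<open>fact q / Suc k\<close> times the complete
  homogeneous symmetric polynomial of degree \<open>q\<close> in \<open>1, ..., 1 / Suc k\<close>:
  the integration by parts builds non-strict nested sums, where the connector built strict
  ones.\<close>

lemma lgC_moment:
  shows "((\<lambda>t. beta_wt k t * lgC t) has_integral harm (Suc k) / real (Suc k)) halfpi"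
    and "((\<lambda>t. beta_wt k t * lgC t ^ 2) has_integral
           ((harm (Suc k))\<^sup>2 + gen_harm 2 (Suc k)) / real (Suc k)) halfpi"
    and "((\<lambda>t. beta_wt k t * lgC t ^ 3) has_integral
           (harm (Suc k) ^ 3 + 3 * harm (Suc k) * gen_harm 2 (Suc k) + 2 * gen_harm 3 (Suc k)) / real (Suc k)) halfpi"
proof -
  have 1: "((\<lambda>t. beta_wt k t * lgC t) has_integral harm (Suc k) / real (Suc k)) halfpi" for k
  proof -
    have "(\<Sum>j\<le>k. 1 / real (Suc j)) = harm (Suc k)"
      using gen_harm_conv_lessThan[of 1 "Suc k"] by (simp add: gen_harm_1 lessThan_Suc_atMost)
    then show ?thesis
      using lgS_lgC_moment_step[of 0 0 "\<lambda>j. 1 / real (Suc j)" k 0 0] lgS_moment[of 0] by simp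
  qed
  show "((\<lambda>t. beta_wt k t * lgC t) has_integral harm (Suc k) / real (Suc k)) halfpi" by (rule 1)
  have 2: "((\<lambda>t. beta_wt k t * lgC t ^ 2) has_integral
           ((harm (Suc k))\<^sup>2 + gen_harm 2 (Suc k)) / real (Suc k)) halfpi" for k
  proof -
    have "((\<lambda>t. beta_wt k t * lgS t ^ 0 * lgC t ^ Suc 1) has_integral
        (real (Suc 1) * (\<Sum>j\<le>k. harm (Suc j) / real (Suc j)) + real 0 * (0 - 0)) / real (Suc k)) halfpi"
      by (rule lgS_lgC_moment_step) (use 1 in simp_all)
    then show ?thesis
      unfolding sum_harm_Suc_div
      by (rule has_integral_eq_rhs[OF has_integral_eq[rotated]]) (simp_all add: field_simps power2_eq_square)
  qed
  show "((\<lambda>t. beta_wt k t * lgC t ^ 2) has_integral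
           ((harm (Suc k))\<^sup>2 + gen_harm 2 (Suc k)) / real (Suc k)) halfpi" by (rule 2)
  show "((\<lambda>t. beta_wt k t * lgC t ^ 3) has_integral
           (harm (Suc k) ^ 3 + 3 * harm (Suc k) * gen_harm 2 (Suc k) + 2 * gen_harm 3 (Suc k)) / real (Suc k)) halfpi"
  proof -
    have "((\<lambda>t. beta_wt k t * lgS t ^ 0 * lgC t ^ Suc 2) has_integral
        (real (Suc 2) * (\<Sum>j\<le>k. ((harm (Suc j))\<^sup>2 + gen_harm 2 (Suc j)) / real (Suc j)) + real 0 * (0 - 0)) / real (Suc k)) halfpi"
      by (rule lgS_lgC_moment_step) (use 2 in simp_all)
    then show ?thesis
      unfolding sum_harm_Suc_div
      by (rule has_integral_eq_rhs[OF has_integral_eq[rotated]]) (simp_all add: field_simps power2_eq_square power3_eq_cube)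
  qed
qed

text \<open>The two summands are the moments of \<open>lgS ^ 2 * lgC\<close> and of
  \<open>lgS * lgC ^ 2\<close>. The zeta values come from the cotangent integrals, which enter
  \<open>lgS_lgC_moment_step\<close> as its \<open>z\<close>.\<close>

lemma lgS_lgC_moment:
  "((\<lambda>t. beta_wt k t * (lgS t * lgC t * (lgS t + lgC t))) has_integral
     (2 * gen_harm 3 (Suc k) + 2 * ((gen_harm 2 (Suc k) + harm (Suc k) / real (Suc k) - zeta 2) / real (Suc k) - zeta 3)) / real (Suc k)
     + (2 * (harm (Suc k) * gen_harm 2 (Suc k) + gen_harm 3 (Suc k) - zeta 2 * harm (Suc k))
        + (((harm (Suc k))\<^sup>2 + gen_harm 2 (Suc k)) / real (Suc k) - 2 * zeta 3)) / real (Suc k)) halfpi"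
proof -
  have gh: "(\<Sum>j\<le>k. 1 / real (Suc j) ^ m) = gen_harm m (Suc k)" for k m
    by (simp add: gen_harm_conv_lessThan lessThan_Suc_atMost)
  have 11: "((\<lambda>t. beta_wt k t * lgS t ^ 1 * lgC t ^ Suc 0) has_integral
      (real (Suc 0) * (\<Sum>j\<le>k. 1 / real (Suc j) ^ 2) + real 1 * (harm (Suc k) / real (Suc k) - zeta 2)) / real (Suc k)) halfpi" for k
    by (rule lgS_lgC_moment_step) (use lgS_moment[of 1] lgC_moment(1) cot_lgC_integral in \<open>simp_all add: power2_eq_square\<close>)
  then have m11: "((\<lambda>t. beta_wt k t * lgS t * lgC t) has_integral
      (gen_harm 2 (Suc k) + harm (Suc k) / real (Suc k) - zeta 2) / real (Suc k)) halfpi" for k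
    unfolding gh by (simp add: add_diff_eq)
  have 21: "((\<lambda>t. beta_wt k t * lgS t ^ 2 * lgC t ^ Suc 0) has_integral
      (real (Suc 0) * (\<Sum>j\<le>k. 2 / real (Suc j) ^ 3)
        + real 2 * ((gen_harm 2 (Suc k) + harm (Suc k) / real (Suc k) - zeta 2) / real (Suc k) - zeta 3)) / real (Suc k)) halfpi"
    by (rule lgS_lgC_moment_step)
       (use lgS_moment[of 2] m11 cot_lgS_lgC_integral in \<open>simp_all add: power2_eq_square power3_eq_cube mult.assoc\<close>)
  have 12: "((\<lambda>t. beta_wt k t * lgS t ^ 1 * lgC t ^ Suc 1) has_integral
      (real (Suc 1) * (\<Sum>j\<le>k. (gen_harm 2 (Suc j) + harm (Suc j) / real (Suc j) - zeta 2) / real (Suc j))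
        + real 1 * (((harm (Suc k))\<^sup>2 + gen_harm 2 (Suc k)) / real (Suc k) - 2 * zeta 3)) / real (Suc k)) halfpi"
    by (rule lgS_lgC_moment_step)
       (use m11 lgC_moment(2) cot_lgC_square_integral in \<open>simp_all add: power2_eq_square mult.assoc\<close>)
  have "(\<Sum>j\<le>k. 2 / real (Suc j) ^ 3) = 2 * gen_harm 3 (Suc k)"
    unfolding gh[symmetric] sum_distrib_left by simp
  with has_integral_add[OF 21 12] show ?thesis
    unfolding sum_harm_Suc_div
    by (elim has_integral_eq_rhs[OF has_integral_eq[rotated]]) (simp_all add: power2_eq_square algebra_simps)
qed

section \<open>Expansions of the powers of the angle\<close>

text \<open>With \<open>X = sin^2 t\<close> and \<open>A\<close> the power series, the derivative is
  \<open>(1 - 2 X) A + 2 X (1 - X) A'\<close>; the hypothesis on \<open>D\<close> is its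
  coefficientwise form.\<close>

lemma theta_series_derivative:
  fixes c :: "nat \<Rightarrow> real"
  assumes conv: "\<And>x. \<bar>x\<bar> < 1 \<Longrightarrow> summable (\<lambda>k. c k * x ^ k)" and t: "\<bar>t\<bar> < pi / 2"
    and D: "(\<lambda>k. (real (2 * k + 3) * c (Suc k) - real (2 * k + 2) * c k) * ((sin t)\<^sup>2) ^ Suc k) sums (D - c 0)"
  shows "((\<lambda>t. sin t * cos t * (\<Sum>k. c k * ((sin t)\<^sup>2) ^ k)) has_real_derivative D) (at t)"
proof -
  define X where "X = (sin t)\<^sup>2"
  define A A' where "A = (\<Sum>k. c k * X ^ k)" and "A' = (\<Sum>k. diffs c k * X ^ k)"
  have "cos t > 0" using t by (intro cos_gt_zero_pi) auto
  then have "(cos t)\<^sup>2 > 0" by simp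
  then have X: "0 \<le> X" "X < 1" "(cos t)\<^sup>2 = 1 - X"
    unfolding X_def cos_squared_eq by auto
  have A'_sums: "(\<lambda>k. diffs c k * X ^ k) sums A'"
    unfolding A'_def by (intro summable_sums termdiff_converges[of X 1]) (use conv X in auto)
  have A_deriv: "((\<lambda>x. \<Sum>k. c k * x ^ k) has_real_derivative A') (at X)"
    unfolding A'_def by (rule termdiffs_strong'[where K = 1]) (use conv X in auto)
  have "((\<lambda>t. (sin t)\<^sup>2) has_real_derivative 2 * sin t * cos t) (at t)"
    by (rule derivative_eq_intros refl)+ simp
  from DERIV_chain2[OF A_deriv[unfolded X_def] this]
  have "((\<lambda>t. \<Sum>k. c k * ((sin t)\<^sup>2) ^ k) has_real_derivative A' * (2 * sin t * cos t)) (at t)" .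
  from DERIV_mult[OF DERIV_mult[OF DERIV_sin DERIV_cos] this]
  have "((\<lambda>t. sin t * cos t * (\<Sum>k. c k * ((sin t)\<^sup>2) ^ k)) has_real_derivative
      (cos t * cos t - sin t * sin t) * A + A' * (2 * sin t * cos t) * (sin t * cos t)) (at t)"
    by (simp add: A_def X_def)
  also have "(cos t * cos t - sin t * sin t) * A + A' * (2 * sin t * cos t) * (sin t * cos t)
      = (1 - 2 * X) * A + 2 * X * (1 - X) * A'"
  proof -
    have "cos t * cos t = 1 - X" "sin t * sin t = X" using X(3) by (simp_all add: X_def power2_eq_square)
    moreover have "A' * (2 * sin t * cos t) * (sin t * cos t) = 2 * (sin t * sin t) * (cos t * cos t) * A'" by simp
    ultimately show ?thesis by (simp only:) simp
  qed
  also have "\<dots> = D"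
  proof -
    have A_sums: "(\<lambda>k. c k * X ^ k) sums A"
      unfolding A_def by (intro summable_sums conv) (use X in auto)
    have kA: "(\<lambda>k. real (Suc k) * c (Suc k) * X ^ Suc k) sums (X * A')"
      using sums_mult[OF A'_sums, of X] by (simp add: diffs_def mult_ac)
    then have kA0: "(\<lambda>k. real k * c k * X ^ k) sums (X * A')"
      by (subst (asm) sums_Suc_iff) simp
    have "(\<lambda>k. c (Suc k) * X ^ Suc k) sums (A - c 0)"
      using A_sums by (subst sums_Suc_iff) simp
    from sums_diff[OF sums_add[OF this sums_mult[OF kA, of 2]] sums_mult[OF sums_add[OF A_sums kA0], of "2 * X"]]
    have "(\<lambda>k. (real (2 * k + 3) * c (Suc k) - real (2 * k + 2) * c k) * X ^ Suc k) sums
        (A - c 0 + 2 * (X * A') - 2 * X * (A + X * A'))"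
      by (simp add: algebra_simps)
    from sums_unique2[OF this D[folded X_def]] show ?thesis
      by (simp add: algebra_simps)
  qed
  finally show ?thesis .
qed

text \<open>The Taylor coefficients of \<open>2 arcsin x / (x sqrt (1 - x^2))\<close> in powers of
  \<open>x^2\<close>.\<close>

definition theta_coeff :: "nat \<Rightarrow> real" where
  "theta_coeff k = conn (Suc k) 0 / real (Suc k)"

lemma theta_coeff_nonneg: "theta_coeff k \<ge> 0"
  by (simp add: theta_coeff_def)

lemma theta_coeff_0: "theta_coeff 0 = 2"
  by (simp add: theta_coeff_def conn_Suc_left)

lemma theta_coeff_Suc: "real (2 * k + 3) * theta_coeff (Suc k) = real (2 * k + 2) * theta_coeff k"
proof -
  define y z where "y = real 0 + 1 / 2 + real (Suc k)" and "z = real (Suc k) + 1"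
  have "y > 0" "z > 0" "real (2 * k + 3) = 2 * y" "real (Suc (Suc k)) = z" "real (2 * k + 2) = 2 * real (Suc k)"
    by (simp_all add: y_def z_def)
  then show ?thesis
    unfolding theta_coeff_def conn_Suc_left[of "Suc k"] y_def[symmetric] z_def[symmetric]
    by (simp del: of_nat_Suc of_nat_add of_nat_mult)
qed

lemma theta_coeff_le: "theta_coeff k \<le> 2"
proof (induction k)
  case (Suc k)
  have "real (2 * k + 2) * theta_coeff (Suc k) \<le> real (2 * k + 3) * theta_coeff (Suc k)"
    using theta_coeff_nonneg[of "Suc k"] by (intro mult_right_mono) auto
  then have "theta_coeff (Suc k) \<le> theta_coeff k"
    unfolding theta_coeff_Suc by (simp add: mult_le_cancel_left)
  with Suc show ?case by linarith
qed (simp add: theta_coeff_0)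

lemma gen_harm_2_le: "gen_harm 2 k \<le> zeta 2"
  using sum_le_suminf[OF sums_summable[OF zeta_sums[of 2]], of "{..<k}"] zeta_sums[of 2]
  by (simp add: gen_harm_conv_lessThan sums_iff)

lemma summable_theta:
  fixes x :: real
  assumes "\<bar>x\<bar> < 1"
  shows "summable (\<lambda>k. theta_coeff k * x ^ k)" and "summable (\<lambda>k. theta_coeff k * gen_harm 2 k * x ^ k)"
proof -
  have g: "summable (\<lambda>k. C * \<bar>x\<bar> ^ k)" for C
    using assms by (intro summable_mult summable_geometric) simp
  show "summable (\<lambda>k. theta_coeff k * x ^ k)"
    by (rule summable_comparison_test'[OF g[of 2], of 0])
       (auto simp: abs_mult power_abs theta_coeff_nonneg intro!: mult_right_mono theta_coeff_le)
  show "summable (\<lambda>k. theta_coeff k * gen_harm 2 k * x ^ k)"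
    by (rule summable_comparison_test'[OF g[of "2 * zeta 2"], of 0])
       (auto simp: abs_mult power_abs theta_coeff_nonneg intro!: mult_right_mono mult_mono theta_coeff_le gen_harm_2_le)
qed

lemma constant_from_derivative:
  fixes f g :: "real \<Rightarrow> real"
  assumes "\<And>t. \<bar>t\<bar> < pi / 2 \<Longrightarrow> (f has_real_derivative h t) (at t)"
    and "\<And>t. \<bar>t\<bar> < pi / 2 \<Longrightarrow> (g has_real_derivative h t) (at t)"
    and "f 0 = g 0" "\<bar>t\<bar> < pi / 2"
  shows "f t = g t"
proof -
  have "\<exists>c. \<forall>t\<in>{- (pi / 2)<..<pi / 2}. f t - g t = c"
  proof (rule has_field_derivative_zero_constant)
    fix t assume "t \<in> {- (pi / 2)<..<pi / 2}"
    then have "\<bar>t\<bar> < pi / 2" by auto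
    from DERIV_diff[OF assms(1)[OF this] assms(2)[OF this]]
    show "((\<lambda>t. f t - g t) has_field_derivative 0) (at t within {- (pi / 2)<..<pi / 2})"
      by (simp add: has_field_derivative_at_within)
  qed simp
  then obtain c where c: "\<forall>t\<in>{- (pi / 2)<..<pi / 2}. f t - g t = c" ..
  have "- (pi / 2) < t" "t < pi / 2" using assms(4) by linarith+
  then show ?thesis
    using bspec[OF c, of 0] bspec[OF c, of t] assms(3) by simp
qed

text \<open>By the recurrence of \<open>theta_coeff\<close>, all higher coefficients of the first
  derivative cancel. In the second series the increment of \<open>gen_harm 2\<close> leaves
  \<open>2 * theta_coeff k / Suc k\<close>, which are the coefficients of \<open>4 * t ^ 2\<close>,
  found by integrating the first expansion.\<close>

lemma theta_series_aux:
  assumes "\<bar>t\<bar> < pi / 2"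
  shows "sin t * cos t * (\<Sum>k. theta_coeff k * ((sin t)\<^sup>2) ^ k) = 2 * t" (is ?A)
    and "sin t * cos t * (\<Sum>k. theta_coeff k * gen_harm 2 k * ((sin t)\<^sup>2) ^ k) = 4 / 3 * t ^ 3" (is ?B)
proof -
  have A: "sin t * cos t * (\<Sum>k. theta_coeff k * ((sin t)\<^sup>2) ^ k) = 2 * t" if t: "\<bar>t\<bar> < pi / 2" for t
  proof (rule constant_from_derivative[OF _ _ _ t])
    show "((\<lambda>t. sin t * cos t * (\<Sum>k. theta_coeff k * ((sin t)\<^sup>2) ^ k)) has_real_derivative 2) (at t)" if "\<bar>t\<bar> < pi / 2" for t
      by (rule theta_series_derivative[OF summable_theta(1) that]) (simp_all only: theta_coeff_Suc theta_coeff_0, simp)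
    show "((\<lambda>t. 2 * t) has_real_derivative 2) (at t)" for t :: real
      by (auto intro!: derivative_eq_intros)
  qed simp
  show ?A by (rule A[OF assms])
  \<comment> \<open>Termwise antiderivative, in the variable \<open>sin^2 t\<close>, of twice the
    first series, with constant term 0.\<close>
  define c where "c = (\<lambda>k. case k of 0 \<Rightarrow> 0 | Suc j \<Rightarrow> 2 * theta_coeff j / real (Suc j))"
  have c_diffs: "diffs c k = 2 * theta_coeff k" for k
    by (simp add: c_def diffs_def)
  have c_summable: "summable (\<lambda>k. c k * x ^ k)" if "\<bar>x\<bar> < 1" for x
  proof -
    have "summable (\<lambda>k. c (Suc k) * x ^ Suc k)"
    proof (rule summable_comparison_test'[of _ 0])
      show "summable (\<lambda>k. 4 * \<bar>x\<bar> ^ k)"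
        using that by (intro summable_mult summable_geometric) simp
      fix k
      have "2 * theta_coeff k / real (Suc k) \<le> 4 / 1"
        using theta_coeff_le[of k] theta_coeff_nonneg[of k] by (intro frac_le) auto
      moreover have "\<bar>x\<bar> * \<bar>x\<bar> ^ k \<le> 1 * \<bar>x\<bar> ^ k" using that by (intro mult_right_mono) auto
      ultimately have "(2 * theta_coeff k / real (Suc k)) * (\<bar>x\<bar> * \<bar>x\<bar> ^ k) \<le> 4 * (1 * \<bar>x\<bar> ^ k)"
        using theta_coeff_nonneg[of k] that by (intro mult_mono) auto
      then show "norm (c (Suc k) * x ^ Suc k) \<le> 4 * \<bar>x\<bar> ^ k"
        using theta_coeff_nonneg[of k] by (simp add: c_def abs_mult power_abs)
    qed
    then show ?thesis by (subst (asm) summable_Suc_iff)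
  qed
  have sin2: "(sin t)\<^sup>2 < 1" if "\<bar>t\<bar> < pi / 2" for t :: real
  proof -
    have "cos t > 0" using that by (intro cos_gt_zero_pi) auto
    then have "(cos t)\<^sup>2 > 0" by simp
    then show ?thesis by (simp add: cos_squared_eq)
  qed
  have C: "(\<Sum>k. c k * ((sin t)\<^sup>2) ^ k) = 4 * t\<^sup>2" if t: "\<bar>t\<bar> < pi / 2" for t
  proof (rule constant_from_derivative[OF _ _ _ t])
    fix t :: real assume t: "\<bar>t\<bar> < pi / 2"
    have "((\<lambda>x. \<Sum>k. c k * x ^ k) has_real_derivative (\<Sum>k. diffs c k * ((sin t)\<^sup>2) ^ k)) (at ((sin t)\<^sup>2))"
      by (rule termdiffs_strong'[where K = 1]) (use c_summable sin2[OF t] in auto)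
    moreover have "((\<lambda>t. (sin t)\<^sup>2) has_real_derivative 2 * sin t * cos t) (at t)"
      by (rule derivative_eq_intros refl)+ simp
    ultimately have "((\<lambda>t. \<Sum>k. c k * ((sin t)\<^sup>2) ^ k) has_real_derivative
        (\<Sum>k. diffs c k * ((sin t)\<^sup>2) ^ k) * (2 * sin t * cos t)) (at t)"
      by (rule DERIV_chain2)
    also have "(\<Sum>k. diffs c k * ((sin t)\<^sup>2) ^ k) = 2 * (\<Sum>k. theta_coeff k * ((sin t)\<^sup>2) ^ k)"
      unfolding c_diffs mult.assoc using sin2[OF t] by (intro suminf_mult summable_theta) auto
    also have "2 * (\<Sum>k. theta_coeff k * ((sin t)\<^sup>2) ^ k) * (2 * sin t * cos t) = 8 * t"
      using A[OF t] by (simp add: mult_ac)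
    finally show "((\<lambda>t. \<Sum>k. c k * ((sin t)\<^sup>2) ^ k) has_real_derivative 8 * t) (at t)" .
    show "((\<lambda>t. 4 * t\<^sup>2) has_real_derivative 8 * t) (at t)"
      by (auto intro!: derivative_eq_intros)
  next
    have "(\<Sum>k. c k * 0 ^ k) = c 0" by (rule powser_zero)
    then show "(\<Sum>k. c k * ((sin 0)\<^sup>2) ^ k) = 4 * 0\<^sup>2" by (simp add: c_def)
  qed
  show ?B
  proof (rule constant_from_derivative[OF _ _ _ assms])
    fix t :: real assume t: "\<bar>t\<bar> < pi / 2"
    have "(\<lambda>k. c k * ((sin t)\<^sup>2) ^ k) sums (4 * t\<^sup>2)"
      unfolding C[OF t, symmetric] using sin2[OF t] by (intro summable_sums c_summable) auto
    then have *: "(\<lambda>k. c (Suc k) * ((sin t)\<^sup>2) ^ Suc k) sums (4 * t\<^sup>2)"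
      by (subst sums_Suc_iff) (simp add: c_def)
    have coeff: "real (2 * k + 3) * (theta_coeff (Suc k) * gen_harm 2 (Suc k)) - real (2 * k + 2) * (theta_coeff k * gen_harm 2 k) = c (Suc k)" for k
    proof -
      have two: "real (2 * k + 2) = 2 * real (Suc k)" by simp
      have alg: "2 * r * a * (g + 1 / r ^ 2) - 2 * r * (a * g) = 2 * a / r" if "r > 0" for r a g :: real
        using that by (simp add: power2_eq_square field_simps)
      have "real (2 * k + 3) * (theta_coeff (Suc k) * gen_harm 2 (Suc k)) = real (2 * k + 2) * theta_coeff k * gen_harm 2 (Suc k)"
        by (simp only: mult.assoc[symmetric] theta_coeff_Suc)
      then have "real (2 * k + 3) * (theta_coeff (Suc k) * gen_harm 2 (Suc k)) - real (2 * k + 2) * (theta_coeff k * gen_harm 2 k)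
          = 2 * real (Suc k) * theta_coeff k * (gen_harm 2 k + 1 / real (Suc k) ^ 2) - 2 * real (Suc k) * (theta_coeff k * gen_harm 2 k)"
        by (simp only: two gen_harm_Suc)
      also have "\<dots> = 2 * theta_coeff k / real (Suc k)"
        by (rule alg) simp
      finally show ?thesis by (simp only: c_def nat.case)
    qed
    show "((\<lambda>t. sin t * cos t * (\<Sum>k. theta_coeff k * gen_harm 2 k * ((sin t)\<^sup>2) ^ k)) has_real_derivative 4 * t\<^sup>2) (at t)"
      by (rule theta_series_derivative[OF summable_theta(2) t]) (use * in \<open>simp_all only: coeff, simp\<close>)
    show "((\<lambda>t. 4 / 3 * t ^ 3) has_real_derivative 4 * t\<^sup>2) (at t)"
      by (auto intro!: derivative_eq_intros simp: power2_eq_square)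
  qed simp
qed

lemma theta_series:
  assumes "0 \<le> t" "t < pi / 2"
  shows "(\<lambda>k. theta_coeff k * beta_wt k t) sums (4 * t)"
    and "(\<lambda>k. theta_coeff k * gen_harm 2 k * beta_wt k t) sums (8 / 3 * t ^ 3)"
proof -
  have t: "\<bar>t\<bar> < pi / 2" using assms by auto
  have "cos t > 0" using t by (intro cos_gt_zero_pi) auto
  then have "(cos t)\<^sup>2 > 0" by simp
  then have X: "\<bar>(sin t)\<^sup>2\<bar> < 1" by (simp add: cos_squared_eq)
  have beta: "beta_wt k t = 2 * (sin t * cos t) * ((sin t)\<^sup>2) ^ k" for k
    by (simp add: beta_wt_def power_mult)
  show "(\<lambda>k. theta_coeff k * beta_wt k t) sums (4 * t)"
  proof -
    have "2 * (sin t * cos t) * (\<Sum>k. theta_coeff k * ((sin t)\<^sup>2) ^ k) = 4 * t"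
      using theta_series_aux(1)[OF t] by (simp add: mult.assoc)
    with sums_mult[OF summable_sums[OF summable_theta(1)[OF X]], of "2 * (sin t * cos t)"] show ?thesis
      by (simp only: beta mult_ac)
  qed
  show "(\<lambda>k. theta_coeff k * gen_harm 2 k * beta_wt k t) sums (8 / 3 * t ^ 3)"
  proof -
    have "2 * (sin t * cos t) * (\<Sum>k. theta_coeff k * gen_harm 2 k * ((sin t)\<^sup>2) ^ k) = 8 / 3 * t ^ 3"
      using theta_series_aux(2)[OF t] by (simp add: mult.assoc)
    with sums_mult[OF summable_sums[OF summable_theta(2)[OF X]], of "2 * (sin t * cos t)"] show ?thesis
      by (simp only: beta mult_ac)
  qed
qed

lemma theta_series_integral:
  fixes b m :: "nat \<Rightarrow> real" and \<theta> W :: "real \<Rightarrow> real"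
  assumes b: "\<And>k. b k \<ge> 0" and W: "\<And>t. t \<in> halfpi \<Longrightarrow> W t \<ge> 0"
    and \<theta>: "\<And>t. 0 \<le> t \<Longrightarrow> t < pi / 2 \<Longrightarrow> (\<lambda>k. b k * beta_wt k t) sums \<theta> t"
    and m: "\<And>k. ((\<lambda>t. beta_wt k t * W t) has_integral m k) halfpi"
    and I: "((\<lambda>t. \<theta> t * W t) has_integral I) halfpi"
  shows "(\<lambda>k. b k * m k) sums I"
proof -
  define f where "f = (\<lambda>n t. \<Sum>k<n. b k * (beta_wt k t * W t))"
  \<comment> \<open>Every \<open>beta_wt k\<close> vanishes at \<open>pi / 2\<close>, so there the
    series sums to 0 whatever \<open>\<theta> t * W t\<close> is; one point does not change the
    integral.\<close>
  define g where "g = (\<lambda>t. if t = pi / 2 then 0 else \<theta> t * W t)"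
  have f_int: "(f n has_integral (\<Sum>k<n. b k * m k)) halfpi" for n
    unfolding f_def by (intro has_integral_sum has_integral_mult_right m) auto
  have g_int: "(g has_integral I) halfpi"
    by (rule has_integral_spike_finite[of "{pi / 2}", OF _ _ I]) (auto simp: g_def)
  have term_nonneg: "0 \<le> b k * (beta_wt k t * W t)" if "t \<in> halfpi" for k t
    using b W[OF that] beta_wt_nonneg[OF that] by (intro mult_nonneg_nonneg)
  have f_lim: "(\<lambda>n. f n t) \<longlonglongrightarrow> g t" if t: "t \<in> halfpi" for t
  proof (cases "t = pi / 2")
    case True
    have "beta_wt k (pi / 2) = 0" for k by (simp add: beta_wt_def)
    then show ?thesis unfolding True f_def g_def by simp
  next
    case False
    then have "(\<lambda>k. b k * beta_wt k t) sums \<theta> t" using t by (intro \<theta>) auto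
    from sums_mult2[OF this, of "W t"] show ?thesis
      using False by (simp add: sums_def f_def g_def mult.assoc)
  qed
  have f_le: "f n t \<le> g t" if "t \<in> halfpi" for n t
    using f_lim[OF that] term_nonneg[OF that]
    by (intro incseq_le) (auto simp: f_def incseq_def intro!: sum_mono2)
  \<comment> \<open>The known integral of the limit bounds the partial integrals, as monotone
    convergence requires.\<close>
  have "(\<Sum>k<n. b k * m k) \<le> I" for n
    by (rule has_integral_le[OF f_int[of n] g_int f_le])
  moreover have "0 \<le> (\<Sum>k<n. b k * m k)" for n
    by (rule has_integral_nonneg[OF f_int[of n]]) (unfold f_def, intro sum_nonneg term_nonneg)
  ultimately have "bounded (range (\<lambda>n. integral halfpi (f n)))"
    by (intro boundedI[of _ I]) (auto simp: integral_unique[OF f_int])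
  then have "(\<lambda>n. integral halfpi (f n)) \<longlonglongrightarrow> integral halfpi g"
    using f_lim f_int term_nonneg
    by (intro monotone_convergence_increasing[THEN conjunct2]) (auto simp: f_def integrable_on_def)
  then show ?thesis
    by (simp add: sums_def integral_unique[OF f_int] integral_unique[OF g_int])
qed


section \<open>The six sums\<close>

text \<open>\<open>u1\<close> to \<open>u6\<close> are the sums in the order of the theorem,
  \<open>u7\<close> is the auxiliary one. The premises come from: \<open>t\<close> against
  \<open>lgC ^ 3\<close>, \<open>t\<close> against the mixed weight, the two connector relations,
  \<open>t ^ 3\<close> against \<open>lgS\<close> and against \<open>lgC\<close>, and
  \<open>t\<close> against \<open>lgS ^ 3\<close>.\<close>

lemma linear_system_solution:
  fixes u1 u2 u3 u4 u5 u6 u7 z a b c L q :: real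
  assumes "u6 + 3 * u5 + 2 * u1 = - (93 / 4) * z + 36 * b + 237 * a + 96 * L - 4 / 5 * q + 32 * c"
   "4 * u1 + 3 * u2 + u3 + 2 * u4 + 2 * u5 = 60 * a + 48 * c"
   "u6 - 3 * u3 + 6 * u4 - 3 * u5 + 3 * u2 + 2 * u1 - 6 * u7 = 186 * z"
   "u5 - u4 - u2 - u1 + 2 * u7 = 21 * b - 31 * z"
   "u2 - u7 = 31 / 8 * z - 9 / 2 * b + 15 / 2 * a"
   "u5 - u4 = - (31 / 8) * z + 6 * b + 15 / 2 * a"
   "u7 = 31 / 8 * z + 6 * b - 16 * L - 19 / 2 * a + 8 / 3 * c + 2 / 15 * q"
 shows "u1 = 217 / 8 * z - 9 / 2 * b - 16 * L - 19 / 2 * a + 8 / 3 * c + 2 / 15 * q"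
   "u2 = 31 / 4 * z + 3 / 2 * b - 16 * L - 2 * a + 8 / 3 * c + 2 / 15 * q"
   "u3 = - 62 * z - 21 / 2 * b + 48 * L + 81 * a + 8 * c - 2 / 5 * q"
   "u4 = - (31 / 2) * z + 3 * b + 16 * L + 2 * a + 16 / 3 * c - 2 / 15 * q"
   "u5 = - (155 / 8) * z + 9 * b + 16 * L + 19 / 2 * a + 16 / 3 * c - 2 / 15 * q"
   "u6 = - (155 / 8) * z + 18 * b + 80 * L + 455 / 2 * a + 32 / 3 * c - 2 / 3 * q"
proof -
  show "u1 = 217 / 8 * z - 9 / 2 * b - 16 * L - 19 / 2 * a + 8 / 3 * c + 2 / 15 * q"
    using assms(4-7) by linarith
  show "u2 = 31 / 4 * z + 3 / 2 * b - 16 * L - 2 * a + 8 / 3 * c + 2 / 15 * q"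
    using assms(4-7) by linarith
  \<comment> \<open>As \<open>u5 - u4\<close> is known, the third premise minus the first determines
    \<open>u3\<close>; the second premise then gives \<open>u5\<close>, hence \<open>u4\<close>, and
    the first gives \<open>u6\<close>.\<close>
  show "u3 = - 62 * z - 21 / 2 * b + 48 * L + 81 * a + 8 * c - 2 / 5 * q"
    using assms by linarith
  show  "u4 = - (31 / 2) * z + 3 * b + 16 * L + 2 * a + 16 / 3 * c - 2 / 15 * q"
    using assms by linarith
  show   "u5 = - (155 / 8) * z + 9 * b + 16 * L + 19 / 2 * a + 16 / 3 * c - 2 / 15 * q"
    using assms by linarith
  show   "u6 = - (155 / 8) * z + 18 * b + 80 * L + 455 / 2 * a + 32 / 3 * c - 2 / 3 * q"
    using assms by linarith
qed
theorem theorem1: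
  shows
    "((\<lambda>n. let k = Suc n in 4 ^ k * gen_harm 3 k / (real k ^ 2 * real ((2 * k) choose k)))
      sums (217 / 8 * zeta 5 - 9 / 2 * zeta 2 * zeta 3 - 16 * Li5 (1 / 2) - 19 / 2 * ln 2 * zeta 4
         + 8 / 3 * ln 2 ^ 3 * zeta 2 + 2 / 15 * ln 2 ^ 5)) \<and>
     ((\<lambda>n. let k = Suc n in 4 ^ k * gen_harm 2 k / (real k ^ 3 * real ((2 * k) choose k)))
      sums (31 / 4 * zeta 5 + 3 / 2 * zeta 2 * zeta 3 - 16 * Li5 (1 / 2) - 2 * ln 2 * zeta 4
         + 8 / 3 * ln 2 ^ 3 * zeta 2 + 2 / 15 * ln 2 ^ 5)) \<and>
     ((\<lambda>n. let k = Suc n in 4 ^ k * harm k ^ 2 / (real k ^ 3 * real ((2 * k) choose k)))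
      sums (- 62 * zeta 5 - 21 / 2 * zeta 2 * zeta 3 + 48 * Li5 (1 / 2) + 81 * ln 2 * zeta 4
         + 8 * ln 2 ^ 3 * zeta 2 - 2 / 5 * ln 2 ^ 5)) \<and>
     ((\<lambda>n. let k = Suc n in 4 ^ k * harm k / (real k ^ 4 * real ((2 * k) choose k)))
      sums (- (31 / 2) * zeta 5 + 3 * zeta 2 * zeta 3 + 16 * Li5 (1 / 2) + 2 * ln 2 * zeta 4
         + 16 / 3 * ln 2 ^ 3 * zeta 2 - 2 / 15 * ln 2 ^ 5)) \<and>
     ((\<lambda>n. let k = Suc n in 4 ^ k * harm k * gen_harm 2 k / (real k ^ 2 * real ((2 * k) choose k)))
      sums (- (155 / 8) * zeta 5 + 9 * zeta 2 * zeta 3 + 16 * Li5 (1 / 2) + 19 / 2 * ln 2 * zeta 4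
         + 16 / 3 * ln 2 ^ 3 * zeta 2 - 2 / 15 * ln 2 ^ 5)) \<and>
     ((\<lambda>n. let k = Suc n in 4 ^ k * harm k ^ 3 / (real k ^ 2 * real ((2 * k) choose k)))
      sums (- (155 / 8) * zeta 5 + 18 * zeta 2 * zeta 3 + 80 * Li5 (1 / 2) + 455 / 2 * ln 2 * zeta 4
         + 32 / 3 * ln 2 ^ 3 * zeta 2 - 2 / 3 * ln 2 ^ 5))"
proof -
  define r where "r = (\<lambda>k. 1 / real (Suc k))"
  define w where "w = (\<lambda>k. conn (Suc k) 0)"
  define H G2 G3 where "H = (\<lambda>k. harm (Suc k) :: real)" and "G2 = (\<lambda>k. gen_harm 2 (Suc k))"
    and "G3 = (\<lambda>k. gen_harm 3 (Suc k))"
  have div_r: "x / real (Suc k) = x * r k" "x / real (Suc k) ^ n = x * r k ^ n" for x :: real and k n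
    by (simp_all add: r_def power_one_over)
  \<comment> \<open>The connector sums and the expansion of \<open>t ^ 3\<close> carry harmonic
    numbers at \<open>k\<close>, the target sums at \<open>Suc k\<close>.\<close>
  have pred: "harm k = H k - r k" "gen_harm 2 k = G2 k - r k ^ 2" "gen_harm 3 k = G3 k - r k ^ 3" for k
    by (simp_all add: H_def G2_def G3_def r_def harm_Suc gen_harm_Suc power_one_over inverse_eq_divide)
  have theta: "theta_coeff k = w k * r k" for k
    by (simp only: theta_coeff_def w_def div_r)
  have w0: "w k \<ge> 0" for k by (simp add: w_def)
  have r01: "0 \<le> r k" "r k \<le> 1" for k by (simp_all add: r_def)
  have H1: "1 \<le> H k" for k
  proof (induction k)
    case 0
    show ?case by (simp add: H_def harm_Suc harm_def)
  next
    case (Suc k)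
    have "harm (Suc (Suc k)) = (harm (Suc k) :: real) + inverse (real (Suc (Suc k)))" by (rule harm_Suc)
    moreover have "0 \<le> inverse (real (Suc (Suc k)))" by simp
    ultimately show ?case using Suc unfolding H_def by linarith
  qed
  have G0: "0 \<le> G2 k" "0 \<le> G3 k" for k by (simp_all add: G2_def G3_def)

  have rep: "(\<lambda>k. theta_coeff k * m k) sums I"
    if "\<And>t. t \<in> halfpi \<Longrightarrow> 0 \<le> W t" "\<And>k. ((\<lambda>t. beta_wt k t * W t) has_integral m k) halfpi"
      "((\<lambda>t. 4 * t * W t) has_integral I) halfpi" for m W I
    by (rule theta_series_integral[where \<theta> = "\<lambda>t. 4 * t", OF theta_coeff_nonneg that(1) _ that(2,3)])
      (assumption, rule theta_series(1))
  have coeff2: "theta_coeff k * gen_harm 2 k \<ge> 0" for k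
    using theta_coeff_nonneg[of k] by simp
  have rep3: "(\<lambda>k. theta_coeff k * gen_harm 2 k * m k) sums I"
    if "\<And>t. t \<in> halfpi \<Longrightarrow> 0 \<le> W t" "\<And>k. ((\<lambda>t. beta_wt k t * W t) has_integral m k) halfpi"
      "((\<lambda>t. 8 / 3 * t ^ 3 * W t) has_integral I) halfpi" for m W I
    by (rule theta_series_integral[where \<theta> = "\<lambda>t. 8 / 3 * t ^ 3", OF coeff2 that(1) _ that(2,3)])
      (assumption, rule theta_series(2))
  have mixed_nonneg: "0 \<le> lgS t * lgC t * (lgS t + lgC t)" if "t \<in> halfpi" for t
    by (rule mult_nonneg_nonneg[OF mult_nonneg_nonneg add_nonneg_nonneg]; intro lgS_nonneg lgC_nonneg that)
  \<comment> \<open>A sum of lower weight; like \<open>e2\<close> and \<open>eV\<close> below, it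
    serves to evaluate the terms with \<open>zeta 2\<close> and \<open>zeta 3\<close> in the mixed
    moments.\<close>
  have e10: "(\<lambda>k. w k * r k ^ 3) sums (ln 2 * pi\<^sup>2 - 7 / 2 * zeta 3)"
  proof -
    have "(\<lambda>k. theta_coeff k * r k ^ 2) sums (ln 2 * pi\<^sup>2 - 7 / 2 * zeta 3)"
    proof (rule rep[OF lgS_nonneg _ weighted_integrals(1)])
      show "((\<lambda>t. beta_wt k t * lgS t) has_integral r k ^ 2) halfpi" for k
        using lgS_moment[of 1 k] by (simp only: div_r) (simp add: power2_eq_square)
    qed
    moreover have "theta_coeff k * r k ^ 2 = w k * r k ^ 3" for k
      unfolding theta by (simp add: power2_eq_square power3_eq_cube)
    ultimately show ?thesis by (simp only:)
  qed
  have e30: "(\<lambda>k. 6 * (w k * r k ^ 5)) sums (93 / 4 * zeta 5 + 6 * pi\<^sup>2 * zeta 3 + 3 / 2 * ln 2 * pi ^ 4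
      - 96 * Li5 (1 / 2) + 4 / 5 * ln 2 ^ 5 - 32 * ln 2 ^ 3 * zeta 2 - 192 * ln 2 * zeta 4 + 8 * pi\<^sup>2 * ln 2 ^ 3)"
  proof -
    have "(\<lambda>k. theta_coeff k * (6 * r k ^ 4)) sums (93 / 4 * zeta 5 + 6 * pi\<^sup>2 * zeta 3 + 3 / 2 * ln 2 * pi ^ 4
      - 96 * Li5 (1 / 2) + 4 / 5 * ln 2 ^ 5 - 32 * ln 2 ^ 3 * zeta 2 - 192 * ln 2 * zeta 4 + 8 * pi\<^sup>2 * ln 2 ^ 3)"
    proof (rule rep[OF _ _ weighted_integrals(4)])
      show "((\<lambda>t. beta_wt k t * lgS t ^ 3) has_integral 6 * r k ^ 4) halfpi" for k
        using lgS_moment[of 3 k] by (simp only: div_r) (simp add: fact_numeral)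
    qed (rule zero_le_power, rule lgS_nonneg)
    moreover have "theta_coeff k * (6 * r k ^ 4) = 6 * (w k * r k ^ 5)" for k
      unfolding theta by (simp add: eval_nat_numeral)
    ultimately show ?thesis by (simp only:)
  qed
  have e03: "(\<lambda>k. H k ^ 3 * w k * r k ^ 2 + 3 * (H k * G2 k * w k * r k ^ 2) + 2 * (G3 k * w k * r k ^ 2)) sums
      (- (93 / 4) * zeta 5 + 6 * pi\<^sup>2 * zeta 3 + ln 2 * pi ^ 4 / 2 + 96 * Li5 (1 / 2) - 4 / 5 * ln 2 ^ 5
           + 32 * ln 2 ^ 3 * zeta 2 + 192 * ln 2 * zeta 4)"
  proof -
    have "(\<lambda>k. theta_coeff k * ((H k ^ 3 + 3 * H k * G2 k + 2 * G3 k) * r k)) sums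
      (- (93 / 4) * zeta 5 + 6 * pi\<^sup>2 * zeta 3 + ln 2 * pi ^ 4 / 2 + 96 * Li5 (1 / 2) - 4 / 5 * ln 2 ^ 5
           + 32 * ln 2 ^ 3 * zeta 2 + 192 * ln 2 * zeta 4)"
      by (rule rep[OF _ _ weighted_integrals(5)])
         (use lgC_moment(3) lgC_nonneg in \<open>simp_all only: div_r H_def G2_def G3_def zero_le_power\<close>)
    moreover have "theta_coeff k * ((H k ^ 3 + 3 * H k * G2 k + 2 * G3 k) * r k)
        = H k ^ 3 * w k * r k ^ 2 + 3 * (H k * G2 k * w k * r k ^ 2) + 2 * (G3 k * w k * r k ^ 2)" for k
      unfolding theta by (simp add: algebra_simps power2_eq_square)
    ultimately show ?thesis by (simp only:)
  qed
  have emix: "(\<lambda>k. 4 * (G3 k * w k * r k ^ 2) + 3 * (G2 k * w k * r k ^ 3) + H k ^ 2 * w k * r k ^ 3 + 2 * (H k * w k * r k ^ 4)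
      + 2 * (H k * G2 k * w k * r k ^ 2) - 2 * zeta 2 * (w k * r k ^ 3) - 4 * zeta 3 * (w k * r k ^ 2)
      - 2 * zeta 2 * (H k * w k * r k ^ 2)) sums (8 * pi\<^sup>2 * ln 2 ^ 3 - 2 * pi\<^sup>2 * zeta 3)"
  proof -
    have "(\<lambda>k. theta_coeff k * ((2 * G3 k + 2 * ((G2 k + H k * r k - zeta 2) * r k - zeta 3)) * r k
         + (2 * (H k * G2 k + G3 k - zeta 2 * H k) + (((H k)\<^sup>2 + G2 k) * r k - 2 * zeta 3)) * r k)) sums
        (8 * pi\<^sup>2 * ln 2 ^ 3 - 2 * pi\<^sup>2 * zeta 3)"
      by (rule rep[OF mixed_nonneg _ weighted_integrals(6)])
         (use lgS_lgC_moment in \<open>simp_all only: div_r H_def G2_def G3_def\<close>)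
    moreover have "theta_coeff k * ((2 * G3 k + 2 * ((G2 k + H k * r k - zeta 2) * r k - zeta 3)) * r k
         + (2 * (H k * G2 k + G3 k - zeta 2 * H k) + (((H k)\<^sup>2 + G2 k) * r k - 2 * zeta 3)) * r k)
       = 4 * (G3 k * w k * r k ^ 2) + 3 * (G2 k * w k * r k ^ 3) + H k ^ 2 * w k * r k ^ 3 + 2 * (H k * w k * r k ^ 4)
      + 2 * (H k * G2 k * w k * r k ^ 2) - 2 * zeta 2 * (w k * r k ^ 3) - 4 * zeta 3 * (w k * r k ^ 2)
      - 2 * zeta 2 * (H k * w k * r k ^ 2)" for k
      unfolding theta by (simp add: algebra_simps power2_eq_square power3_eq_cube power4_eq_xxxx)
    ultimately show ?thesis by (simp only:)
  qed
  have eB: "(\<lambda>k. G2 k * w k * r k ^ 3 - w k * r k ^ 5) sums (31 / 8 * zeta 5 - 3 / 4 * pi\<^sup>2 * zeta 3 + ln 2 * pi ^ 4 / 12)"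
  proof -
    have "(\<lambda>k. theta_coeff k * gen_harm 2 k * r k ^ 2) sums (31 / 8 * zeta 5 - 3 / 4 * pi\<^sup>2 * zeta 3 + ln 2 * pi ^ 4 / 12)"
    proof (rule rep3[OF lgS_nonneg _ weighted_integrals(2)])
      show "((\<lambda>t. beta_wt k t * lgS t) has_integral r k ^ 2) halfpi" for k
        using lgS_moment[of 1 k] by (simp only: div_r) (simp add: power2_eq_square)
    qed
    moreover have "theta_coeff k * gen_harm 2 k * r k ^ 2 = G2 k * w k * r k ^ 3 - w k * r k ^ 5" for k
      unfolding theta pred by (simp add: algebra_simps eval_nat_numeral)
    ultimately show ?thesis by (simp only:)
  qed
  have eC: "(\<lambda>k. H k * G2 k * w k * r k ^ 2 - H k * w k * r k ^ 4) sums (- (31 / 8) * zeta 5 + pi\<^sup>2 * zeta 3 + ln 2 * pi ^ 4 / 12)"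
  proof -
    have "(\<lambda>k. theta_coeff k * gen_harm 2 k * (H k * r k)) sums (- (31 / 8) * zeta 5 + pi\<^sup>2 * zeta 3 + ln 2 * pi ^ 4 / 12)"
      by (rule rep3[OF lgC_nonneg _ weighted_integrals(3)])
         (use lgC_moment(1) in \<open>simp_all only: div_r H_def\<close>)
    moreover have "theta_coeff k * gen_harm 2 k * (H k * r k) = H k * G2 k * w k * r k ^ 2 - H k * w k * r k ^ 4" for k
      unfolding theta pred by (simp add: algebra_simps eval_nat_numeral)
    ultimately show ?thesis by (simp only:)
  qed
  have e2: "(\<lambda>k. w k * r k ^ 2) sums (3 * zeta 2)"
    using central_sums(1) half_zeta_conv_zeta[of 2] by (simp only: div_r w_def) simp
  have eV: "(\<lambda>k. H k * w k * r k ^ 2 - w k * r k ^ 3) sums (7 * zeta 3)"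
  proof -
    have "(\<lambda>k. harm k * w k * r k ^ 2) sums (7 * zeta 3)"
      using central_sums(2) half_zeta_conv_zeta[of 3] by (simp only: div_r w_def) simp
    moreover have "harm k * w k * r k ^ 2 = H k * w k * r k ^ 2 - w k * r k ^ 3" for k
      unfolding pred by (simp add: algebra_simps power2_eq_square power3_eq_cube)
    ultimately show ?thesis by (simp only:)
  qed
  have eR1: "(\<lambda>k. H k ^ 3 * w k * r k ^ 2 - 3 * (H k ^ 2 * w k * r k ^ 3) + 6 * (H k * w k * r k ^ 4)
      - 3 * (H k * G2 k * w k * r k ^ 2) + 3 * (G2 k * w k * r k ^ 3) + 2 * (G3 k * w k * r k ^ 2) - 6 * (w k * r k ^ 5))
      sums (186 * zeta 5)"
  proof -
    have "(\<lambda>k. 6 * ((harm k ^ 3 - 3 * harm k * gen_harm 2 k + 2 * gen_harm 3 k) / 6 * w k * r k ^ 2)) sums (6 * (31 * zeta 5))"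
      using central_sums(3) half_zeta_conv_zeta[of 5] by (intro sums_mult) (simp only: div_r w_def, simp)
    moreover have "6 * ((harm k ^ 3 - 3 * harm k * gen_harm 2 k + 2 * gen_harm 3 k) / 6 * w k * r k ^ 2)
       = H k ^ 3 * w k * r k ^ 2 - 3 * (H k ^ 2 * w k * r k ^ 3) + 6 * (H k * w k * r k ^ 4)
      - 3 * (H k * G2 k * w k * r k ^ 2) + 3 * (G2 k * w k * r k ^ 3) + 2 * (G3 k * w k * r k ^ 2) - 6 * (w k * r k ^ 5)" for k
      unfolding pred by (simp add: field_simps eval_nat_numeral)
    ultimately show ?thesis by simp
  qed
  have eR2: "(\<lambda>k. H k * G2 k * w k * r k ^ 2 - H k * w k * r k ^ 4 - G2 k * w k * r k ^ 3 - G3 k * w k * r k ^ 2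
      + 2 * (w k * r k ^ 5)) sums (21 * zeta 2 * zeta 3 - 31 * zeta 5)"
  proof -
    have "(\<lambda>k. (harm k * gen_harm 2 k - gen_harm 3 k) * w k * r k ^ 2) sums (21 * zeta 2 * zeta 3 - 31 * zeta 5)"
      using central_sums_mixed half_zeta_conv_zeta[of 2] half_zeta_conv_zeta[of 3] half_zeta_conv_zeta[of 5]
      by (simp only: div_r w_def) (simp add: mult.assoc)
    moreover have "(harm k * gen_harm 2 k - gen_harm 3 k) * w k * r k ^ 2
      = H k * G2 k * w k * r k ^ 2 - H k * w k * r k ^ 4 - G2 k * w k * r k ^ 3 - G3 k * w k * r k ^ 2 + 2 * (w k * r k ^ 5)" for k
      unfolding pred by (simp add: algebra_simps eval_nat_numeral)
    ultimately show ?thesis by (simp only:)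
  qed

  have wr: "0 \<le> w k * r k ^ n" for k n using w0 r01 by simp
  \<comment> \<open>The series \<open>e03\<close> converges and is a sum of three nonnegative parts,
    so anything below it converges.\<close>
  have summ: "summable x" if "\<And>k. 0 \<le> x k" "\<And>k. x k \<le> H k ^ 3 * w k * r k ^ 2 + 3 * (H k * G2 k * w k * r k ^ 2) + 2 * (G3 k * w k * r k ^ 2)" for x
    by (rule summable_comparison_test'[OF sums_summable[OF e03], of 0]) (use that in auto)
  have nn: "0 \<le> H k ^ 3 * w k * r k ^ 2" "0 \<le> H k * G2 k * w k * r k ^ 2" "0 \<le> G3 k * w k * r k ^ 2" for k
    using H1[of k] G0[of k] w0[of k] r01[of k] by auto
  obtain u1 where u1: "(\<lambda>k. G3 k * w k * r k ^ 2) sums u1"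
  proof -
    have "summable (\<lambda>k. G3 k * w k * r k ^ 2)"
      by (rule summ) (use nn in \<open>smt (verit)\<close>)+
    then show ?thesis using that by (auto simp: summable_def)
  qed
  obtain u5 where u5: "(\<lambda>k. H k * G2 k * w k * r k ^ 2) sums u5"
  proof -
    have "summable (\<lambda>k. H k * G2 k * w k * r k ^ 2)"
      by (rule summ) (use nn in \<open>smt (verit)\<close>)+
    then show ?thesis using that by (auto simp: summable_def)
  qed
  have u6_summable: "summable (\<lambda>k. H k ^ 3 * w k * r k ^ 2)"
    by (rule summ) (use nn in \<open>smt (verit)\<close>)+
  then obtain u6 where u6: "(\<lambda>k. H k ^ 3 * w k * r k ^ 2) sums u6"
    by (auto simp: summable_def)
  \<comment> \<open>\<open>H k \<ge> 1\<close> and \<open>r k \<le> 1\<close>, so lowering the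
    harmonic power and raising that of \<open>r k\<close> only shrinks the term.\<close>
  have le: "H k ^ i * w k * r k ^ j \<le> H k ^ 3 * w k * r k ^ 2" if "i \<le> 3" "2 \<le> j" for i j k
    using that H1[of k] w0[of k] r01[of k]
    by (intro mult_mono power_increasing power_decreasing) auto
  have "summable (\<lambda>k. H k ^ 2 * w k * r k ^ 3)"
    by (rule summable_comparison_test'[OF u6_summable, of 0]) (use le[of 2 3] H1 w0 r01 in auto)
  then obtain u3 where u3: "(\<lambda>k. H k ^ 2 * w k * r k ^ 3) sums u3"
    by (auto simp: summable_def)
  have u7: "(\<lambda>k. w k * r k ^ 5) sums ((93 / 4 * zeta 5 + 6 * pi\<^sup>2 * zeta 3 + 3 / 2 * ln 2 * pi ^ 4
      - 96 * Li5 (1 / 2) + 4 / 5 * ln 2 ^ 5 - 32 * ln 2 ^ 3 * zeta 2 - 192 * ln 2 * zeta 4 + 8 * pi\<^sup>2 * ln 2 ^ 3) / 6)"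
    (is "_ sums ?u7")
    using sums_divide[OF e30, of 6] by simp
  \<comment> \<open>\<open>eB\<close> and \<open>eC\<close> give these two series as combinations
    with \<open>u7\<close> and \<open>u5\<close>, which settles convergence and two equations of the
    system at once.\<close>
  define u2 u4 where "u2 = (31 / 8 * zeta 5 - 3 / 4 * pi\<^sup>2 * zeta 3 + ln 2 * pi ^ 4 / 12) + ?u7"
    and "u4 = u5 - (- (31 / 8) * zeta 5 + pi\<^sup>2 * zeta 3 + ln 2 * pi ^ 4 / 12)"
  have u2: "(\<lambda>k. G2 k * w k * r k ^ 3) sums u2"
    using sums_add[OF eB u7] by (simp add: u2_def)
  have u4: "(\<lambda>k. H k * w k * r k ^ 4) sums u4"
    using sums_diff[OF u5 eC] by (simp add: u4_def)
  have v: "(\<lambda>k. H k * w k * r k ^ 2) sums (7 * zeta 3 + (ln 2 * pi\<^sup>2 - 7 / 2 * zeta 3))"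
    using sums_add[OF eV e10] by simp
  have pi2: "pi\<^sup>2 = 6 * zeta 2" and pi4: "pi ^ 4 = 90 * zeta 4"
    by (simp_all add: zeta_2 zeta_4)
  have z22: "zeta 2 * (zeta 2 * x) = 5 / 2 * (zeta 4 * x)" for x
    by (simp add: zeta_2 zeta_4 power2_eq_square power4_eq_xxxx)
  \<comment> \<open>The products of constants become atoms, so that the system is linear.\<close>
  define a b c where "a = ln 2 * zeta 4" and "b = zeta 2 * zeta 3" and "c = ln 2 ^ 3 * zeta 2"
  note abc = a_def b_def c_def
  have U7: "?u7 = 31 / 8 * zeta 5 + 6 * b - 16 * Li5 (1 / 2) - 19 / 2 * a + 8 / 3 * c + 2 / 15 * ln 2 ^ 5"
    unfolding pi2 pi4 abc by (simp add: field_simps)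
  have U2: "u2 - ?u7 = 31 / 8 * zeta 5 - 9 / 2 * b + 15 / 2 * a"
    unfolding u2_def unfolding pi2 pi4 abc by (simp add: field_simps)
  have U4: "u5 - u4 = - (31 / 8) * zeta 5 + 6 * b + 15 / 2 * a"
    unfolding u4_def unfolding pi2 pi4 abc by (simp add: field_simps)
  have "u6 + 3 * u5 + 2 * u1 = - (93 / 4) * zeta 5 + 6 * pi\<^sup>2 * zeta 3 + ln 2 * pi ^ 4 / 2 + 96 * Li5 (1 / 2)
      - 4 / 5 * ln 2 ^ 5 + 32 * ln 2 ^ 3 * zeta 2 + 192 * ln 2 * zeta 4"
    by (rule sums_unique2[OF _ e03]) (intro sums_add sums_mult u1 u5 u6)
  then have E03: "u6 + 3 * u5 + 2 * u1 = - (93 / 4) * zeta 5 + 36 * b + 237 * a + 96 * Li5 (1 / 2) - 4 / 5 * ln 2 ^ 5 + 32 * c"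
    unfolding pi2 pi4 abc by (simp add: algebra_simps)
  have "4 * u1 + 3 * u2 + u3 + 2 * u4 + 2 * u5 - 2 * zeta 2 * (ln 2 * pi\<^sup>2 - 7 / 2 * zeta 3)
      - 4 * zeta 3 * (3 * zeta 2) - 2 * zeta 2 * (7 * zeta 3 + (ln 2 * pi\<^sup>2 - 7 / 2 * zeta 3))
      = 8 * pi\<^sup>2 * ln 2 ^ 3 - 2 * pi\<^sup>2 * zeta 3"
    by (rule sums_unique2[OF _ emix]) (intro sums_add sums_diff sums_mult u1 u2 u3 u4 u5 e10 e2 v)
  \<comment> \<open>The contributions of \<open>b\<close> cancel in total, leaving only
    \<open>a\<close> and \<open>c\<close> in this equation.\<close>
  moreover have "2 * zeta 2 * (ln 2 * pi\<^sup>2 - 7 / 2 * zeta 3) = 30 * a - 7 * b"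
    "2 * zeta 2 * (7 * zeta 3 + (ln 2 * pi\<^sup>2 - 7 / 2 * zeta 3)) = 30 * a + 7 * b"
    "4 * zeta 3 * (3 * zeta 2) = 12 * b" "8 * pi\<^sup>2 * ln 2 ^ 3 = 48 * c" "2 * pi\<^sup>2 * zeta 3 = 12 * b"
    unfolding pi2 pi4 abc by (simp_all add: algebra_simps z22)
  ultimately have Emix: "4 * u1 + 3 * u2 + u3 + 2 * u4 + 2 * u5 = 60 * a + 48 * c"
    by linarith
  have ER1: "u6 - 3 * u3 + 6 * u4 - 3 * u5 + 3 * u2 + 2 * u1 - 6 * ?u7 = 186 * zeta 5"
    by (rule sums_unique2[OF _ eR1]) (intro sums_add sums_diff sums_mult u1 u2 u3 u4 u5 u6 u7)
  have "u5 - u4 - u2 - u1 + 2 * ?u7 = 21 * zeta 2 * zeta 3 - 31 * zeta 5"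
    by (rule sums_unique2[OF _ eR2]) (intro sums_add sums_diff sums_mult u1 u2 u4 u5 u7)
  then have ER2: "u5 - u4 - u2 - u1 + 2 * ?u7 = 21 * b - 31 * zeta 5"
    by (simp add: b_def mult.assoc)
  have vals: "u1 = 217 / 8 * zeta 5 - 9 / 2 * zeta 2 * zeta 3 - 16 * Li5 (1 / 2) - 19 / 2 * ln 2 * zeta 4
         + 8 / 3 * ln 2 ^ 3 * zeta 2 + 2 / 15 * ln 2 ^ 5"
    "u2 = 31 / 4 * zeta 5 + 3 / 2 * zeta 2 * zeta 3 - 16 * Li5 (1 / 2) - 2 * ln 2 * zeta 4
         + 8 / 3 * ln 2 ^ 3 * zeta 2 + 2 / 15 * ln 2 ^ 5"
    "u3 = - 62 * zeta 5 - 21 / 2 * zeta 2 * zeta 3 + 48 * Li5 (1 / 2) + 81 * ln 2 * zeta 4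
         + 8 * ln 2 ^ 3 * zeta 2 - 2 / 5 * ln 2 ^ 5"
    "u4 = - (31 / 2) * zeta 5 + 3 * zeta 2 * zeta 3 + 16 * Li5 (1 / 2) + 2 * ln 2 * zeta 4
         + 16 / 3 * ln 2 ^ 3 * zeta 2 - 2 / 15 * ln 2 ^ 5"
    "u5 = - (155 / 8) * zeta 5 + 9 * zeta 2 * zeta 3 + 16 * Li5 (1 / 2) + 19 / 2 * ln 2 * zeta 4
         + 16 / 3 * ln 2 ^ 3 * zeta 2 - 2 / 15 * ln 2 ^ 5"
    "u6 = - (155 / 8) * zeta 5 + 18 * zeta 2 * zeta 3 + 80 * Li5 (1 / 2) + 455 / 2 * ln 2 * zeta 4
         + 32 / 3 * ln 2 ^ 3 * zeta 2 - 2 / 3 * ln 2 ^ 5"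
    unfolding mult.assoc abc[symmetric]
    by - (rule linear_system_solution[OF E03 Emix ER1 ER2 U2 U4 U7])+
  have summand: "4 ^ Suc k * x / (real (Suc k) ^ n * real (2 * Suc k choose Suc k)) = x * w k * r k ^ n" for k n x
    unfolding w_def conn_0_right r_def by (simp add: power_one_over mult_ac del: power_Suc of_nat_Suc binomial_Suc_Suc)
  show ?thesis
    unfolding Let_def vals[symmetric] mult.assoc[of "4 ^ _"] summand
    using u1 u2 u3 u4 u5 u6 by (simp only: H_def G2_def G3_def)
qed

end
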